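(* Let $N\ge 1$, let $e_1$ be the first standard basis vector of $\mathbb{R}^N$, and let $$\Omega=B_{1/2}(e_1)\cup B_{1/4}\big(-\tfrac12 e_1\big).$$ For $s\in(0,1)$, let $\lambda_s$ be the first eigenvalue of $$-\Delta u=\lambda(-\Delta)^s u\ \text{ in }\Omega,\qquad u=0\ \text{ in }\mathbb{R}^N\setminus\Omega,$$ namely $$\lambda_s=\min_{u\in H^1_0(\Omega)\setminus\{0\}}\frac{\int_\Omega|\nabla u|^2}{[u]_s^2}.$$ Then $\lambda_s$ is simple, provided that $s$ is small enough.
   Context: Functions in $H^1_0(\Omega)$ are extended by zero outside $\Omega$. The fractional Laplacian and seminorm are $$(-\Delta)^su(x)=c_{N,s}\int\frac{2u(x)-u(x+y)-u(x-y)}{|y|^{N+2s}}\,dy,\qquad [u]_s^2=c_{N,s}\iint\frac{|u(x)-u(y)|^2}{|x-y|^{N+2s}}\,dx\,dy,$$ with $c_{N,s}=\frac{2^{2s-1}\Gamma(\frac{N+2s}{2})}{\pi^{N/2}\Gamma(2-s)}s(1-s)$. Let $\langle u,v\rangle_s$ denote the associated bilinear form. An eigenfunction for $\lambda$ is $u\in H^1_0(\Omega)\setminus\{0\}$ with $$\int_\Omega\nabla u\cdot\nabla v=\lambda\langle u,v\rangle_s\quad\text{for all } v\in C_c^\infty(\Omega).$$ Simple means the eigenfunctions together with $0$ form a one-dimensional space. *)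

theory Defs
  imports "HOL-Analysis.Analysis"
begin

text \<open>C^k functions on the whole space (functions are extended by zero outside Omega).\<close>
fun Ck :: "nat \<Rightarrow> ('a::euclidean_space \<Rightarrow> real) \<Rightarrow> bool" where
  "Ck 0 f = continuous_on UNIV f"
| "Ck (Suc k) f = ((\<forall>x. f differentiable (at x)) \<and>
      (\<forall>b\<in>Basis. Ck k (\<lambda>x. frechet_derivative f (at x) b)))"

definition smooth_fun :: "('a::euclidean_space \<Rightarrow> real) \<Rightarrow> bool" where
  "smooth_fun f \<longleftrightarrow> (\<forall>k. Ck k f)"

definition test_fun :: "'a::euclidean_space set \<Rightarrow> ('a \<Rightarrow> real) \<Rightarrow> bool" where
  "test_fun \<Omega> \<phi> \<longleftrightarrow> smooth_fun \<phi> \<and> compact (closure {x. \<phi> x \<noteq> 0})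
      \<and> closure {x. \<phi> x \<noteq> 0} \<subseteq> \<Omega>"

definition grad :: "('a::euclidean_space \<Rightarrow> real) \<Rightarrow> 'a \<Rightarrow> 'a" where
  "grad f x = (\<Sum>b\<in>Basis. frechet_derivative f (at x) b *\<^sub>R b)"

text \<open>H10 Omega u G: u belongs to H^1_0(Omega) (closure of C_c^infty(Omega) in the
  H^1 norm) and G is its (weak) gradient: there are test functions converging to u in L^2
  whose gradients converge to G in L^2.\<close>
definition H10 :: "'a::euclidean_space set \<Rightarrow> ('a \<Rightarrow> real) \<Rightarrow> ('a \<Rightarrow> 'a) \<Rightarrow> bool" where
  "H10 \<Omega> u G \<longleftrightarrow> u \<in> borel_measurable lborel \<and> G \<in> borel_measurable lborel \<and>
     (\<exists>\<phi>::nat \<Rightarrow> 'a \<Rightarrow> real. (\<forall>k. test_fun \<Omega> (\<phi> k)) \<and>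
        ((\<lambda>k. \<integral>\<^sup>+ x. ennreal ((\<phi> k x - u x)\<^sup>2) \<partial>lborel) \<longlonglongrightarrow> 0) \<and>
        ((\<lambda>k. \<integral>\<^sup>+ x. ennreal ((norm (grad (\<phi> k) x - G x))\<^sup>2) \<partial>lborel) \<longlonglongrightarrow> 0))"

definition cNs :: "nat \<Rightarrow> real \<Rightarrow> real" where
  "cNs N s = 2 powr (2 * s - 1) * Gamma ((real N + 2 * s)/2) / (pi powr (real N / 2) * Gamma (2 - s))
      * s * (1 - s)"

definition frac_form :: "real \<Rightarrow> ('a::euclidean_space \<Rightarrow> real) \<Rightarrow> ('a \<Rightarrow> real) \<Rightarrow> real" where
  "frac_form s u v = cNs DIM('a) s *
     (\<integral>z. (u (fst z) - u (snd z)) * (v (fst z) - v (snd z)) /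
            norm (fst z - snd z) powr (real DIM('a) + 2 * s) \<partial>(lborel \<Otimes>\<^sub>M lborel))"

definition frac_seminorm_sq :: "real \<Rightarrow> ('a::euclidean_space \<Rightarrow> real) \<Rightarrow> real" where
  "frac_seminorm_sq s u = cNs DIM('a) s *
     (\<integral>z. (u (fst z) - u (snd z))\<^sup>2 /
            norm (fst z - snd z) powr (real DIM('a) + 2 * s) \<partial>(lborel \<Otimes>\<^sub>M lborel))"

definition eigenfunction :: "'a::euclidean_space set \<Rightarrow> real \<Rightarrow> real \<Rightarrow> ('a \<Rightarrow> real) \<Rightarrow> bool" where
  "eigenfunction \<Omega> s lam u \<longleftrightarrow> (\<exists>G. H10 \<Omega> u G \<and> \<not> (AE x in lborel. u x = 0) \<and>
     (\<forall>v. test_fun \<Omega> v \<longrightarrow>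
        (\<integral>x. G x \<bullet> grad v x \<partial>lborel) = lam * frac_form s u v))"

definition first_eigenvalue :: "'a::euclidean_space set \<Rightarrow> real \<Rightarrow> real" where
  "first_eigenvalue \<Omega> s = Inf {(\<integral>x. (norm (G x))\<^sup>2 \<partial>lborel) / frac_seminorm_sq s u
       | u G. H10 \<Omega> u G \<and> \<not> (AE x in lborel. u x = 0)}"

definition simple_eigenvalue :: "'a::euclidean_space set \<Rightarrow> real \<Rightarrow> real \<Rightarrow> bool" where
  "simple_eigenvalue \<Omega> s lam \<longleftrightarrow> (\<exists>\<psi>. eigenfunction \<Omega> s lam \<psi> \<and>
     (\<forall>u. eigenfunction \<Omega> s lam u \<longrightarrow> (\<exists>c. AE x in lborel. u x = c * \<psi> x)))"

definition Omega_domain :: "'a::euclidean_space \<Rightarrow> 'a set" where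
  "Omega_domain e = ball e (1/2) \<union> ball (- (1/2) *\<^sub>R e) (1/4)"

end

theory Submission
  imports Defs
begin

text \<open>As \<open>s \<rightarrow> 0\<close>, \<open>[u]\<^sub>s\<^sup>2\<close> tends to \<open>\<integral>u\<^sup>2\<close>, so the problem degenerates to the Dirichlet Laplacian,
  whose first eigenvalue on the two disjoint balls is that of the larger ball. A gap above it gives
  \<open>\<mu> \<integral>u\<^sup>2 \<le> \<integral>|\<nabla>u|\<^sup>2 + M (\<integral>r u)\<^sup>2\<close> for some weight \<open>r\<close>, together with a test function of Rayleigh quotient
  below \<open>\<mu>\<close>. Splitting the double integral at \<open>|x - y| = R\<close> gives \<open>A \<integral>u\<^sup>2 \<le> [u]\<^sub>s\<^sup>2 \<le> A \<integral>u\<^sup>2 + \<epsilon> \<integral>|\<nabla>u|\<^sup>2\<close> with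
  \<open>\<epsilon> / A \<rightarrow> 0\<close>. Hence, for small \<open>s\<close>, the nonnegative form \<open>\<integral>|\<nabla>u|\<^sup>2 - \<lambda>\<^sub>s [u]\<^sub>s\<^sup>2\<close> is coercive on the hyperplane
  \<open>\<integral>r u = 0\<close>. This yields existence of a minimiser without compactness and leaves room for only one.

  The gap comes from the radial eigenfunction \<open>\<phi>\<close> of the larger ball: writing \<open>u = \<phi> v\<close> turns
  \<open>\<integral>|\<nabla>u|\<^sup>2 - \<kappa> \<integral>u\<^sup>2\<close> into \<open>\<integral>\<phi>\<^sup>2 |\<nabla>v|\<^sup>2\<close>, and the measure with density \<open>\<phi>\<^sup>2\<close> satisfies a Poincare inequality
  because \<open>\<phi>\<close> is quasi-concave. On the smaller ball the first eigenvalue is four times larger.\<close>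

section \<open>Square-integrable functions\<close>

text \<open>The familiar route to simplicity, replacing \<open>u\<close> by \<open>|u|\<close>, is
  blocked: the fractional seminorm of \<open>|u|\<close> is at most that of \<open>u\<close>, and it
  stands in the denominator, so the quotient may increase. The domain is also disconnected.
  Simplicity is therefore inherited from the limit problem, where it is due to the different radii,
  through a rank-one argument: two independent eigenfunctions would span a plane on which the
  nonnegative form vanishes, and every plane meets the hyperplane \<open>\<integral>r u = 0\<close>
  in a nonzero vector, against coercivity. A test function with quotient \<open>q < \<mu>\<close>
  and the lower bound on the seminorm give \<open>\<lambda> A \<le> q\<close>, with \<open>A\<close>
  as above. On the hyperplane the form is then at least
  \<open>(1 - q / \<mu>) \<integral>|\<nabla>u|^2\<close>, up to an error governed by
  \<open>\<epsilon> / A\<close>. That ratio is found by comparing the kernel inside and outside one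
  radius with the mass \<open>I\<close> of a single dyadic annulus: the inner part is of order
  \<open>I\<close>, the outer part is \<open>I / (1 - 2^(-2s))\<close>. Estimates are proved for
  test functions, whose supports can be split and translated, and reach the Sobolev space by
  limits.\<close>

abbreviation sqint :: "'a measure \<Rightarrow> ('a \<Rightarrow> 'b::real_normed_vector) \<Rightarrow> real" where
  "sqint M f \<equiv> \<integral>x. (norm (f x))\<^sup>2 \<partial>M"

abbreviation nnsqint :: "'a measure \<Rightarrow> ('a \<Rightarrow> 'b::real_normed_vector) \<Rightarrow> ennreal" where
  "nnsqint M f \<equiv> \<integral>\<^sup>+x. ennreal ((norm (f x))\<^sup>2) \<partial>M"

definition L2 :: "'a measure \<Rightarrow> ('a \<Rightarrow> 'b::euclidean_space) \<Rightarrow> bool" where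
  "L2 M f \<longleftrightarrow> f \<in> borel_measurable M \<and> integrable M (\<lambda>x. (norm (f x))\<^sup>2)"

lemma L2_measurable [measurable_dest]: "L2 M f \<Longrightarrow> f \<in> borel_measurable M"
  and L2_integrable: "L2 M f \<Longrightarrow> integrable M (\<lambda>x. (norm (f x))\<^sup>2)"
  by (auto simp: L2_def)

lemma L2_nn_integral_eq:
  "L2 M f \<Longrightarrow> nnsqint M f = ennreal (sqint M f)"
  by (simp add: L2_def nn_integral_eq_integral)

lemma L2_iff_nn_integral:
  assumes "f \<in> borel_measurable M"
  shows "L2 M f \<longleftrightarrow> (nnsqint M f) < \<infinity>"
  using assms by (simp add: L2_def integrable_iff_bounded)

lemma L2_I_nn_integral:
  assumes "f \<in> borel_measurable M" "nnsqint M f \<le> ennreal C" "0 \<le> C"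
  shows "L2 M f" "sqint M f \<le> C"
proof -
  show *: "L2 M f"
    using assms by (simp add: L2_iff_nn_integral le_less_trans)
  show "sqint M f \<le> C"
    using assms L2_nn_integral_eq[OF *] by simp
qed

text \<open>The parallelogram law with the square of the difference dropped.\<close>

lemma norm_lin_comb_sq_le:
  fixes u v :: "'b::real_inner"
  shows "(norm (a *\<^sub>R u + b *\<^sub>R v))\<^sup>2 \<le> 2 * a\<^sup>2 * (norm u)\<^sup>2 + 2 * b\<^sup>2 * (norm v)\<^sup>2"
proof -
  have "(norm (a *\<^sub>R u + b *\<^sub>R v))\<^sup>2 + (norm (a *\<^sub>R u - b *\<^sub>R v))\<^sup>2
      = 2 * (norm (a *\<^sub>R u))\<^sup>2 + 2 * (norm (b *\<^sub>R v))\<^sup>2"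
    unfolding power2_norm_eq_inner by (simp add: algebra_simps)
  then have "(norm (a *\<^sub>R u + b *\<^sub>R v))\<^sup>2 \<le> 2 * (norm (a *\<^sub>R u))\<^sup>2 + 2 * (norm (b *\<^sub>R v))\<^sup>2"
    using zero_le_power2[of "norm (a *\<^sub>R u - b *\<^sub>R v)"] by linarith
  then show ?thesis by (simp add: power_mult_distrib)
qed

lemma L2_lin:
  assumes "L2 M f" "L2 M g"
  shows "L2 M (\<lambda>x. a *\<^sub>R f x + b *\<^sub>R g x)"
proof -
  have [measurable]: "f \<in> borel_measurable M" "g \<in> borel_measurable M"
    using assms by (auto simp: L2_def)
  have "integrable M (\<lambda>x. 2 * a\<^sup>2 * (norm (f x))\<^sup>2 + 2 * b\<^sup>2 * (norm (g x))\<^sup>2)"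
    using assms by (auto simp: L2_def)
  then have "integrable M (\<lambda>x. (norm (a *\<^sub>R f x + b *\<^sub>R g x))\<^sup>2)"
    by (rule Bochner_Integration.integrable_bound) (use norm_lin_comb_sq_le in \<open>force+\<close>)
  then show ?thesis by (simp add: L2_def)
qed

lemma L2_diff: "L2 M f \<Longrightarrow> L2 M g \<Longrightarrow> L2 M (\<lambda>x. f x - g x)"
  using L2_lin[of M f g 1 "-1"] by simp

lemma L2_norm_lin_le:
  assumes "L2 M f" "L2 M g"
  shows "sqint M (\<lambda>x. a *\<^sub>R f x + b *\<^sub>R g x)
    \<le> 2 * a\<^sup>2 * sqint M f + 2 * b\<^sup>2 * sqint M g"
proof -
  have "sqint M (\<lambda>x. a *\<^sub>R f x + b *\<^sub>R g x)
     \<le> (\<integral>x. 2 * a\<^sup>2 * (norm (f x))\<^sup>2 + 2 * b\<^sup>2 * (norm (g x))\<^sup>2 \<partial>M)"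
    using assms L2_lin[OF assms, of a b] norm_lin_comb_sq_le
    by (intro integral_mono) (auto simp: L2_def)
  also have "\<dots> = 2 * a\<^sup>2 * sqint M f + 2 * b\<^sup>2 * sqint M g"
    using assms by (simp add: L2_def)
  finally show ?thesis .
qed

lemma L2_inner_integrable:
  assumes "L2 M f" "L2 M g"
  shows "integrable M (\<lambda>x. f x \<bullet> g x)"
proof -
  have [measurable]: "f \<in> borel_measurable M" "g \<in> borel_measurable M"
    using assms by (auto simp: L2_def)
  have "integrable M (\<lambda>x. (norm (f x))\<^sup>2 + (norm (g x))\<^sup>2)"
    using assms by (auto simp: L2_def)
  then show ?thesis
  proof (rule Bochner_Integration.integrable_bound)
    show "AE x in M. norm (f x \<bullet> g x) \<le> norm ((norm (f x))\<^sup>2 + (norm (g x))\<^sup>2)"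
    proof (rule AE_I2)
      fix x
      have "\<bar>f x \<bullet> g x\<bar> \<le> norm (f x) * norm (g x)" by (rule Cauchy_Schwarz_ineq2)
      also have "\<dots> \<le> (norm (f x))\<^sup>2 + (norm (g x))\<^sup>2"
        using sum_squares_bound[of "norm (f x)" "norm (g x)"]
          mult_nonneg_nonneg[OF norm_ge_zero[of "f x"] norm_ge_zero[of "g x"]] by linarith
      finally show "norm (f x \<bullet> g x) \<le> norm ((norm (f x))\<^sup>2 + (norm (g x))\<^sup>2)" by simp
    qed
  qed simp
qed

lemma integral_norm_sq_eq_inner: "sqint M (\<lambda>x. f x :: 'b::euclidean_space) = (\<integral>x. f x \<bullet> f x \<partial>M)"
  by (simp add: power2_norm_eq_inner)

lemma L2_inner_lin:
  assumes "L2 M f" "L2 M g" "L2 M h"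
  shows "(\<integral>x. (a *\<^sub>R f x + b *\<^sub>R g x) \<bullet> h x \<partial>M)
    = a * (\<integral>x. f x \<bullet> h x \<partial>M) + b * (\<integral>x. g x \<bullet> h x \<partial>M)"
  using L2_inner_integrable[OF assms(1,3)] L2_inner_integrable[OF assms(2,3)]
  by (simp add: inner_add_left)

text \<open>For \<open>c > 0\<close> the minimum, at \<open>t = - b / c\<close>, is
  \<open>a - b\<^sup>2 / c\<close>. This is the common core of the Cauchy-Schwarz inequalities for
  integrals and for the abstract form of \<open>coercive_forms\<close>.\<close>

lemma quadratic_nonneg_discrim:
  fixes a b c :: real
  assumes "\<And>t. 0 \<le> a + 2 * t * b + t\<^sup>2 * c" "0 \<le> c"
  shows "b\<^sup>2 \<le> a * c"
proof (cases "c = 0")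
  case True
  have "b = 0"
  proof (rule ccontr)
    assume "b \<noteq> 0"
    \<comment> \<open>With \<open>c = 0\<close> the expression is affine in \<open>t\<close>; this
      value of \<open>t\<close> makes it -1.\<close>
    then show False
      using assms(1)[of "-(a+1)/(2*b)"] True by (simp add: field_simps)
  qed
  with True show ?thesis by simp
next
  case False
  with assms(2) have c: "c > 0" by simp
  have "0 \<le> (a + 2 * (-b/c) * b + (-b/c)\<^sup>2 * c) * c"
    using assms(1)[of "-b/c"] c by simp
  also have "\<dots> = a * c - b\<^sup>2"
    using c by (simp add: field_simps power2_eq_square)
  finally show ?thesis by simp
qed

lemma L2_Cauchy_Schwarz:
  assumes "L2 M f" "L2 M g"
  shows "(\<integral>x. f x \<bullet> g x \<partial>M)\<^sup>2 \<le> sqint M f * sqint M g"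
proof (rule quadratic_nonneg_discrim)
  fix t :: real
  have i: "integrable M (\<lambda>x. f x \<bullet> g x)" using L2_inner_integrable[OF assms] .
  have "0 \<le> sqint M (\<lambda>x. f x + t *\<^sub>R g x)" by simp
  also have "\<dots> = (\<integral>x. (norm (f x))\<^sup>2 + 2 * t * (f x \<bullet> g x) + t\<^sup>2 * (norm (g x))\<^sup>2 \<partial>M)"
    unfolding power2_norm_eq_inner
    by (intro Bochner_Integration.integral_cong) (auto simp: algebra_simps inner_commute power2_eq_square)
  also have "\<dots> = sqint M f + 2 * t * (\<integral>x. f x \<bullet> g x \<partial>M)
      + t\<^sup>2 * sqint M g"
    using i assms by (simp add: L2_def)
  finally show "0 \<le> sqint M f + 2 * t * (\<integral>x. f x \<bullet> g x \<partial>M)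
      + t\<^sup>2 * sqint M g" .
qed simp

lemma L2_tendsto_inner:
  assumes "\<And>k. L2 M (f k)" "L2 M f'" "L2 M g"
    and lim: "(\<lambda>k. sqint M (\<lambda>x. f k x - f' x)) \<longlonglongrightarrow> 0"
  shows "(\<lambda>k. \<integral>x. f k x \<bullet> g x \<partial>M) \<longlonglongrightarrow> (\<integral>x. f' x \<bullet> g x \<partial>M)"
proof -
  have d: "L2 M (\<lambda>x. f k x - f' x)" for k using L2_diff[OF assms(1,2)] .
  have eq: "(\<integral>x. f k x \<bullet> g x \<partial>M) - (\<integral>x. f' x \<bullet> g x \<partial>M) = (\<integral>x. (f k x - f' x) \<bullet> g x \<partial>M)" for k
    using L2_inner_lin[OF assms(1)[of k] assms(2,3), of 1 "-1"] by simp
  have "(\<lambda>k. ((\<integral>x. f k x \<bullet> g x \<partial>M) - (\<integral>x. f' x \<bullet> g x \<partial>M))\<^sup>2) \<longlonglongrightarrow> 0"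
  proof (rule tendsto_sandwich[OF _ _ tendsto_const])
    show "\<forall>\<^sub>F k in sequentially. ((\<integral>x. f k x \<bullet> g x \<partial>M) - (\<integral>x. f' x \<bullet> g x \<partial>M))\<^sup>2
       \<le> sqint M (\<lambda>x. f k x - f' x) * sqint M g"
      unfolding eq using L2_Cauchy_Schwarz[OF d assms(3)] by simp
    show "(\<lambda>k. (sqint M (\<lambda>x. f k x - f' x)) * sqint M g) \<longlonglongrightarrow> 0"
      using tendsto_mult_left_zero[OF lim] .
  qed auto
  then have "(\<lambda>k. (\<integral>x. f k x \<bullet> g x \<partial>M) - (\<integral>x. f' x \<bullet> g x \<partial>M)) \<longlonglongrightarrow> 0"
    by (simp add: power_tendsto_0_iff)
  then show ?thesis by (simp add: LIM_zero_iff)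
qed

lemma L2_tendsto_norm:
  assumes "\<And>k. L2 M (f k)" "L2 M f'"
    and lim: "(\<lambda>k. sqint M (\<lambda>x. f k x - f' x)) \<longlonglongrightarrow> 0"
  shows "(\<lambda>k. sqint M (f k)) \<longlonglongrightarrow> (sqint M f')"
proof -
  have "sqint M (f k) = sqint M (\<lambda>x. f k x - f' x)
      + 2 * (\<integral>x. f k x \<bullet> f' x \<partial>M) - sqint M f'" for k
  proof -
    have "sqint M (\<lambda>x. f k x - f' x)
      = (\<integral>x. (norm (f k x))\<^sup>2 - 2 * (f k x \<bullet> f' x) + (norm (f' x))\<^sup>2 \<partial>M)"
      unfolding power2_norm_eq_inner
      by (intro Bochner_Integration.integral_cong) (auto simp: algebra_simps inner_commute)
    also have "\<dots> = sqint M (f k) - 2 * (\<integral>x. f k x \<bullet> f' x \<partial>M) + sqint M f'"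
      using L2_inner_integrable[OF assms(1)[of k] assms(2)] assms(1)[of k] assms(2)
      by (simp add: L2_def)
    finally show ?thesis by simp
  qed
  moreover have "(\<lambda>k. (sqint M (\<lambda>x. f k x - f' x))
      + 2 * (\<integral>x. f k x \<bullet> f' x \<partial>M) - sqint M f')
     \<longlonglongrightarrow> 0 + 2 * (\<integral>x. f' x \<bullet> f' x \<partial>M) - sqint M f'"
    by (intro tendsto_intros lim L2_tendsto_inner assms)
  ultimately show ?thesis by (simp add: power2_norm_eq_inner)
qed

lemma L2_AE_zero:
  assumes "L2 M f" "sqint M f = 0"
  shows "AE x in M. f x = 0"
  using assms integral_nonneg_eq_0_iff_AE[of M "\<lambda>x. (norm (f x))\<^sup>2"] by (simp add: L2_def)

text \<open>Weighted arithmetic-geometric mean: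
  \<open>a k \<le> 2^k * (a k)\<^sup>2 + (1/2)^k\<close>. It turns control of squared distances, all
  that an L2 estimate offers, into absolute convergence.\<close>

lemma summable_of_weighted_squares:
  fixes a :: "nat \<Rightarrow> real"
  assumes "summable (\<lambda>k. 2^k * (a k)\<^sup>2)" "\<And>k. 0 \<le> a k"
  shows "summable a"
proof (rule summable_comparison_test')
  show "summable (\<lambda>k. 2^k * (a k)\<^sup>2 + (1/2)^k)"
    using assms(1) by (intro summable_add) (auto simp: summable_geometric)
  fix k
  have "2 * ((2::real)^k * a k) * 1 \<le> (2^k * a k)\<^sup>2 + 1\<^sup>2" by (rule sum_squares_bound)
  then have "(2::real)^k * a k \<le> (2^k * a k)\<^sup>2 + 1"
    using assms(2)[of k] by (smt (verit) mult_nonneg_nonneg one_power2 zero_le_power)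
  then have "a k \<le> ((2^k * a k)\<^sup>2 + 1) / 2^k" by (simp add: field_simps)
  also have "\<dots> = 2^k * (a k)\<^sup>2 + (1/2)^k" by (simp add: field_simps power2_eq_square)
  finally show "norm (a k) \<le> 2^k * (a k)\<^sup>2 + (1/2)^k" using assms(2)[of k] by simp
qed

text \<open>Riesz--Fischer at a geometric rate, so that no subsequence has to be extracted.\<close>
lemma L2_complete_fast:
  fixes f :: "nat \<Rightarrow> 'a \<Rightarrow> 'b::euclidean_space"
  assumes L: "\<And>k. L2 M (f k)" and B: "0 \<le> B"
    and fast: "\<And>k m. k \<le> m \<Longrightarrow> sqint M (\<lambda>x. f m x - f k x) \<le> B * (1/8)^k"
  shows "\<exists>f'. f' \<in> borel_measurable M \<and> (AE x in M. (\<lambda>k. f k x) \<longlonglongrightarrow> f' x) \<and>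
    (\<forall>k. (nnsqint M (\<lambda>x. f k x - f' x)) \<le> ennreal (B * (1/8)^k))"
proof -
  have [measurable]: "f k \<in> borel_measurable M" for k using L by (simp add: L2_def)
  have d: "L2 M (\<lambda>x. f m x - f k x)" for k m using L2_diff[OF L L] .
  have nn: "nnsqint M (\<lambda>x. f m x - f k x) \<le> ennreal (B * (1/8)^k)" if "k \<le> m" for k m
    unfolding L2_nn_integral_eq[OF d] using fast[OF that] by (rule ennreal_leI)
  have "(\<integral>\<^sup>+x. (\<Sum>k. ennreal (2^k * (norm (f (Suc k) x - f k x))\<^sup>2)) \<partial>M)
     = (\<Sum>k. (\<integral>\<^sup>+x. ennreal (2^k * (norm (f (Suc k) x - f k x))\<^sup>2) \<partial>M))"
    by (rule nn_integral_suminf) simp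
  \<comment> \<open>The weight \<open>2^k\<close> against the rate \<open>(1/8)^k\<close> leaves a
    convergent geometric series, so the weighted sum of squares is finite almost everywhere.\<close>
  also have "\<dots> \<le> (\<Sum>k. ennreal (B * (1/4)^k))"
  proof (rule suminf_le)
    fix k
    have "(\<integral>\<^sup>+x. ennreal (2^k * (norm (f (Suc k) x - f k x))\<^sup>2) \<partial>M)
       = ennreal (2^k) * nnsqint M (\<lambda>x. f (Suc k) x - f k x)"
      by (subst nn_integral_cmult[symmetric]) (auto simp: ennreal_mult')
    also have "\<dots> \<le> ennreal (2^k) * ennreal (B * (1/8)^k)"
      by (intro mult_left_mono nn) auto
    also have "\<dots> = ennreal (B * (1/4)^k)"
      using B by (simp add: ennreal_mult[symmetric] power_mult_distrib[symmetric] mult.left_commute)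
    finally show "(\<integral>\<^sup>+x. ennreal (2^k * (norm (f (Suc k) x - f k x))\<^sup>2) \<partial>M) \<le> ennreal (B * (1/4)^k)" .
  qed auto
  also have "\<dots> = ennreal (\<Sum>k. B * (1/4)^k)"
    using B by (intro suminf_ennreal2) (auto intro!: summable_mult summable_geometric)
  also have "\<dots> < \<infinity>" by simp
  finally have "(\<integral>\<^sup>+x. (\<Sum>k. ennreal (2^k * (norm (f (Suc k) x - f k x))\<^sup>2)) \<partial>M) \<noteq> \<infinity>" by simp
  then have "AE x in M. (\<Sum>k. ennreal (2^k * (norm (f (Suc k) x - f k x))\<^sup>2)) \<noteq> \<infinity>"
    by (intro nn_integral_PInf_AE) auto
  then have conv: "AE x in M. convergent (\<lambda>k. f k x)"
  proof (rule AE_mp, intro AE_I2 impI)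
    fix x assume "(\<Sum>k. ennreal (2^k * (norm (f (Suc k) x - f k x))\<^sup>2)) \<noteq> \<infinity>"
    then have "summable (\<lambda>k. 2^k * (norm (f (Suc k) x - f k x))\<^sup>2)"
      by (intro summable_suminf_not_top) (auto simp: infinity_ennreal_def)
    then have "summable (\<lambda>k. norm (f (Suc k) x - f k x))"
      by (rule summable_of_weighted_squares) auto
    then have "summable (\<lambda>k. f (Suc k) x - f k x)" by (rule summable_norm_cancel)
    then obtain l where "(\<lambda>n. \<Sum>k<n. f (Suc k) x - f k x) \<longlonglongrightarrow> l"
      by (auto simp: summable_def sums_def)
    then have "(\<lambda>n. f n x - f 0 x) \<longlonglongrightarrow> l"
      by (simp add: sum_lessThan_telescope[where f="\<lambda>k. f k x"])
    then have "(\<lambda>n. (f n x - f 0 x) + f 0 x) \<longlonglongrightarrow> l + f 0 x"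
      by (intro tendsto_intros)
    then show "convergent (\<lambda>k. f k x)" by (auto simp: convergent_def)
  qed
  define f' where "f' = (\<lambda>x. lim (\<lambda>k. f k x))"
  have [measurable]: "f' \<in> borel_measurable M"
    unfolding f'_def by (rule borel_measurable_lim_metric) simp
  have ae: "AE x in M. (\<lambda>k. f k x) \<longlonglongrightarrow> f' x"
    using conv by eventually_elim (simp add: f'_def convergent_LIMSEQ_iff)
  have "nnsqint M (\<lambda>x. f k x - f' x) \<le> ennreal (B * (1/8)^k)" for k
  proof -
    have "nnsqint M (\<lambda>x. f k x - f' x)
       = (\<integral>\<^sup>+x. liminf (\<lambda>m. ennreal ((norm (f m x - f k x))\<^sup>2)) \<partial>M)"
    proof (rule nn_integral_cong_AE, use ae in eventually_elim)
      fix x assume "(\<lambda>k. f k x) \<longlonglongrightarrow> f' x"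
      then have "(\<lambda>m. ennreal ((norm (f m x - f k x))\<^sup>2)) \<longlonglongrightarrow> ennreal ((norm (f' x - f k x))\<^sup>2)"
        by (intro tendsto_intros)
      from lim_imp_Liminf[OF _ this]
      show "ennreal ((norm (f k x - f' x))\<^sup>2) = liminf (\<lambda>m. ennreal ((norm (f m x - f k x))\<^sup>2))"
        by (simp add: norm_minus_commute)
    qed
    also have "\<dots> \<le> liminf (\<lambda>m. \<integral>\<^sup>+x. ennreal ((norm (f m x - f k x))\<^sup>2) \<partial>M)"
      by (rule nn_integral_liminf) simp
    also have "\<dots> \<le> limsup (\<lambda>m. \<integral>\<^sup>+x. ennreal ((norm (f m x - f k x))\<^sup>2) \<partial>M)"
      by (rule Liminf_le_Limsup) simp
    also have "\<dots> \<le> ennreal (B * (1/8)^k)"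
      by (rule Limsup_bounded) (use nn in \<open>auto simp: eventually_sequentially\<close>)
    finally show ?thesis .
  qed
  then show ?thesis using ae by (intro exI[of _ f']) auto
qed

section \<open>Functions of class C^k\<close>

lemma has_derivative_eq_frechet:
  "f differentiable (at x) \<Longrightarrow> (f has_derivative frechet_derivative f (at x)) (at x)"
  by (simp add: frechet_derivative_works)

lemma frechet_derivative_eqI:
  "(f has_derivative f') (at x) \<Longrightarrow> frechet_derivative f (at x) = f'"
  by (metis frechet_derivative_at)

lemma Ck_SucI:
  assumes "\<And>x. (f has_derivative f' x) (at x)" "\<And>b. b \<in> Basis \<Longrightarrow> Ck k (\<lambda>x. f' x b)"
  shows "Ck (Suc k) f"
  using assms frechet_derivative_eqI[OF assms(1)] by (auto simp: differentiable_def)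

lemma Ck_SucD: "Ck (Suc k) f \<Longrightarrow> Ck k f"
proof (induction k arbitrary: f)
  case 0
  then show ?case
    by (auto intro!: continuous_at_imp_continuous_on differentiable_imp_continuous_within)
next
  case (Suc k)
  then show ?case by auto
qed

lemma Ck_const: "Ck k (\<lambda>x. c)"
proof (induction k arbitrary: c)
  case (Suc k)
  show ?case by (rule Ck_SucI[where f'="\<lambda>x h. 0"]) (auto intro: Suc)
qed simp

lemma Ck_add: "Ck k f \<Longrightarrow> Ck k g \<Longrightarrow> Ck k (\<lambda>x. f x + g x)"
proof (induction k arbitrary: f g)
  case (Suc k)
  show ?case
    by (rule Ck_SucI[OF has_derivative_add]) (use Suc in \<open>auto intro!: has_derivative_eq_frechet\<close>)
qed (auto intro: continuous_intros)

lemma Ck_mult: "Ck k f \<Longrightarrow> Ck k g \<Longrightarrow> Ck k (\<lambda>x. f x * g x)"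
proof (induction k arbitrary: f g)
  case (Suc k)
  show ?case
    by (rule Ck_SucI[OF has_derivative_mult])
      (use Suc Ck_SucD[OF Suc.prems(1)] Ck_SucD[OF Suc.prems(2)]
        in \<open>auto intro!: has_derivative_eq_frechet Ck_add\<close>)
qed (auto intro: continuous_intros)

lemma Ck_inner_left: "Ck k (\<lambda>x. x \<bullet> c)"
proof (cases k)
  case (Suc k)
  show ?thesis unfolding Suc
    by (rule Ck_SucI[where f'="\<lambda>x h. h \<bullet> c"]) (auto intro!: derivative_eq_intros Ck_const)
qed (auto intro: continuous_intros)

lemma Ck_sum: "finite A \<Longrightarrow> (\<And>i. i \<in> A \<Longrightarrow> Ck k (f i)) \<Longrightarrow> Ck k (\<lambda>x. \<Sum>i\<in>A. f i x)"
  by (induction A rule: finite_induct) (auto intro: Ck_const Ck_add)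

lemma Ck_compose: "Ck k f \<Longrightarrow> Ck k g \<Longrightarrow> Ck k (\<lambda>x. g (f x))" for g :: "real \<Rightarrow> real"
proof (induction k arbitrary: f g)
  case 0
  then show ?case by (auto intro: continuous_on_compose2)
next
  case (Suc k)
  show ?case
  proof (rule Ck_SucI)
    fix x
    have df: "(f has_derivative frechet_derivative f (at x)) (at x)"
      using Suc.prems by (auto intro: has_derivative_eq_frechet)
    have dg: "(g has_derivative frechet_derivative g (at (f x))) (at (f x))"
      using Suc.prems by (auto intro: has_derivative_eq_frechet)
    \<comment> \<open>A linear map of the reals is multiplication by its value at 1, and 1 is the
      only basis vector along which \<open>Ck\<close> differentiates \<open>g\<close>. The chain
      rule thus becomes a product, to which \<open>Ck_mult\<close> applies.\<close>
    have lin: "frechet_derivative g (at (f x)) h = h * frechet_derivative g (at (f x)) 1" for h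
      using linear.scaleR[OF has_derivative_linear[OF dg], of h 1]
      by (simp only: real_scaleR_def mult_1_right)
    show "((\<lambda>x. g (f x)) has_derivative
        (\<lambda>h. frechet_derivative f (at x) h * frechet_derivative g (at (f x)) 1)) (at x)"
      by (rule has_derivative_eq_rhs[OF has_derivative_compose[OF df dg]]) (rule ext, rule lin)
  next
    fix b :: 'a assume "b \<in> Basis"
    then have "Ck k (\<lambda>x. frechet_derivative f (at x) b)" using Suc.prems(1) by simp
    moreover have "Ck k (\<lambda>y. frechet_derivative g (at y) 1)" using Suc.prems(2) by simp
    ultimately show "Ck k (\<lambda>x. frechet_derivative f (at x) b * frechet_derivative g (at (f x)) 1)"
      by (intro Ck_mult Suc.IH[OF Ck_SucD[OF Suc.prems(1)], of "\<lambda>y. frechet_derivative g (at y) 1"])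
  qed
qed

text \<open>Gluing: the function agrees with \<open>f\<close> on \<open>U\<close> and with 0 on
  \<open>V\<close>, and every boundary point of the open set \<open>U\<close> lies in
  \<open>V\<close>.\<close>

lemma has_derivative_restrict:
  assumes "open U" "open V" "U \<union> V = UNIV" "\<And>x. x \<in> U \<inter> V \<Longrightarrow> f x = 0"
    and d: "\<And>x. x \<in> U \<Longrightarrow> (f has_derivative f' x) (at x)"
  shows "((\<lambda>x. if x \<in> U then f x else 0) has_derivative (if x \<in> U then f' x else (\<lambda>h. 0))) (at x)"
    (is "(?g has_derivative _) _")
proof (cases "x \<in> U")
  case True
  have "(?g has_derivative f' x) (at x)"
    by (rule has_derivative_transform_within_open[OF d[OF True] \<open>open U\<close> True]) auto
  with True show ?thesis by simp
next
  case False
  then have "x \<in> V" using assms(3) by auto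
  have "((\<lambda>x. 0) has_derivative (\<lambda>h. 0)) (at x)" by simp
  then have "(?g has_derivative (\<lambda>h. 0)) (at x)"
    by (rule has_derivative_transform_within_open[OF _ \<open>open V\<close> \<open>x \<in> V\<close>]) (use assms(4) in auto)
  with False show ?thesis by simp
qed

lemma has_derivative_zero_open:
  assumes "open W" "x \<in> W" "\<And>y. y \<in> W \<Longrightarrow> f y = 0" "(f has_derivative f') (at x)"
  shows "f' h = 0"
proof -
  have "((\<lambda>x. 0) has_derivative f') (at x)"
    by (rule has_derivative_transform_within_open[OF assms(4,1,2)]) (use assms(3) in auto)
  then have "f' = (\<lambda>h. 0)" using has_derivative_unique has_derivative_const by blast
  then show ?thesis by simp
qed

lemma continuous_restrict:
  assumes "open U" "open V" "U \<union> V = UNIV" "\<And>x. x \<in> U \<inter> V \<Longrightarrow> f x = 0"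
    and "continuous_on U f"
  shows "continuous_on UNIV (\<lambda>x. if x \<in> U then f x else (0::'b::real_normed_vector))" (is "continuous_on _ ?g")
proof -
  have "continuous_on U ?g" using assms(5) by (rule continuous_on_eq) auto
  moreover have "continuous_on V ?g"
    by (rule continuous_on_eq[OF continuous_on_const[of _ 0]]) (use assms(4) in auto)
  ultimately show ?thesis
    using continuous_on_open_Un[OF assms(1,2)] assms(3) by metis
qed

text \<open>Here \<open>V\<close> is a neighbourhood of the complement of \<open>U\<close>, so \<open>f\<close> vanishes near the boundary of \<open>U\<close>.\<close>
lemma Ck_restrict:
  assumes "open U" "open V" "U \<union> V = UNIV"
  shows "Ck k f \<Longrightarrow> (\<And>x. x \<in> U \<inter> V \<Longrightarrow> f x = 0) \<Longrightarrow> Ck k (\<lambda>x. if x \<in> U then f x else 0)"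
proof (induction k arbitrary: f)
  case 0
  show ?case
    using continuous_restrict[OF assms 0(2)] 0(1) continuous_on_subset[of UNIV f U] by auto
next
  case (Suc k)
  have d: "(f has_derivative frechet_derivative f (at x)) (at x)" for x
    using Suc.prems by (auto intro: has_derivative_eq_frechet)
  show ?case
  proof (rule Ck_SucI)
    fix x show "((\<lambda>x. if x \<in> U then f x else 0) has_derivative
       (if x \<in> U then frechet_derivative f (at x) else (\<lambda>h. 0))) (at x)"
      by (rule has_derivative_restrict[OF assms Suc.prems(2) d])
  next
    fix b :: 'a assume "b \<in> Basis"
    have "Ck k (\<lambda>x. if x \<in> U then frechet_derivative f (at x) b else 0)"
    proof (rule Suc.IH)
      show "Ck k (\<lambda>x. frechet_derivative f (at x) b)" using Suc.prems \<open>b \<in> Basis\<close> by auto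
      show "frechet_derivative f (at x) b = 0" if "x \<in> U \<inter> V" for x
        by (rule has_derivative_zero_open[OF open_Int[OF assms(1,2)] that Suc.prems(2) d])
    qed
    also have "(\<lambda>x. if x \<in> U then frechet_derivative f (at x) b else 0)
       = (\<lambda>x. (if x \<in> U then frechet_derivative f (at x) else (\<lambda>h. 0)) b)" by auto
    finally show "Ck k (\<lambda>x. (if x \<in> U then frechet_derivative f (at x) else (\<lambda>h. 0)) b)" .
  qed
qed

lemma Ck_real_SucI:
  assumes "\<And>x. (f has_real_derivative f' x) (at x)" "Ck k f'"
  shows "Ck (Suc k) f"
  by (rule Ck_SucI[where f'="\<lambda>x h. h * f' x"])
    (use assms in \<open>auto simp: has_field_derivative_def mult.commute[of "f' _"] mult_commute_abs\<close>)

text \<open>Induction through termwise differentiation: \<open>diffs c\<close> again belongs to a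
  series that converges everywhere.\<close>

lemma Ck_powser:
  fixes c :: "nat \<Rightarrow> real"
  assumes "\<And>x. summable (\<lambda>n. c n * x^n)"
  shows "Ck k (\<lambda>x. \<Sum>n. c n * x^n)"
  using assms
proof (induction k arbitrary: c)
  case 0
  have "((\<lambda>x. \<Sum>n. c n * x^n) has_real_derivative (\<Sum>n. diffs c n * x^n)) (at x)" for x
    by (rule termdiffs_strong_converges_everywhere[OF 0])
  then show ?case by (auto intro!: DERIV_continuous_on)
next
  case (Suc k)
  show ?case
    by (rule Ck_real_SucI[OF termdiffs_strong_converges_everywhere[OF Suc.prems]])
      (auto intro!: Suc.IH termdiff_converges_all Suc.prems)
qed

text \<open>The classical function \<open>exp (- 1 / x)\<close>, continued by 0, with a polynomial
  factor in \<open>1 / x\<close>. Keeping the polynomial as a parameter makes the family closed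
  under differentiation, so smoothness is a plain induction.\<close>

definition flat :: "real poly \<Rightarrow> real \<Rightarrow> real" where
  "flat p x = (if x > 0 then poly p (1/x) * exp (-(1/x)) else 0)"

lemma tendsto_poly_exp_at_top:
  "((\<lambda>y. poly p y * exp (-y)) \<longlongrightarrow> (0::real)) at_top"
proof (induction p)
  case (pCons a p)
  have "((\<lambda>y. y^n * exp (-y)) \<longlongrightarrow> (0::real)) at_top" for n
    using tendsto_power_div_exp_0[of n] by (simp add: exp_minus divide_inverse)
  then have "((\<lambda>y. \<Sum>i\<le>degree (pCons a p). coeff (pCons a p) i * (y^i * exp (-y))) \<longlongrightarrow>
     (\<Sum>i\<le>degree (pCons a p). coeff (pCons a p) i * 0)) at_top"
    by (intro tendsto_intros)
  then show ?case by (simp add: poly_altdef sum_distrib_right mult.assoc)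
qed simp

lemma flat_tendsto_0: "(flat p \<longlongrightarrow> 0) (at 0)"
proof -
  have "((\<lambda>x. poly p (inverse x) * exp (-(inverse x))) \<longlongrightarrow> 0) (at_right 0)"
    by (rule filterlim_compose[OF tendsto_poly_exp_at_top filterlim_inverse_at_top_right])
  then have "(flat p \<longlongrightarrow> 0) (at_right 0)"
    by (rule Lim_transform_eventually)
      (auto simp: flat_def inverse_eq_divide eventually_at_filter)
  moreover have "(flat p \<longlongrightarrow> 0) (at_left 0)"
    by (rule Lim_transform_eventually[OF tendsto_const])
      (auto simp: flat_def eventually_at_filter)
  ultimately show ?thesis by (simp add: filterlim_split_at)
qed

text \<open>With \<open>y = 1 / x\<close>, differentiation in \<open>x\<close> is
  \<open>- y\<^sup>2\<close> times differentiation in \<open>y\<close>, which takes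
  \<open>p * exp (- y)\<close> to \<open>y\<^sup>2 * (p - p') * exp (- y)\<close>. The factor
  \<open>[:0,0,1:]\<close> is \<open>y\<^sup>2\<close>.\<close>

lemma flat_deriv:
  "(flat p has_real_derivative flat ([:0,0,1:] * (p - pderiv p)) x) (at x)"
proof -
  consider "x > 0" | "x < 0" | "x = 0" by linarith
  then show ?thesis
  proof cases
    case 1
    have inv: "((\<lambda>x. 1/x) has_real_derivative -(1/x^2)) (at x)"
      using 1 by (auto intro!: derivative_eq_intros simp: power2_eq_square)
    have "((\<lambda>x. poly p (1/x) * exp (-(1/x))) has_real_derivative
        poly (pderiv p) (1/x) * (-(1/x^2)) * exp (-(1/x)) + exp (-(1/x)) * (-(-(1/x^2))) * poly p (1/x)) (at x)"
      by (intro DERIV_mult DERIV_chain2[OF poly_DERIV inv] DERIV_chain2[OF DERIV_exp DERIV_minus[OF inv]])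
    moreover have "poly (pderiv p) (1/x) * (-(1/x^2)) * exp (-(1/x)) + exp (-(1/x)) * (-(-(1/x^2))) * poly p (1/x)
       = flat ([:0,0,1:] * (p - pderiv p)) x"
      using 1 by (simp add: flat_def field_simps power2_eq_square)
    ultimately have "((\<lambda>x. poly p (1/x) * exp (-(1/x))) has_real_derivative
        flat ([:0,0,1:] * (p - pderiv p)) x) (at x)" by simp
    then show ?thesis
      by (rule has_field_derivative_transform_within_open[where S="{0<..}"]) (use 1 in \<open>auto simp: flat_def\<close>)
  next
    case 2
    have "((\<lambda>x. 0) has_real_derivative flat ([:0,0,1:] * (p - pderiv p)) x) (at x)"
      using 2 by (simp add: flat_def)
    then show ?thesis
      by (rule has_field_derivative_transform_within_open[where S="{..<0}"]) (use 2 in \<open>auto simp: flat_def\<close>)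
  next
    case 3
    \<comment> \<open>Division by \<open>h\<close> multiplies the polynomial by its variable, so the
      difference quotient at 0 is again a member of the family and tends to 0.\<close>
    have "(\<lambda>h. (flat p (0 + h) - flat p 0) / h) = flat ([:0,1:] * p)"
      by (auto simp: flat_def fun_eq_iff)
    then show ?thesis using flat_tendsto_0[of "[:0,1:] * p"] 3
      by (simp add: DERIV_def flat_def[of _ 0])
  qed
qed

lemma Ck_flat: "Ck k (flat p)"
proof (induction k arbitrary: p)
  case 0
  show ?case using flat_deriv by (auto intro!: DERIV_continuous_on)
next
  case (Suc k)
  show ?case by (rule Ck_real_SucI[OF flat_deriv Suc])
qed

section \<open>Continuously differentiable functions\<close>

text \<open>The gradient is an explicit argument, so that the product and gluing rules act on pairs
  and do not mention \<open>frechet_derivative\<close>; test functions enter through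
  \<open>Ck_C1g\<close>.\<close>

definition C1g :: "('a::euclidean_space \<Rightarrow> real) \<Rightarrow> ('a \<Rightarrow> 'a) \<Rightarrow> bool" where
  "C1g f g \<longleftrightarrow> (\<forall>x. (f has_derivative (\<lambda>h. g x \<bullet> h)) (at x)) \<and> continuous_on UNIV g"

lemma
  assumes "C1g f g"
  shows C1g_deriv: "(f has_derivative (\<lambda>h. g x \<bullet> h)) (at x)"
    and C1g_cont: "continuous_on UNIV f"
    and C1g_cont_grad: "continuous_on UNIV g"
  using assms
  by (auto simp: C1g_def intro!: continuous_at_imp_continuous_on has_derivative_continuous)

lemma C1g_measurable:
  assumes "C1g f g"
  shows "f \<in> borel_measurable borel" "g \<in> borel_measurable borel"
  using C1g_cont[OF assms] C1g_cont_grad[OF assms] by (auto intro: borel_measurable_continuous_onI)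

lemma grad_inner:
  assumes "f differentiable (at x)"
  shows "grad f x \<bullet> h = frechet_derivative f (at x) h"
proof -
  have lin: "linear (frechet_derivative f (at x))"
    using assms by (rule linear_frechet_derivative)
  have "frechet_derivative f (at x) h = frechet_derivative f (at x) (\<Sum>b\<in>Basis. (h \<bullet> b) *\<^sub>R b)"
    by (simp add: euclidean_representation)
  also have "\<dots> = (\<Sum>b\<in>Basis. (h \<bullet> b) * frechet_derivative f (at x) b)"
    by (simp add: linear_sum[OF lin] linear.scaleR[OF lin])
  finally show ?thesis
    by (simp add: grad_def inner_sum_left inner_sum_right inner_commute mult.commute)
qed

lemma C1g_grad: "C1g f g \<Longrightarrow> grad f = g"
proof
  fix x assume f: "C1g f g"
  have "frechet_derivative f (at x) = (\<lambda>h. g x \<bullet> h)"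
    by (rule frechet_derivative_eqI[OF C1g_deriv[OF f]])
  then show "grad f x = g x"
    by (simp add: grad_def euclidean_representation)
qed

lemma Ck_C1g:
  assumes "Ck (Suc 0) f"
  shows "C1g f (grad f)"
proof -
  have "(f has_derivative (\<lambda>h. grad f x \<bullet> h)) (at x)" for x
    using assms has_derivative_eq_frechet[of f x] grad_inner[of f x]
    by (simp add: fun_eq_iff)
  moreover have "continuous_on UNIV (grad f)"
    unfolding grad_def using assms by (intro continuous_intros) auto
  ultimately show ?thesis by (simp add: C1g_def)
qed

lemma C1g_mult:
  assumes "C1g f f'" "C1g g g'"
  shows "C1g (\<lambda>x. f x * g x) (\<lambda>x. f x *\<^sub>R g' x + g x *\<^sub>R f' x)"
  unfolding C1g_def
proof safe
  fix x
  show "((\<lambda>x. f x * g x) has_derivative (\<bullet>) (f x *\<^sub>R g' x + g x *\<^sub>R f' x)) (at x)"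
    by (rule has_derivative_eq_rhs[OF has_derivative_mult[OF C1g_deriv[OF assms(1)] C1g_deriv[OF assms(2)]]])
      (auto simp: inner_add_left)
qed (intro continuous_intros C1g_cont[OF assms(1)] C1g_cont[OF assms(2)]
    C1g_cont_grad[OF assms(1)] C1g_cont_grad[OF assms(2)])

lemma C1g_lin:
  assumes "C1g f f'" "C1g g g'"
  shows "C1g (\<lambda>x. a * f x + b * g x) (\<lambda>x. a *\<^sub>R f' x + b *\<^sub>R g' x)"
  unfolding C1g_def
proof safe
  fix x
  show "((\<lambda>x. a * f x + b * g x) has_derivative (\<bullet>) (a *\<^sub>R f' x + b *\<^sub>R g' x)) (at x)"
    by (auto intro!: derivative_eq_intros C1g_deriv[OF assms(1)] C1g_deriv[OF assms(2)]
        simp: inner_add_left)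
qed (intro continuous_intros C1g_cont_grad[OF assms(1)] C1g_cont_grad[OF assms(2)])

lemma C1g_restrict:
  assumes UV: "open U" "open V" "U \<union> V = UNIV" "\<And>x. x \<in> U \<inter> V \<Longrightarrow> f x = 0"
    and d: "\<And>x. x \<in> U \<Longrightarrow> (f has_derivative (\<lambda>h. g x \<bullet> h)) (at x)"
    and c: "continuous_on U g"
  shows "C1g (\<lambda>x. if x \<in> U then f x else 0) (\<lambda>x. if x \<in> U then g x else 0)"
  unfolding C1g_def
proof safe
  fix x
  show "((\<lambda>x. if x \<in> U then f x else 0) has_derivative (\<bullet>) (if x \<in> U then g x else 0)) (at x)"
    by (rule has_derivative_eq_rhs[OF has_derivative_restrict[OF UV d]]) auto
next
  have "g x = 0" if "x \<in> U \<inter> V" for x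
  proof -
    have "(f has_derivative (\<lambda>h. g x \<bullet> h)) (at x)" using d that by auto
    from has_derivative_zero_open[OF open_Int[OF UV(1,2)] that UV(4) this, of "g x"]
    show ?thesis by simp
  qed
  then show "continuous_on UNIV (\<lambda>x. if x \<in> U then g x else 0)"
    by (rule continuous_restrict[OF UV(1-3) _ c])
qed

lemma C1g_zero_off:
  assumes "C1g f g" "closed K" "\<And>x. x \<notin> K \<Longrightarrow> f x = 0" "x \<notin> K"
  shows "g x = 0"
  using has_derivative_zero_open[of "-K" x f, OF _ _ _ C1g_deriv[OF assms(1)], of "g x"] assms
  by auto

lemma integrable_compact_support:
  fixes f :: "'a::euclidean_space \<Rightarrow> 'b::euclidean_space"
  assumes "continuous_on UNIV f" "compact K" "\<And>x. x \<notin> K \<Longrightarrow> f x = 0"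
  shows "integrable lborel f"
proof -
  have "integrable lborel (\<lambda>x. indicator K x *\<^sub>R f x)"
    by (rule borel_integrable_compact[OF assms(2)]) (rule continuous_on_subset[OF assms(1)], simp)
  moreover have "(\<lambda>x. indicator K x *\<^sub>R f x) = f"
    using assms(3) by (auto simp: indicator_def)
  ultimately show ?thesis by simp
qed

lemma L2_compact_support:
  fixes f :: "'a::euclidean_space \<Rightarrow> 'b::euclidean_space"
  assumes "continuous_on UNIV f" "compact K" "\<And>x. x \<notin> K \<Longrightarrow> f x = 0"
  shows "L2 lborel f"
  unfolding L2_def
  using assms by (auto intro!: integrable_compact_support[of _ K] borel_measurable_continuous_onI
      continuous_intros)

section \<open>Translations, difference quotients and line integrals\<close>

lemma integral_lborel_translate:
  fixes f :: "'a::euclidean_space \<Rightarrow> 'b::euclidean_space"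
  assumes "f \<in> borel_measurable borel"
  shows "(LBINT x. f (x + c)) = (LBINT x. f x)"
    and "integrable lborel (\<lambda>x. f (x + c)) \<longleftrightarrow> integrable lborel f"
proof -
  have "(\<integral>x. f x \<partial>distr lborel borel ((+) c)) = (LBINT x. f (c + x))"
    by (rule integral_distr) (use assms in auto)
  then show "(LBINT x. f (x + c)) = (LBINT x. f x)"
    by (simp add: lborel_distr_plus add.commute)
  have "integrable (distr lborel borel ((+) c)) f \<longleftrightarrow> integrable lborel (\<lambda>x. f (c + x))"
    by (rule integrable_distr_eq) (use assms in auto)
  then show "integrable lborel (\<lambda>x. f (x + c)) \<longleftrightarrow> integrable lborel f"
    by (simp add: lborel_distr_plus add.commute)
qed

lemma nn_integral_lborel_translate:
  fixes f :: "'a::euclidean_space \<Rightarrow> ennreal"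
  assumes "f \<in> borel_measurable borel"
  shows "(\<integral>\<^sup>+x. f (x + c) \<partial>lborel) = (\<integral>\<^sup>+x. f x \<partial>lborel)"
proof -
  have "(\<integral>\<^sup>+x. f x \<partial>distr lborel borel ((+) c)) = (\<integral>\<^sup>+x. f (c + x) \<partial>lborel)"
    by (rule nn_integral_distr) (use assms in auto)
  then show ?thesis by (simp add: lborel_distr_plus add.commute)
qed

lemma C1g_Lipschitz:
  assumes "C1g f g" "\<And>x. norm (g x) \<le> B"
  shows "\<bar>f x - f y\<bar> \<le> B * norm (x - y)"
proof -
  have "norm (f x - f y) \<le> B * norm (x - y)"
  proof (rule differentiable_bound[of UNIV])
    fix x show "(f has_derivative (\<lambda>h. g x \<bullet> h)) (at x within UNIV)"
      using C1g_deriv[OF assms(1)] by simp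
    show "onorm (\<lambda>h. g x \<bullet> h) \<le> B"
    proof (rule onorm_le)
      fix h have "norm (g x \<bullet> h) \<le> norm (g x) * norm h" by (simp add: Cauchy_Schwarz_ineq2)
      also have "\<dots> \<le> B * norm h" using assms(2) by (intro mult_right_mono) auto
      finally show "norm (g x \<bullet> h) \<le> B * norm h" .
    qed
  qed auto
  then show ?thesis by simp
qed

lemma bounded_compact_support:
  fixes f :: "'a::euclidean_space \<Rightarrow> 'b::euclidean_space"
  assumes "continuous_on UNIV f" "compact K" "\<And>x. x \<notin> K \<Longrightarrow> f x = 0"
  obtains B where "0 \<le> B" "\<And>x. norm (f x) \<le> B"
proof -
  have "compact (f ` K)"
    by (rule compact_continuous_image[OF continuous_on_subset[OF assms(1)] assms(2)]) simp
  then obtain B where "\<forall>x\<in>K. norm (f x) \<le> B"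
    using compact_imp_bounded by (fastforce simp: bounded_iff)
  then have "norm (f x) \<le> max B 0" for x using assms(3)[of x] by (cases "x \<in> K") auto
  then show ?thesis using that[of "max B 0"] by auto
qed

text \<open>The difference quotients have integral zero by translation invariance and converge
  dominatedly; no iterated integration is needed.\<close>
lemma integral_directional_derivative:
  assumes f: "C1g f g" and K: "compact K" "\<And>x. x \<notin> K \<Longrightarrow> f x = 0"
  shows "(LBINT x. g x \<bullet> b) = 0"
proof -
  have g0: "g x = 0" if "x \<notin> K" for x
    using C1g_zero_off[OF f compact_imp_closed[OF K(1)] K(2) that] .
  obtain B where B: "0 \<le> B" "\<And>x. norm (g x) \<le> B"
    using bounded_compact_support[OF C1g_cont_grad[OF f] K(1) g0] by blast
  obtain R where R: "\<And>x. x \<in> K \<Longrightarrow> norm x \<le> R"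
    using compact_imp_bounded[OF K(1)] by (auto simp: bounded_iff)
  have [measurable]: "f \<in> borel_measurable borel" "g \<in> borel_measurable borel"
    using C1g_measurable[OF f] by auto
  have fint: "integrable lborel f"
    by (rule integrable_compact_support[OF C1g_cont[OF f] K])
  define h where "h n = 1 / real (Suc n)" for n
  have h: "0 < h n" "h n \<le> 1" for n by (auto simp: h_def)
  have h0: "h \<longlonglongrightarrow> 0"
    unfolding h_def using LIMSEQ_inverse_real_of_nat by (simp add: inverse_eq_divide)
  define q where "q n x = (f (x + h n *\<^sub>R b) - f x) / h n" for n x
  have zero: "(LBINT x. q n x) = 0" for n
  proof -
    have "integrable lborel (\<lambda>x. f (x + h n *\<^sub>R b))"
      using fint by (subst integral_lborel_translate(2)) auto
    then show ?thesis
      using fint integral_lborel_translate(1)[of f "h n *\<^sub>R b"] by (simp add: q_def)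
  qed
  have lim: "(\<lambda>n. q n x) \<longlonglongrightarrow> g x \<bullet> b" for x
  proof -
    have "((\<lambda>t. f (x + t *\<^sub>R b)) has_real_derivative g x \<bullet> b) (at 0)"
    proof -
      have d: "((\<lambda>t::real. x + t *\<^sub>R b) has_derivative (\<lambda>t. t *\<^sub>R b)) (at 0)"
        by (auto intro!: derivative_eq_intros)
      have "((\<lambda>t. f (x + t *\<^sub>R b)) has_derivative (\<lambda>t. g x \<bullet> (t *\<^sub>R b))) (at 0)"
        using has_derivative_compose[OF d C1g_deriv[OF f]] by simp
      then show ?thesis
        by (simp add: has_field_derivative_def mult.commute[of _ "_ \<bullet> _"])
    qed
    then have "((\<lambda>t. (f (x + t *\<^sub>R b) - f x) / t) \<longlongrightarrow> g x \<bullet> b) (at 0)"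
      by (simp add: DERIV_def)
    then show ?thesis
      unfolding q_def
      by (rule filterlim_compose[OF _ filterlim_atI[OF h0]]) (use h in \<open>auto simp: less_imp_neq[symmetric]\<close>)
  qed
  have "(\<lambda>n. LBINT x. q n x) \<longlonglongrightarrow> (LBINT x. g x \<bullet> b)"
  proof (rule integral_dominated_convergence)
    \<comment> \<open>As \<open>h n \<le> 1\<close>, the quotients vanish outside this ball; inside
      it the Lipschitz bound controls them.\<close>
    show "integrable lborel (\<lambda>x::'a. indicator (cball 0 (R + norm b)) x * (B * norm b))"
      by (intro integrable_mult_left integrable_real_indicator emeasure_bounded_finite[OF bounded_cball]) simp
    show "AE x in lborel. norm (q n x) \<le> indicator (cball 0 (R + norm b)) x * (B * norm b)" for n
    proof (rule AE_I2)
      fix x :: 'a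
      show "norm (q n x) \<le> indicator (cball 0 (R + norm b)) x * (B * norm b)"
      proof (cases "x \<in> cball 0 (R + norm b)")
        case True
        have "\<bar>f (x + h n *\<^sub>R b) - f x\<bar> \<le> B * norm (h n *\<^sub>R b)"
          using C1g_Lipschitz[OF f B(2), of "x + h n *\<^sub>R b" x] by simp
        then show ?thesis using True h[of n] by (simp add: q_def field_simps abs_of_pos)
      next
        case False
        then have nx: "norm x > R + norm b" by simp
        have "norm (h n *\<^sub>R b) \<le> norm b"
          using h[of n] mult_right_mono[of "h n" 1 "norm b"] by simp
        then have "norm (x + h n *\<^sub>R b) > R"
          using nx norm_triangle_ineq2[of x "- (h n *\<^sub>R b)"] by simp
        then have "f (x + h n *\<^sub>R b) = 0" using K(2) R by force
        moreover have "f x = 0" using K(2) R[of x] nx norm_ge_zero[of b] by (cases "x \<in> K") auto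
        ultimately show ?thesis by (simp add: q_def B)
      qed
    qed
  qed (use lim in \<open>auto simp: q_def\<close>)
  then show ?thesis by (simp add: zero LIMSEQ_const_iff)
qed

text \<open>The fundamental theorem of calculus along the segment, then Cauchy-Schwarz against the
  constant 1 on \<open>{0..1}\<close>. Feeds both the weighted Poincare inequality and the estimate
  of the seminorm at short range.\<close>

lemma C1g_segment_bound:
  assumes "C1g f g"
  shows "ennreal ((f y - f x)\<^sup>2) \<le> ennreal ((norm (y - x))\<^sup>2) *
     (\<integral>\<^sup>+t. ennreal ((norm (g (x + t *\<^sub>R (y - x))))\<^sup>2) * indicator {0..1} t \<partial>lborel)"
proof -
  define h where "h t = g (x + t *\<^sub>R (y - x)) \<bullet> (y - x)" for t :: real
  have cz: "continuous_on A (\<lambda>t. g (x + t *\<^sub>R (y - x)))" for A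
    by (rule continuous_on_compose2[OF C1g_cont_grad[OF assms]]) (auto intro!: continuous_intros)
  then have ch: "continuous_on A h" for A unfolding h_def by (intro continuous_intros)
  have d: "((\<lambda>t. f (x + t *\<^sub>R (y - x))) has_vector_derivative h t) (at t within {0..1})" for t
  proof -
    have d: "((\<lambda>t::real. x + t *\<^sub>R (y - x)) has_derivative (\<lambda>t. t *\<^sub>R (y - x))) (at t within {0..1})"
      by (auto intro!: derivative_eq_intros)
    have "((\<lambda>t. f (x + t *\<^sub>R (y - x))) has_derivative (\<lambda>s. g (x + t *\<^sub>R (y - x)) \<bullet> (s *\<^sub>R (y - x)))) (at t within {0..1})"
      using has_derivative_compose[OF d C1g_deriv[OF assms]] by simp
    then show ?thesis by (simp add: has_vector_derivative_def h_def)
  qed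
  have "f y - f x = (LBINT t. indicator {0..1} t *\<^sub>R h t)"
    using integral_FTC_atLeastAtMost[of 0 1 "\<lambda>t. f (x + t *\<^sub>R (y - x))" h, OF _ d ch] by simp
  \<comment> \<open>Doubling the indicator exhibits the integral as an L2 inner product with the
    indicator of \<open>{0..1}\<close>.\<close>
  also have "\<dots> = (LBINT t. indicator {0..1} t \<bullet> (indicator {0..1} t *\<^sub>R h t))"
    by (intro Bochner_Integration.integral_cong) (auto simp: indicator_def)
  finally have eq: "f y - f x = \<dots>" .
  have int: "integrable lborel (\<lambda>t. indicator {0..1} t *\<^sub>R (h t)\<^sup>2)"
    by (rule borel_integrable_compact) (auto intro!: continuous_intros ch)
  have sq: "(norm (indicator {0..1} t *\<^sub>R h t))\<^sup>2 = indicator {0..1} t *\<^sub>R (h t)\<^sup>2" for t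
    by (auto simp: indicator_def)
  have Lh: "L2 lborel (\<lambda>t. indicator {0..1} t *\<^sub>R h t)"
    unfolding L2_def sq using int borel_measurable_continuous_onI[OF ch] by auto
  have isq: "(norm (indicator {0..1::real} t :: real))\<^sup>2 = indicator {0..1} t" for t
    by (auto simp: indicator_def)
  have Li: "L2 lborel (indicator {0..1} :: real \<Rightarrow> real)"
    unfolding L2_def isq by auto
  have "(f y - f x)\<^sup>2 \<le> sqint lborel (\<lambda>t. indicator {0..1::real} t :: real) *
     sqint lborel (\<lambda>t. indicator {0..1} t *\<^sub>R h t)"
    unfolding eq by (rule L2_Cauchy_Schwarz[OF Li Lh])
  also have "\<dots> = (LBINT t. indicator {0..1} t *\<^sub>R (h t)\<^sup>2)"
    unfolding isq sq by simp
  finally have "ennreal ((f y - f x)\<^sup>2) \<le> ennreal (LBINT t. indicator {0..1} t *\<^sub>R (h t)\<^sup>2)"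
    by (rule ennreal_leI)
  also have "\<dots> = (\<integral>\<^sup>+t. ennreal (indicator {0..1} t *\<^sub>R (h t)\<^sup>2) \<partial>lborel)"
    by (rule nn_integral_eq_integral[symmetric, OF int]) auto
  also have "\<dots> \<le> (\<integral>\<^sup>+t. ennreal ((norm (y - x))\<^sup>2) *
       (ennreal ((norm (g (x + t *\<^sub>R (y - x))))\<^sup>2) * indicator {0..1} t) \<partial>lborel)"
  proof (rule nn_integral_mono)
    fix t :: real
    have "\<bar>h t\<bar>\<^sup>2 \<le> (norm (g (x + t *\<^sub>R (y - x))) * norm (y - x))\<^sup>2"
      unfolding h_def by (intro power_mono Cauchy_Schwarz_ineq2) auto
    then have "(h t)\<^sup>2 \<le> (norm (y - x))\<^sup>2 * (norm (g (x + t *\<^sub>R (y - x))))\<^sup>2"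
      by (simp add: power_mult_distrib mult.commute)
    then show "ennreal (indicator {0..1} t *\<^sub>R (h t)\<^sup>2) \<le> ennreal ((norm (y - x))\<^sup>2) *
       (ennreal ((norm (g (x + t *\<^sub>R (y - x))))\<^sup>2) * indicator {0..1} t)"
      by (auto simp: indicator_def ennreal_mult'[symmetric] intro: ennreal_leI)
  qed
  also have "\<dots> = ennreal ((norm (y - x))\<^sup>2) *
     (\<integral>\<^sup>+t. ennreal ((norm (g (x + t *\<^sub>R (y - x))))\<^sup>2) * indicator {0..1} t \<partial>lborel)"
    using borel_measurable_continuous_onI[OF cz[of UNIV]] by (intro nn_integral_cmult) simp
  finally show ?thesis .
qed

section \<open>The radial eigenfunction\<close>

text \<open>\<open>r \<mapsto> F N (r\<^sup>2)\<close> is the radial solution, with value 1 at 0, of \<open>- \<Delta> \<phi> = \<phi>\<close> in \<open>N\<close> dimensions,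
  that is, a normalised Bessel function; it is expanded in powers of \<open>t = r\<^sup>2\<close>.\<close>
primrec bcoeff :: "nat \<Rightarrow> nat \<Rightarrow> real" where
  "bcoeff N 0 = 1"
| "bcoeff N (Suc k) = - bcoeff N k / (real (Suc k) * (4 * real k + 2 * real N))"

definition bF :: "nat \<Rightarrow> real \<Rightarrow> real" where "bF N t = (\<Sum>k. bcoeff N k * t^k)"
definition bF' :: "nat \<Rightarrow> real \<Rightarrow> real" where "bF' N t = (\<Sum>k. diffs (bcoeff N) k * t^k)"
definition bF'' :: "nat \<Rightarrow> real \<Rightarrow> real" where "bF'' N t = (\<Sum>k. diffs (diffs (bcoeff N)) k * t^k)"

context
  fixes N :: nat
  assumes N: "N \<ge> 1"
begin

lemma bcoeff_bound: "\<bar>bcoeff N k\<bar> \<le> inverse (fact k)"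
proof (induction k)
  case (Suc k)
  have "\<bar>bcoeff N (Suc k)\<bar> = \<bar>bcoeff N k\<bar> / (real (Suc k) * (4 * real k + 2 * real N))"
    by (simp add: abs_mult)
  also have "\<dots> \<le> inverse (fact k) / (real (Suc k) * 1)"
    by (rule frac_le) (use Suc N in \<open>auto intro!: mult_left_mono\<close>)
  also have "\<dots> = inverse (fact (Suc k))" by (simp add: field_simps)
  finally show ?case .
qed simp

lemma summable_bcoeff: "summable (\<lambda>k. bcoeff N k * t^k)"
proof (rule summable_comparison_test')
  show "summable (\<lambda>k. inverse (fact k) * \<bar>t\<bar>^k)" by (rule summable_exp)
  show "norm (bcoeff N k * t^k) \<le> inverse (fact k) * \<bar>t\<bar>^k" for k
    using bcoeff_bound[of k] by (auto simp: abs_mult power_abs intro!: mult_right_mono)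
qed

lemma summable_bcoeff_diffs:
  "summable (\<lambda>k. diffs (bcoeff N) k * t^k)" "summable (\<lambda>k. diffs (diffs (bcoeff N)) k * t^k)"
  by (auto intro!: termdiff_converges_all summable_bcoeff)

lemma bF_deriv: "(bF N has_real_derivative bF' N t) (at t)"
  and bF'_deriv: "(bF' N has_real_derivative bF'' N t) (at t)"
  unfolding bF_def[abs_def] bF'_def[abs_def] bF''_def
  by (auto intro!: termdiffs_strong_converges_everywhere summable_bcoeff summable_bcoeff_diffs)

lemma bF''_cont: "continuous_on A (bF'' N)"
proof -
  have "((\<lambda>t. \<Sum>k. diffs (diffs (bcoeff N)) k * t^k) has_real_derivative
    (\<Sum>k. diffs (diffs (diffs (bcoeff N))) k * t^k)) (at t)" for t
    by (intro termdiffs_strong_converges_everywhere summable_bcoeff_diffs)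
  then show ?thesis
    unfolding bF''_def[abs_def] by (rule DERIV_continuous_on[OF has_field_derivative_at_within])
qed

lemma bF_cont: "continuous_on A (bF N)" and bF'_cont: "continuous_on A (bF' N)"
  by (rule DERIV_continuous_on[OF has_field_derivative_at_within], rule bF_deriv bF'_deriv)+

text \<open>For \<open>\<phi> = F(r\<^sup>2)\<close> in \<open>N\<close> dimensions and
  \<open>t = r\<^sup>2\<close>, the Laplacian is \<open>4 t F'' + 2 N F'\<close>. The recursion of
  \<open>bcoeff\<close> is exactly the comparison of coefficients in this equation.\<close>

lemma bF_ode: "4 * t * bF'' N t + 2 * real N * bF' N t + bF N t = 0"
proof -
  let ?d = "diffs (bcoeff N)"
  have "(\<lambda>k. diffs ?d k * t^k * t) sums (bF'' N t * t)"
    unfolding bF''_def by (intro sums_mult2 summable_sums summable_bcoeff_diffs)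
  then have "(\<lambda>k. real (Suc k) * ?d (Suc k) * t^(Suc k)) sums (bF'' N t * t)"
    by (simp add: diffs_def mult_ac)
  \<comment> \<open>The term of index 0 vanishes, so the shifted series may start there.\<close>
  then have "(\<lambda>k. real k * ?d k * t^k) sums (bF'' N t * t)"
    using sums_Suc[of "\<lambda>k. real k * ?d k * t^k"] by simp
  then have "(\<lambda>k. 4 * (real k * ?d k * t^k) + 2 * real N * (?d k * t^k) + bcoeff N k * t^k)
     sums (4 * (bF'' N t * t) + 2 * real N * bF' N t + bF N t)"
    unfolding bF_def bF'_def
    by (intro sums_add sums_mult summable_sums summable_bcoeff summable_bcoeff_diffs)
  moreover have "4 * (real k * ?d k * t^k) + 2 * real N * (?d k * t^k) + bcoeff N k * t^k = 0" for k
  proof -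
    have nz: "4 * real k + 2 * real N \<noteq> 0" using N by linarith
    have "?d k = - bcoeff N k / (4 * real k + 2 * real N)"
      unfolding diffs_def bcoeff.simps by (simp del: of_nat_Suc)
    then have "?d k * (4 * real k + 2 * real N) = - bcoeff N k"
      using nz by simp
    moreover have "4 * (real k * ?d k * t^k) + 2 * real N * (?d k * t^k) + bcoeff N k * t^k
      = (?d k * (4 * real k + 2 * real N) + bcoeff N k) * t^k"
      by (simp add: algebra_simps)
    ultimately show ?thesis by simp
  qed
  ultimately show ?thesis
    by (simp add: sums_unique2[OF _ sums_zero] mult_ac)
qed

lemma bF_0: "bF N 0 = 1"
  unfolding bF_def by simp

lemma bF_square_deriv: "((\<lambda>r. bF N (r\<^sup>2)) has_real_derivative bF' N (r\<^sup>2) * (2 * r)) (at r)"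
  and bF'_square_deriv: "((\<lambda>r. bF' N (r\<^sup>2)) has_real_derivative bF'' N (r\<^sup>2) * (2 * r)) (at r)"
  by (auto intro!: DERIV_chain2[OF bF_deriv] DERIV_chain2[OF bF'_deriv] derivative_eq_intros)

lemma power_pred: "real N * r^(N - 1) * r = real N * r^N" "r^(N-1) * r = (r::real)^N"
  using N by (cases N; simp)+

text \<open>The radial equation in divergence form: \<open>r^N * F'(r\<^sup>2)\<close> has
  derivative \<open>- r^(N-1) * F(r\<^sup>2) / 2\<close>. It starts from 0 and decreases while
  \<open>F\<close> is positive.\<close>

lemma bF'_neg:
  assumes pos: "\<And>s. 0 \<le> s \<Longrightarrow> s < t \<Longrightarrow> 0 < bF N s" and t: "0 < t"
  shows "bF' N t < 0"
proof -
  define r where "r = sqrt t"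
  have r: "0 < r" "r\<^sup>2 = t" using t by (auto simp: r_def)
  have d: "((\<lambda>r. r^N * bF' N (r\<^sup>2)) has_real_derivative -(x^(N-1) * bF N (x\<^sup>2)) / 2) (at x)" for x
  proof -
    have "((\<lambda>r. r^N * bF' N (r\<^sup>2)) has_real_derivative
       real N * x^(N-1) * bF' N (x\<^sup>2) + bF'' N (x\<^sup>2) * (2 * x) * x^N) (at x)"
      by (rule DERIV_mult) (auto intro!: derivative_eq_intros bF'_square_deriv)
    moreover have "real N * x^(N-1) * bF' N (x\<^sup>2) + bF'' N (x\<^sup>2) * (2 * x) * x^N
      = x^(N-1) * (4 * x\<^sup>2 * bF'' N (x\<^sup>2) + 2 * real N * bF' N (x\<^sup>2)) / 2"
      unfolding power_pred(2)[symmetric] by (simp add: algebra_simps power2_eq_square)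
    moreover have "4 * x\<^sup>2 * bF'' N (x\<^sup>2) + 2 * real N * bF' N (x\<^sup>2) = - bF N (x\<^sup>2)"
      using bF_ode[of "x\<^sup>2"] by simp
    ultimately show ?thesis by simp
  qed
  have "r^N * bF' N (r\<^sup>2) < 0^N * bF' N (0\<^sup>2)"
  proof (rule DERIV_neg_imp_decreasing_open[OF r(1)])
    fix x assume "0 < x" "x < r"
    moreover from this have "x\<^sup>2 < t" using r by (metis power_strict_mono less_imp_le zero_less_numeral)
    ultimately have "-(x^(N-1) * bF N (x\<^sup>2)) / 2 < 0" using pos[of "x\<^sup>2"] by simp
    then show "\<exists>y. ((\<lambda>r. r^N * bF' N (r\<^sup>2)) has_real_derivative y) (at x) \<and> y < 0"
      using d by blast
  next
    show "continuous_on {0..r} (\<lambda>r. r^N * bF' N (r\<^sup>2))"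
      by (rule DERIV_continuous_on[OF has_field_derivative_at_within[OF d]])
  qed
  then show ?thesis using N r by (simp add: power_0_left mult_less_0_iff)
qed

text \<open>By the differential equation, \<open>r^N * (2 N F' + F)\<close>, taken at
  \<open>r\<^sup>2\<close>, has derivative \<open>2 r^(N+1) F'\<close>, which is not positive by
  \<open>bF'_neg\<close>; it starts from 0. The bound keeps \<open>- F / F'\<close> below
  \<open>2 N\<close> in the Riccati argument.\<close>

lemma bF_log_deriv_bound:
  assumes pos: "\<And>s. 0 \<le> s \<Longrightarrow> s < t \<Longrightarrow> 0 < bF N s" and t: "0 < t"
  shows "bF N t \<le> - 2 * real N * bF' N t"
proof -
  define r where "r = sqrt t"
  have r: "0 < r" "r\<^sup>2 = t" using t by (auto simp: r_def)
  let ?Q = "\<lambda>r. r^N * (2 * real N * bF' N (r\<^sup>2) + bF N (r\<^sup>2))"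
  have d: "(?Q has_real_derivative 2 * x * x^N * bF' N (x\<^sup>2)) (at x)" for x
  proof -
    have "(?Q has_real_derivative
       real N * x^(N-1) * (2 * real N * bF' N (x\<^sup>2) + bF N (x\<^sup>2))
        + (2 * real N * (bF'' N (x\<^sup>2) * (2 * x)) + bF' N (x\<^sup>2) * (2 * x)) * x^N) (at x)"
      by (rule DERIV_mult) (auto intro!: derivative_eq_intros bF'_square_deriv bF_square_deriv)
    moreover have "real N * x^(N-1) * (2 * real N * bF' N (x\<^sup>2) + bF N (x\<^sup>2))
        + (2 * real N * (bF'' N (x\<^sup>2) * (2 * x)) + bF' N (x\<^sup>2) * (2 * x)) * x^N
      = real N * x^(N-1) * (4 * x\<^sup>2 * bF'' N (x\<^sup>2) + 2 * real N * bF' N (x\<^sup>2) + bF N (x\<^sup>2))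
        + 2 * x * x^N * bF' N (x\<^sup>2)"
      unfolding power_pred(2)[symmetric] by (simp add: algebra_simps power2_eq_square)
    ultimately show ?thesis by (simp only: bF_ode) simp
  qed
  have "?Q r \<le> ?Q 0"
  proof (rule DERIV_nonpos_imp_nonincreasing[of 0 r])
    fix x assume x: "0 \<le> x" "x \<le> r"
    have "2 * x * x^N * bF' N (x\<^sup>2) \<le> 0"
    proof (cases "x = 0")
      case False
      have "x\<^sup>2 \<le> t" using x r by (metis power_mono)
      then have "bF' N (x\<^sup>2) < 0" using False x by (intro bF'_neg pos) auto
      then show ?thesis using x by (intro mult_nonneg_nonpos) auto
    qed simp
    then show "\<exists>y. (?Q has_real_derivative y) (at x) \<and> y \<le> 0" using d by blast
  qed (use r in auto)
  then show ?thesis using N r zero_less_power[OF r(1), of N] by (simp add: power_0_left mult_le_0_iff)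
qed

text \<open>Riccati argument: if \<open>bF N\<close> stayed positive, \<open>w = - F / F'\<close> would be positive, at most \<open>2 N\<close>,
  and have derivative at most \<open>- 1/2\<close> beyond \<open>2 N\<^sup>2\<close>.\<close>
lemma bF_nonpos_exists: "\<exists>t>0. bF N t \<le> 0"
proof (rule ccontr)
  assume "\<not> ?thesis"
  then have pos: "0 < bF N t" if "0 \<le> t" for t
    using that bF_0 by (cases "t = 0") (auto simp: not_le)
  have neg: "bF' N t < 0" if "0 < t" for t using bF'_neg[OF pos that] by simp
  \<comment> \<open>Chosen so that the error term \<open>4 N\<^sup>2 / (4 t)\<close> in the
    derivative of \<open>w\<close> is at most 1/2 from here on.\<close>
  define a where "a = 2 * (real N)\<^sup>2"
  define w where "w t = - bF N t / bF' N t" for t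
  have a: "0 < a" using N by (simp add: a_def)
  have w: "0 < w t" "w t \<le> 2 * real N" if "0 < t" for t
  proof -
    show "0 < w t" unfolding w_def using pos[of t] neg[OF that] that by (simp add: divide_less_0_iff zero_less_divide_iff)
    show "w t \<le> 2 * real N"
      unfolding w_def using bF_log_deriv_bound[OF pos that] neg[OF that] by (simp add: field_simps)
  qed
  have dw: "\<exists>y. (w has_real_derivative y) (at t) \<and> y \<le> -1/2" if t: "a \<le> t" for t
  proof (intro exI conjI)
    have t0: "0 < t" using a t by simp
    have nz: "bF' N t \<noteq> 0" using neg[OF t0] by simp
    show "(w has_real_derivative (- bF' N t * bF' N t - - bF N t * bF'' N t) / (bF' N t * bF' N t)) (at t)"
      unfolding w_def by (intro DERIV_divide DERIV_minus bF_deriv bF'_deriv nz)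
    have e: "bF'' N t = (- 2 * real N * bF' N t - bF N t) / (4 * t)"
      using bF_ode[of t] t0 by (simp add: field_simps)
    have "(- bF' N t * bF' N t - - bF N t * bF'' N t) / (bF' N t * bF' N t)
       = -1 + (2 * real N * w t - (w t)\<^sup>2) / (4 * t)"
      unfolding e w_def using nz t0 by (simp add: field_simps power2_eq_square)
    also have "\<dots> \<le> -1 + (2 * real N * (2 * real N)) / (4 * t)"
    proof -
      have "2 * real N * w t - (w t)\<^sup>2 \<le> 2 * real N * (2 * real N)"
        using mult_left_mono[OF w(2)[OF t0], of "2 * real N"] zero_le_power2[of "w t"] by linarith
      then have "(2 * real N * w t - (w t)\<^sup>2) / (4 * t) \<le> (2 * real N * (2 * real N)) / (4 * t)"
        using t0 by (intro divide_right_mono) auto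
      then show ?thesis by simp
    qed
    also have "\<dots> \<le> -1/2"
      using t t0 by (simp add: a_def field_simps power2_eq_square)
    finally show "(- bF' N t * bF' N t - - bF N t * bF'' N t) / (bF' N t * bF' N t) \<le> -1/2" .
  qed
  \<comment> \<open>Over a length \<open>4 N\<close>, a slope of at most \<open>-1/2\<close> lowers
    \<open>w\<close> by at least \<open>2 N\<close>, its upper bound, so \<open>w ?b\<close> could
    not be positive.\<close>
  let ?b = "a + 4 * real N"
  have "w ?b + ?b / 2 \<le> w a + a / 2"
  proof (rule DERIV_nonpos_imp_nonincreasing[of a ?b "\<lambda>t. w t + t / 2"])
    fix t assume "a \<le> t" "t \<le> ?b"
    from dw[OF this(1)] obtain y where y: "(w has_real_derivative y) (at t)" "y \<le> -1/2" by auto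
    have "((\<lambda>t. w t + t / 2) has_real_derivative y + 1/2) (at t)"
      by (auto intro!: derivative_eq_intros y)
    then show "\<exists>y. ((\<lambda>t. w t + t / 2) has_real_derivative y) (at t) \<and> y \<le> 0" using y by auto
  qed simp
  then show False using w[of a] w[of ?b] a N by (simp add: field_simps)
qed

text \<open>This zero fixes the eigenvalues used below: a ball of radius \<open>\<rho>\<close> gets
  \<open>\<kappa> = T / \<rho>\<^sup>2\<close>. Minimality of \<open>T\<close> makes the
  eigenfunction positive inside the ball.\<close>

lemma bF_first_zero:
  obtains T where "0 < T" "bF N T = 0" "\<And>t. 0 \<le> t \<Longrightarrow> t < T \<Longrightarrow> 0 < bF N t"
proof -
  obtain M where M: "0 < M" "bF N M \<le> 0" using bF_nonpos_exists by blast
  have ivt: "\<exists>x\<ge>0. x \<le> y \<and> bF N x = 0" if "0 \<le> y" "bF N y \<le> 0" for y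
    using IVT2'[of "bF N" y 0 0] that bF_0 bF_cont[of "{0..y}"] by auto
  define Z where "Z = {0..M} \<inter> bF N -` {0}"
  have "compact Z"
    unfolding Z_def by (intro compact_Int_closed compact_Icc continuous_closed_vimage)
      (auto intro: DERIV_isCont[OF bF_deriv])
  moreover have "Z \<noteq> {}" using ivt[of M] M by (auto simp: Z_def)
  ultimately obtain T where T: "T \<in> Z" "\<And>t. t \<in> Z \<Longrightarrow> T \<le> t"
    using compact_attains_inf[of Z] by auto
  have "0 < bF N t" if t: "0 \<le> t" "t < T" for t
  proof (rule ccontr)
    assume "\<not> 0 < bF N t"
    with ivt[of t] t obtain x where x: "0 \<le> x" "x \<le> t" "bF N x = 0" by force
    then have "x \<in> Z" using t T(1) by (auto simp: Z_def)
    with T(2) x t show False by fastforce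
  qed
  moreover have "T \<noteq> 0" using T(1) bF_0 by (auto simp: Z_def)
  ultimately show ?thesis using that[of T] T(1) by (auto simp: Z_def)
qed

end

text \<open>Solves \<open>- \<Delta> \<phi> = \<kappa> \<phi>\<close> on the whole space; a ball
  enters only through the choice of \<open>\<kappa>\<close>, which puts the first zero on its
  boundary.\<close>

definition phi :: "real \<Rightarrow> 'a \<Rightarrow> 'a::euclidean_space \<Rightarrow> real" where
  "phi \<kappa> c x = bF DIM('a) (\<kappa> * (norm (x - c))\<^sup>2)"

definition dphi :: "real \<Rightarrow> 'a \<Rightarrow> 'a::euclidean_space \<Rightarrow> 'a" where
  "dphi \<kappa> c x = (2 * \<kappa> * bF' DIM('a) (\<kappa> * (norm (x - c))\<^sup>2)) *\<^sub>R (x - c)"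

lemma DIM_ge_1: "1 \<le> DIM('a::euclidean_space)"
  using DIM_positive[where 'a='a] by simp

lemma norm_sq_deriv:
  "((\<lambda>x. \<kappa> * (norm (x - c))\<^sup>2) has_derivative (\<lambda>h. 2 * \<kappa> * ((x - c) \<bullet> h))) (at x)"
  for x c :: "'a::euclidean_space"
  unfolding power2_norm_eq_inner
  by (auto intro!: derivative_eq_intros simp: inner_commute algebra_simps)

lemma C1g_phi: "C1g (phi \<kappa> c) (dphi \<kappa> c)"
  unfolding C1g_def
proof safe
  fix x :: 'a
  show "(phi \<kappa> c has_derivative (\<bullet>) (dphi \<kappa> c x)) (at x)"
    unfolding phi_def[abs_def] dphi_def
    by (rule has_derivative_eq_rhs[OF has_derivative_compose[OF norm_sq_deriv
          bF_deriv[OF DIM_ge_1, unfolded has_field_derivative_def]]])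
      (auto simp: algebra_simps)
next
  show "continuous_on UNIV (dphi \<kappa> c :: 'a \<Rightarrow> 'a)"
    unfolding dphi_def[abs_def]
    by (intro continuous_intros continuous_on_compose2[OF bF'_cont[OF DIM_ge_1, of UNIV]]) auto
qed

text \<open>A row of the Hessian of \<open>phi\<close>, in the closed form that its trace
  requires.\<close>

lemma C1g_dphi_comp:
  fixes c b :: "'a::euclidean_space"
  shows "C1g (\<lambda>x. dphi \<kappa> c x \<bullet> b) (\<lambda>x. (4 * \<kappa>\<^sup>2 * bF'' DIM('a) (\<kappa> * (norm (x - c))\<^sup>2) * ((x - c) \<bullet> b)) *\<^sub>R (x - c)
     + (2 * \<kappa> * bF' DIM('a) (\<kappa> * (norm (x - c))\<^sup>2)) *\<^sub>R b)"
  unfolding C1g_def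
proof safe
  fix x :: 'a
  have d: "((\<lambda>x. bF' DIM('a) (\<kappa> * (norm (x - c))\<^sup>2)) has_derivative
     (\<lambda>h. bF'' DIM('a) (\<kappa> * (norm (x - c))\<^sup>2) * (2 * \<kappa> * ((x - c) \<bullet> h)))) (at x)"
    by (rule has_derivative_compose[OF norm_sq_deriv bF'_deriv[OF DIM_ge_1, unfolded has_field_derivative_def]])
  show "((\<lambda>x. dphi \<kappa> c x \<bullet> b) has_derivative (\<bullet>) ((4 * \<kappa>\<^sup>2 * bF'' DIM('a) (\<kappa> * (norm (x - c))\<^sup>2) * ((x - c) \<bullet> b)) *\<^sub>R (x - c)
     + (2 * \<kappa> * bF' DIM('a) (\<kappa> * (norm (x - c))\<^sup>2)) *\<^sub>R b)) (at x)"
    unfolding dphi_def inner_scaleR_left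
    by (rule has_derivative_eq_rhs, (rule derivative_intros d)+)
      (auto simp: algebra_simps inner_add_left inner_commute power2_eq_square)
next
  show "continuous_on UNIV (\<lambda>x. (4 * \<kappa>\<^sup>2 * bF'' DIM('a) (\<kappa> * (norm (x - c))\<^sup>2) * ((x - c) \<bullet> b)) *\<^sub>R (x - c)
     + (2 * \<kappa> * bF' DIM('a) (\<kappa> * (norm (x - c))\<^sup>2)) *\<^sub>R b)"
    by (intro continuous_intros continuous_on_compose2[OF bF'_cont[OF DIM_ge_1, of UNIV]]
        continuous_on_compose2[OF bF''_cont[OF DIM_ge_1, of UNIV]]) auto
qed

text \<open>The left side is the trace of the Hessian from \<open>C1g_dphi_comp\<close>. With
  \<open>t = \<kappa> * (norm (x - c))\<^sup>2\<close> it equals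
  \<open>\<kappa> * (4 t F'' + 2 N F')\<close>, which \<open>bF_ode\<close> evaluates.\<close>

lemma phi_laplace:
  fixes c x :: "'a::euclidean_space"
  shows "(\<Sum>b\<in>Basis. ((4 * \<kappa>\<^sup>2 * bF'' DIM('a) (\<kappa> * (norm (x - c))\<^sup>2) * ((x - c) \<bullet> b)) *\<^sub>R (x - c)
     + (2 * \<kappa> * bF' DIM('a) (\<kappa> * (norm (x - c))\<^sup>2)) *\<^sub>R b) \<bullet> b) = - \<kappa> * phi \<kappa> c x"
proof -
  let ?t = "\<kappa> * (norm (x - c))\<^sup>2"
  have "(\<Sum>b\<in>Basis. ((4 * \<kappa>\<^sup>2 * bF'' DIM('a) ?t * ((x - c) \<bullet> b)) *\<^sub>R (x - c)
     + (2 * \<kappa> * bF' DIM('a) ?t) *\<^sub>R b) \<bullet> b)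
    = 4 * \<kappa>\<^sup>2 * bF'' DIM('a) ?t * (\<Sum>b\<in>Basis. ((x - c) \<bullet> b) * ((x - c) \<bullet> b))
      + 2 * \<kappa> * bF' DIM('a) ?t * real DIM('a)"
    by (simp add: inner_add_left sum.distrib sum_distrib_left mult.assoc inner_Basis)
  also have "\<dots> = \<kappa> * (4 * ?t * bF'' DIM('a) ?t + 2 * real DIM('a) * bF' DIM('a) ?t)"
    unfolding euclidean_inner[symmetric] power2_norm_eq_inner by (simp add: algebra_simps power2_eq_square)
  also have "\<dots> = - \<kappa> * bF DIM('a) ?t"
    using bF_ode[OF DIM_ge_1[where 'a='a], of ?t] by (simp add: algebra_simps) (metis distrib_left mult_minus_right add_eq_0_iff)
  finally show ?thesis by (simp add: phi_def)
qed

text \<open>The weak form of \<open>- \<Delta> \<phi> = \<kappa> \<phi>\<close>: the divergence of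
  \<open>W \<nabla>\<phi>\<close> integrates to 0, one coordinate at a time, because
  \<open>W\<close> has compact support.\<close>

lemma integral_grad_dphi:
  fixes W :: "'a::euclidean_space \<Rightarrow> real"
  assumes W: "C1g W W'" and K: "compact K" "\<And>x. x \<notin> K \<Longrightarrow> W x = 0"
  shows "(LBINT x. W' x \<bullet> dphi \<kappa> c x) = \<kappa> * (LBINT x. W x * phi \<kappa> c x)"
proof -
  define H where "H b x = (4 * \<kappa>\<^sup>2 * bF'' DIM('a) (\<kappa> * (norm (x - c))\<^sup>2) * ((x - c) \<bullet> b)) *\<^sub>R (x - c)
     + (2 * \<kappa> * bF' DIM('a) (\<kappa> * (norm (x - c))\<^sup>2)) *\<^sub>R b" for b x
  have W'0: "W' x = 0" if "x \<notin> K" for x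
    using C1g_zero_off[OF W compact_imp_closed[OF K(1)] K(2) that] .
  have CH: "C1g (\<lambda>x. dphi \<kappa> c x \<bullet> b) (H b)" for b
    unfolding H_def[abs_def] by (rule C1g_dphi_comp)
  have C: "C1g (\<lambda>x. W x * (dphi \<kappa> c x \<bullet> b)) (\<lambda>x. W x *\<^sub>R H b x + (dphi \<kappa> c x \<bullet> b) *\<^sub>R W' x)" for b
    by (rule C1g_mult[OF W CH])
  have z: "(LBINT x. (W x *\<^sub>R H b x + (dphi \<kappa> c x \<bullet> b) *\<^sub>R W' x) \<bullet> b) = 0" for b
    by (rule integral_directional_derivative[OF C K(1)]) (simp add: K(2))
  have i: "integrable lborel (\<lambda>x. (W x *\<^sub>R H b x + (dphi \<kappa> c x \<bullet> b) *\<^sub>R W' x) \<bullet> b)" for b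
    by (rule integrable_compact_support[OF _ K(1)])
      (auto simp: K(2) W'0 intro!: continuous_intros C1g_cont[OF W] C1g_cont_grad[OF W] C1g_cont_grad[OF CH]
        C1g_cont_grad[OF C1g_phi])
  have i1: "integrable lborel (\<lambda>x. W x * phi \<kappa> c x)"
    by (rule integrable_compact_support[OF _ K(1)])
      (auto simp: K(2) intro!: continuous_intros C1g_cont[OF W] C1g_cont[OF C1g_phi])
  have i2: "integrable lborel (\<lambda>x. W' x \<bullet> dphi \<kappa> c x)"
    by (rule integrable_compact_support[OF _ K(1)])
      (auto simp: W'0 intro!: continuous_intros C1g_cont_grad[OF W] C1g_cont_grad[OF C1g_phi])
  have "0 = (\<Sum>b\<in>Basis. (LBINT x. (W x *\<^sub>R H b x + (dphi \<kappa> c x \<bullet> b) *\<^sub>R W' x) \<bullet> b))"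
    by (simp add: z)
  also have "\<dots> = (LBINT x. (\<Sum>b\<in>Basis. (W x *\<^sub>R H b x + (dphi \<kappa> c x \<bullet> b) *\<^sub>R W' x) \<bullet> b))"
    by (rule Bochner_Integration.integral_sum[symmetric]) (rule i)
  also have "\<dots> = (LBINT x. W' x \<bullet> dphi \<kappa> c x - \<kappa> * (W x * phi \<kappa> c x))"
  proof (intro Bochner_Integration.integral_cong refl)
    fix x :: 'a
    have "(\<Sum>b\<in>Basis. (W x *\<^sub>R H b x + (dphi \<kappa> c x \<bullet> b) *\<^sub>R W' x) \<bullet> b)
      = W x * (\<Sum>b\<in>Basis. H b x \<bullet> b) + (\<Sum>b\<in>Basis. (W' x \<bullet> b) * (dphi \<kappa> c x \<bullet> b))"
      by (simp add: inner_add_left sum.distrib sum_distrib_left mult_ac)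
    also have "(\<Sum>b\<in>Basis. H b x \<bullet> b) = - \<kappa> * phi \<kappa> c x"
      unfolding H_def by (rule phi_laplace)
    finally show "(\<Sum>b\<in>Basis. (W x *\<^sub>R H b x + (dphi \<kappa> c x \<bullet> b) *\<^sub>R W' x) \<bullet> b)
      = W' x \<bullet> dphi \<kappa> c x - \<kappa> * (W x * phi \<kappa> c x)"
      unfolding euclidean_inner[of "W' x" "dphi \<kappa> c x"] by simp
  qed
  also have "\<dots> = (LBINT x. W' x \<bullet> dphi \<kappa> c x) - \<kappa> * (LBINT x. W x * phi \<kappa> c x)"
    using i1 i2 by simp
  finally show ?thesis by simp
qed

text \<open>Jacobi's ground-state substitution \<open>u = \<phi> v\<close>.\<close>
lemma ground_state_identity:
  fixes v :: "'a::euclidean_space \<Rightarrow> real" and c :: 'a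
  assumes v: "C1g v v'" and K: "compact K" "\<And>x. x \<notin> K \<Longrightarrow> v x = 0"
  shows "sqint lborel (\<lambda>x. phi \<kappa> c x *\<^sub>R v' x + v x *\<^sub>R dphi \<kappa> c x)
    = (LBINT x. (phi \<kappa> c x)\<^sup>2 * (norm (v' x))\<^sup>2) + \<kappa> * (LBINT x. (phi \<kappa> c x * v x)\<^sup>2)"
proof -
  let ?p = "phi \<kappa> c" and ?d = "dphi \<kappa> c"
  have v'0: "v' x = 0" if "x \<notin> K" for x
    using C1g_zero_off[OF v compact_imp_closed[OF K(1)] K(2) that] .
  \<comment> \<open>With this \<open>W\<close>, \<open>|\<phi> \<nabla>v + v \<nabla>\<phi>|^2 =
    \<phi>^2 |\<nabla>v|^2 + \<nabla>W \<bullet> \<nabla>\<phi>\<close>, and the weak equation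
    integrates the last term.\<close>
  define W where "W x = ?p x * (v x * v x)" for x
  define W' where "W' x = ?p x *\<^sub>R (v x *\<^sub>R v' x + v x *\<^sub>R v' x) + (v x * v x) *\<^sub>R ?d x" for x
  have W: "C1g W W'"
    unfolding W_def[abs_def] W'_def[abs_def] by (intro C1g_mult C1g_phi v)
  have i1: "integrable lborel (\<lambda>x. (?p x)\<^sup>2 * (norm (v' x))\<^sup>2)"
    by (rule integrable_compact_support[OF _ K(1)])
      (auto simp: v'0 intro!: continuous_intros C1g_cont_grad[OF v] C1g_cont[OF C1g_phi])
  have i2: "integrable lborel (\<lambda>x. W' x \<bullet> ?d x)"
    by (rule integrable_compact_support[OF _ K(1)])
      (auto simp: W'_def v'0 K(2) intro!: continuous_intros C1g_cont_grad[OF W, unfolded W'_def[abs_def]]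
         C1g_cont_grad[OF C1g_phi])
  have "sqint lborel (\<lambda>x. ?p x *\<^sub>R v' x + v x *\<^sub>R ?d x)
     = (LBINT x. (?p x)\<^sup>2 * (norm (v' x))\<^sup>2 + W' x \<bullet> ?d x)"
    unfolding power2_norm_eq_inner W'_def
    by (intro Bochner_Integration.integral_cong) (auto simp: algebra_simps inner_commute power2_eq_square)
  also have "\<dots> = (LBINT x. (?p x)\<^sup>2 * (norm (v' x))\<^sup>2) + (LBINT x. W' x \<bullet> ?d x)"
    using i1 i2 by simp
  also have "(LBINT x. W' x \<bullet> ?d x) = \<kappa> * (LBINT x. W x * ?p x)"
    by (rule integral_grad_dphi[OF W K(1)]) (simp add: W_def K(2))
  also have "(\<lambda>x. W x * ?p x) = (\<lambda>x. (?p x * v x)\<^sup>2)"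
    by (auto simp: W_def power2_eq_square)
  finally show ?thesis .
qed

section \<open>Spectral gap of a ball\<close>

lemma nn_integral_lborel_scale:
  fixes f :: "'a::euclidean_space \<Rightarrow> ennreal"
  assumes [measurable]: "f \<in> borel_measurable borel" and a: "a \<noteq> 0"
  shows "ennreal (\<bar>a\<bar>^DIM('a)) * (\<integral>\<^sup>+x. f (c + a *\<^sub>R x) \<partial>lborel) = (\<integral>\<^sup>+x. f x \<partial>lborel)"
  by (subst (2) lborel_affine[OF a, of c])
    (simp add: nn_integral_density nn_integral_distr nn_integral_cmult)

text \<open>The Jacobian \<open>a^(-N)\<close> of the substitution is at most
  \<open>2^N\<close>.\<close>

lemma nn_integral_scale_half_le:
  fixes f :: "'a::euclidean_space \<Rightarrow> ennreal"
  assumes [measurable]: "f \<in> borel_measurable borel" and a: "1/2 \<le> a"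
  shows "(\<integral>\<^sup>+x. f (c + a *\<^sub>R x) \<partial>lborel) \<le> ennreal (2^DIM('a)) * (\<integral>\<^sup>+x. f x \<partial>lborel)"
proof -
  have "1 \<le> (2 * a)^DIM('a)" using a by (intro one_le_power) simp
  then have "1 \<le> ennreal (2^DIM('a) * \<bar>a\<bar>^DIM('a))"
    using a by (simp add: power_mult_distrib)
  then have "1 * (\<integral>\<^sup>+x. f (c + a *\<^sub>R x) \<partial>lborel)
     \<le> ennreal (2^DIM('a) * \<bar>a\<bar>^DIM('a)) * (\<integral>\<^sup>+x. f (c + a *\<^sub>R x) \<partial>lborel)"
    by (rule mult_right_mono) simp
  also have "\<dots> = ennreal (2^DIM('a)) * (ennreal (\<bar>a\<bar>^DIM('a)) * (\<integral>\<^sup>+x. f (c + a *\<^sub>R x) \<partial>lborel))"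
    by (simp add: ennreal_mult' mult.assoc)
  also have "\<dots> = ennreal (2^DIM('a)) * (\<integral>\<^sup>+x. f x \<partial>lborel)"
    using a by (subst nn_integral_lborel_scale) auto
  finally show ?thesis by simp
qed

text \<open>For \<open>t \<le> 1/2\<close> the inner integral is taken in \<open>x\<close>, for \<open>t \<ge> 1/2\<close> in \<open>y\<close>, so that the
  Jacobian of the substitution is bounded.\<close>
lemma segment_average_bound:
  fixes H :: "'a::euclidean_space \<Rightarrow> ennreal" and B :: "'a set"
  assumes [measurable]: "H \<in> borel_measurable borel" "B \<in> sets borel"
  shows "(\<integral>\<^sup>+x. \<integral>\<^sup>+y. \<integral>\<^sup>+t. indicator B x * indicator B y * H (x + t *\<^sub>R (y - x)) * indicator {0..1::real} t
      \<partial>lborel \<partial>lborel \<partial>lborel)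
    \<le> emeasure lborel B * ennreal (2^DIM('a)) * (\<integral>\<^sup>+z. H z \<partial>lborel)" (is "?L \<le> ?R")
proof -
  let ?f = "\<lambda>x y t. indicator B x * indicator B y * H (x + t *\<^sub>R (y - x)) * indicator {0..1::real} t"
  have "?L = (\<integral>\<^sup>+x. \<integral>\<^sup>+t. \<integral>\<^sup>+y. ?f x y t \<partial>lborel \<partial>lborel \<partial>lborel)"
    by (intro nn_integral_cong lborel_pair.Fubini') measurable
  also have "\<dots> = (\<integral>\<^sup>+t. \<integral>\<^sup>+x. \<integral>\<^sup>+y. ?f x y t \<partial>lborel \<partial>lborel \<partial>lborel)"
    by (intro lborel_pair.Fubini') measurable
  also have "\<dots> \<le> (\<integral>\<^sup>+t. ?R * indicator {0..1::real} t \<partial>lborel)"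
  proof (rule nn_integral_mono)
    fix t :: real
    let ?H = "\<integral>\<^sup>+z. H z \<partial>lborel"
    consider "t \<notin> {0..1}" | "0 \<le> t" "t \<le> 1/2" | "1/2 \<le> t" "t \<le> 1" by fastforce
    then show "(\<integral>\<^sup>+x. \<integral>\<^sup>+y. ?f x y t \<partial>lborel \<partial>lborel) \<le> ?R * indicator {0..1::real} t"
    proof cases
      case 1
      then show ?thesis by simp
    next
      case 2
      have "(\<integral>\<^sup>+x. \<integral>\<^sup>+y. ?f x y t \<partial>lborel \<partial>lborel) = (\<integral>\<^sup>+y. \<integral>\<^sup>+x. ?f x y t \<partial>lborel \<partial>lborel)"
        by (intro lborel_pair.Fubini') measurable
      also have "\<dots> \<le> (\<integral>\<^sup>+y. indicator B y * (ennreal (2^DIM('a)) * ?H) \<partial>lborel)"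
      proof (rule nn_integral_mono)
        fix y
        have "(\<integral>\<^sup>+x. ?f x y t \<partial>lborel) \<le> (\<integral>\<^sup>+x. indicator B y * H (t *\<^sub>R y + (1 - t) *\<^sub>R x) \<partial>lborel)"
          by (intro nn_integral_mono) (auto simp: indicator_def algebra_simps)
        also have "\<dots> = indicator B y * (\<integral>\<^sup>+x. H (t *\<^sub>R y + (1 - t) *\<^sub>R x) \<partial>lborel)"
          by (intro nn_integral_cmult) measurable
        also have "\<dots> \<le> indicator B y * (ennreal (2^DIM('a)) * ?H)"
          using 2 by (intro mult_left_mono nn_integral_scale_half_le) auto
        finally show "(\<integral>\<^sup>+x. ?f x y t \<partial>lborel) \<le> indicator B y * (ennreal (2^DIM('a)) * ?H)" .
      qed
      also have "\<dots> = ?R"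
        by (subst nn_integral_multc) (auto simp: mult.assoc)
      finally show ?thesis using 2 by simp
    next
      case 3
      have "(\<integral>\<^sup>+x. \<integral>\<^sup>+y. ?f x y t \<partial>lborel \<partial>lborel) \<le> (\<integral>\<^sup>+x. indicator B x * (ennreal (2^DIM('a)) * ?H) \<partial>lborel)"
      proof (rule nn_integral_mono)
        fix x
        have "(\<integral>\<^sup>+y. ?f x y t \<partial>lborel) \<le> (\<integral>\<^sup>+y. indicator B x * H ((1 - t) *\<^sub>R x + t *\<^sub>R y) \<partial>lborel)"
          by (intro nn_integral_mono) (auto simp: indicator_def algebra_simps)
        also have "\<dots> = indicator B x * (\<integral>\<^sup>+y. H ((1 - t) *\<^sub>R x + t *\<^sub>R y) \<partial>lborel)"
          by (intro nn_integral_cmult) measurable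
        also have "\<dots> \<le> indicator B x * (ennreal (2^DIM('a)) * ?H)"
          using 3 by (intro mult_left_mono nn_integral_scale_half_le) auto
        finally show "(\<integral>\<^sup>+y. ?f x y t \<partial>lborel) \<le> indicator B x * (ennreal (2^DIM('a)) * ?H)" .
      qed
      also have "\<dots> = ?R"
        by (subst nn_integral_multc) (auto simp: mult.assoc)
      finally show ?thesis using 3 by simp
    qed
  qed
  also have "\<dots> = ?R"
    by (subst nn_integral_cmult) auto
  finally show ?thesis .
qed

text \<open>The symmetrised variance of \<open>v\<close> for the measure with density
  \<open>w\<^sup>2\<close>: expand the square and integrate each term. It leads from differences
  \<open>v y - v x\<close>, which segments control, to a Poincare inequality.\<close>

lemma weighted_variance_eq:
  fixes w v :: "'a \<Rightarrow> real"
  assumes "sigma_finite_measure M"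
    and i0: "integrable M (\<lambda>x. (w x)\<^sup>2)" and i1: "integrable M (\<lambda>x. (w x)\<^sup>2 * v x)"
    and i2: "integrable M (\<lambda>x. (w x)\<^sup>2 * (v x)\<^sup>2)"
  shows "(\<integral>\<^sup>+x. \<integral>\<^sup>+y. ennreal ((w x)\<^sup>2 * (w y)\<^sup>2 * (v y - v x)\<^sup>2) \<partial>M \<partial>M)
    = ennreal (2 * (\<integral>x. (w x)\<^sup>2 \<partial>M) * (\<integral>x. (w x)\<^sup>2 * (v x)\<^sup>2 \<partial>M) - 2 * (\<integral>x. (w x)\<^sup>2 * v x \<partial>M)\<^sup>2)"
proof -
  define a where "a = (\<integral>x. (w x)\<^sup>2 \<partial>M)"
  define b where "b = (\<integral>x. (w x)\<^sup>2 * v x \<partial>M)"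
  define c where "c = (\<integral>x. (w x)\<^sup>2 * (v x)\<^sup>2 \<partial>M)"
  have e: "(w x)\<^sup>2 * (w y)\<^sup>2 * (v y - v x)\<^sup>2 =
      (w x)\<^sup>2 * ((w y)\<^sup>2 * (v y)\<^sup>2) - 2 * ((w x)\<^sup>2 * v x) * ((w y)\<^sup>2 * v y) + (w x)\<^sup>2 * (v x)\<^sup>2 * (w y)\<^sup>2" for x y
    by (simp add: power2_eq_square algebra_simps)
  have ii: "integrable M (\<lambda>y. (w x)\<^sup>2 * (w y)\<^sup>2 * (v y - v x)\<^sup>2)" for x
    unfolding e using i0 i1 i2 by auto
  have val: "(\<integral>y. (w x)\<^sup>2 * (w y)\<^sup>2 * (v y - v x)\<^sup>2 \<partial>M)
     = (w x)\<^sup>2 * c - 2 * ((w x)\<^sup>2 * v x) * b + (w x)\<^sup>2 * (v x)\<^sup>2 * a" for x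
    unfolding e a_def b_def c_def using i0 i1 i2 by simp
  have nn: "0 \<le> (w x)\<^sup>2 * c - 2 * ((w x)\<^sup>2 * v x) * b + (w x)\<^sup>2 * (v x)\<^sup>2 * a" for x
    unfolding val[symmetric] by (intro Bochner_Integration.integral_nonneg) simp
  have "(\<integral>\<^sup>+x. \<integral>\<^sup>+y. ennreal ((w x)\<^sup>2 * (w y)\<^sup>2 * (v y - v x)\<^sup>2) \<partial>M \<partial>M)
     = (\<integral>\<^sup>+x. ennreal ((w x)\<^sup>2 * c - 2 * ((w x)\<^sup>2 * v x) * b + (w x)\<^sup>2 * (v x)\<^sup>2 * a) \<partial>M)"
    by (subst nn_integral_eq_integral[OF ii]) (auto simp: val)
  also have "\<dots> = ennreal (\<integral>x. (w x)\<^sup>2 * c - 2 * ((w x)\<^sup>2 * v x) * b + (w x)\<^sup>2 * (v x)\<^sup>2 * a \<partial>M)"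
    by (rule nn_integral_eq_integral) (use i0 i1 i2 nn in auto)
  also have "(\<integral>x. (w x)\<^sup>2 * c - 2 * ((w x)\<^sup>2 * v x) * b + (w x)\<^sup>2 * (v x)\<^sup>2 * a \<partial>M) = 2 * a * c - 2 * b\<^sup>2"
  proof -
    have "(\<integral>x. (w x)\<^sup>2 * c - 2 * ((w x)\<^sup>2 * v x) * b + (w x)\<^sup>2 * (v x)\<^sup>2 * a \<partial>M)
      = (\<integral>x. (w x)\<^sup>2 * c - ((w x)\<^sup>2 * v x) * (2 * b) + (w x)\<^sup>2 * (v x)\<^sup>2 * a \<partial>M)"
      by (intro Bochner_Integration.integral_cong) (auto simp: mult_ac)
    also have "\<dots> = (\<integral>x. (w x)\<^sup>2 * c \<partial>M) - (\<integral>x. ((w x)\<^sup>2 * v x) * (2 * b) \<partial>M) + (\<integral>x. (w x)\<^sup>2 * (v x)\<^sup>2 * a \<partial>M)"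
      by (subst Bochner_Integration.integral_add, intro Bochner_Integration.integrable_diff integrable_mult_left i0 i1,
          intro integrable_mult_left i2, subst Bochner_Integration.integral_diff)
        (intro integrable_mult_left i0 i1 refl)+
    also have "\<dots> = a * c - b * (2 * b) + c * a"
      unfolding a_def b_def c_def by simp
    finally show ?thesis by (simp add: power2_eq_square)
  qed
  finally show ?thesis unfolding a_def b_def c_def .
qed

lemma C1g_divide:
  assumes "(u has_derivative (\<lambda>h. u' \<bullet> h)) (at x)" "(p has_derivative (\<lambda>h. p' \<bullet> h)) (at x)" "p x \<noteq> (0::real)"
  shows "((\<lambda>x. u x / p x) has_derivative (\<lambda>h. ((1 / p x) *\<^sub>R u' - (u x / (p x)\<^sup>2) *\<^sub>R p') \<bullet> h)) (at x)"
  by (rule has_derivative_eq_rhs[OF has_derivative_divide'[OF assms]])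
    (use assms(3) in \<open>auto simp: inner_diff_left field_simps power2_eq_square\<close>)

locale bessel_ball =
  fixes c :: "'a::euclidean_space" and \<rho> \<kappa> :: real
  assumes \<rho>: "0 < \<rho>" "\<rho> \<le> 1/2" and \<kappa>: "0 < \<kappa>"
    and bF_zero: "bF DIM('a) (\<kappa> * \<rho>\<^sup>2) = 0"
    and bF_pos: "\<And>t. 0 \<le> t \<Longrightarrow> t < \<kappa> * \<rho>\<^sup>2 \<Longrightarrow> 0 < bF DIM('a) t"
begin

definition w :: "'a \<Rightarrow> real" where "w x = indicator (ball c \<rho>) x * phi \<kappa> c x"

lemma arg_less: "x \<in> ball c \<rho> \<Longrightarrow> \<kappa> * (norm (x - c))\<^sup>2 < \<kappa> * \<rho>\<^sup>2"
  using \<kappa> \<rho> by (auto simp: dist_norm norm_minus_commute intro!: power_strict_mono)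

lemma phi_pos: "x \<in> ball c \<rho> \<Longrightarrow> 0 < phi \<kappa> c x"
  unfolding phi_def using bF_pos[of "\<kappa> * (norm (x - c))\<^sup>2"] arg_less \<kappa> by simp

lemma phi_sphere: "x \<in> sphere c \<rho> \<Longrightarrow> phi \<kappa> c x = 0"
  using bF_zero by (simp add: phi_def dist_norm norm_minus_commute)

lemma bF_antimono: "0 \<le> s \<Longrightarrow> s \<le> t \<Longrightarrow> t \<le> \<kappa> * \<rho>\<^sup>2 \<Longrightarrow> bF DIM('a) t \<le> bF DIM('a) s"
proof (rule DERIV_nonpos_imp_decreasing_open[of s t])
  fix x assume *: "0 \<le> s" "s \<le> t" "t \<le> \<kappa> * \<rho>\<^sup>2" "s < x" "x < t"
  have "bF' DIM('a) x < 0"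
    by (rule bF'_neg[OF DIM_ge_1]) (use * in \<open>auto intro!: bF_pos\<close>)
  then show "\<exists>y. (bF DIM('a) has_real_derivative y) (at x) \<and> y \<le> 0"
    using bF_deriv[OF DIM_ge_1[where 'a='a], of x] by (intro exI[of _ "bF' DIM('a) x"]) auto
qed (use bF_cont[OF DIM_ge_1] in auto)

lemma w_measurable [measurable]: "w \<in> borel_measurable borel"
  unfolding w_def[abs_def]
  by (intro borel_measurable_times borel_measurable_indicator C1g_measurable(1)[OF C1g_phi]) simp

lemma w_nonneg: "0 \<le> w x"
  using phi_pos[of x] by (auto simp: w_def indicator_def)

lemma w_le_1: "w x \<le> 1"
proof (cases "x \<in> ball c \<rho>")
  case True
  have "bF DIM('a) (\<kappa> * (norm (x - c))\<^sup>2) \<le> bF DIM('a) 0"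
    using arg_less[OF True] \<kappa> by (intro bF_antimono) auto
  then show ?thesis using True by (simp add: w_def phi_def bF_0[OF DIM_ge_1])
qed (simp add: w_def)

text \<open>The weight is radially decreasing, and along a segment the distance to the centre never
  exceeds the larger of its values at the endpoints.\<close>

lemma w_quasi_concave:
  assumes "x \<in> ball c \<rho>" "y \<in> ball c \<rho>" "0 \<le> t" "t \<le> 1"
  shows "min (w x) (w y) \<le> w (x + t *\<^sub>R (y - x))"
proof -
  let ?z = "x + t *\<^sub>R (y - x)"
  define m where "m = max (norm (x - c)) (norm (y - c))"
  have "?z - c = (1 - t) *\<^sub>R (x - c) + t *\<^sub>R (y - c)" by (simp add: algebra_simps)
  then have "norm (?z - c) \<le> (1 - t) * norm (x - c) + t * norm (y - c)"
    using norm_triangle_ineq[of "(1 - t) *\<^sub>R (x - c)" "t *\<^sub>R (y - c)"] assms by simp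
  also have "\<dots> \<le> (1 - t) * m + t * m"
    using assms by (intro add_mono mult_left_mono) (auto simp: m_def)
  finally have zm: "norm (?z - c) \<le> m" by (simp add: algebra_simps)
  have m: "m < \<rho>" "0 \<le> m" using assms by (auto simp: m_def dist_norm norm_minus_commute le_max_iff_disj)
  have zB: "?z \<in> ball c \<rho>" using zm m by (simp add: dist_norm norm_minus_commute)
  have mr: "\<kappa> * m\<^sup>2 \<le> \<kappa> * \<rho>\<^sup>2" using m \<kappa> by (intro mult_left_mono power_mono) auto
  have "bF DIM('a) (\<kappa> * m\<^sup>2) \<le> bF DIM('a) (\<kappa> * (norm (?z - c))\<^sup>2)"
    using zm \<kappa> by (intro bF_antimono mr mult_left_mono[OF power_mono]) auto
  moreover have "min (w x) (w y) \<le> bF DIM('a) (\<kappa> * m\<^sup>2)"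
    using assms by (auto simp: w_def phi_def m_def max_def min_def)
  ultimately show ?thesis using zB by (simp add: w_def phi_def)
qed

lemma w_square_integrable: "L2 lborel w"
  unfolding L2_def
proof
  show "integrable lborel (\<lambda>x. (norm (w x))\<^sup>2)"
  proof (rule Bochner_Integration.integrable_bound)
    show "integrable lborel (indicator (ball c \<rho>) :: 'a \<Rightarrow> real)"
      by (intro integrable_real_indicator emeasure_bounded_finite) auto
    show "AE x in lborel. norm ((norm (w x))\<^sup>2) \<le> norm (indicator (ball c \<rho>) x :: real)"
    proof (rule AE_I2)
      fix x
      show "norm ((norm (w x))\<^sup>2) \<le> norm (indicator (ball c \<rho>) x :: real)"
        using power_le_one[OF w_nonneg w_le_1, of x 2] by (cases "x \<in> ball c \<rho>") (auto simp: w_def)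
    qed
  qed simp
qed simp

definition A :: real where "A = (LBINT x. (w x)\<^sup>2)"

lemma A_pos: "0 < A"
proof -
  have "A \<noteq> 0"
  proof
    assume "A = 0"
    then have "AE x in lborel. w x = 0"
      using L2_AE_zero[OF w_square_integrable] by (simp add: A_def)
    then have "AE x in lborel. x \<notin> ball c \<rho>"
      by eventually_elim (use phi_pos in \<open>force simp: w_def\<close>)
    then have "emeasure lborel (ball c \<rho>) = 0"
      by (subst (asm) AE_iff_measurable[of "ball c \<rho>"]) auto
    then show False using \<rho> unit_ball_vol_pos[of "real DIM('a)"] by (auto simp: emeasure_ball)
  qed
  moreover have "0 \<le> A" unfolding A_def by simp
  ultimately show ?thesis by simp
qed

text \<open>The constant that \<open>segment_average_bound\<close> yields for the ball.\<close>

definition C :: real where "C = measure lborel (ball c \<rho>) * 2^DIM('a)"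

lemma C_pos: "0 < C"
  using \<rho> by (simp add: C_def content_ball unit_ball_vol_pos)

text \<open>Twice the variance is the double integral of
  \<open>w(x)\<^sup>2 w(y)\<^sup>2 (v(y) - v(x))\<^sup>2\<close>. Each difference is bounded along
  its segment, the weight is moved to the intermediate point by quasi-concavity, and
  \<open>segment_average_bound\<close> integrates over all segments.\<close>

lemma weighted_poincare:
  assumes v: "C1g v v'" and K: "compact K" "K \<subseteq> ball c \<rho>" "\<And>x. x \<notin> K \<Longrightarrow> v x = 0"
  shows "2 * A * (LBINT x. (phi \<kappa> c x * v x)\<^sup>2) - 2 * (LBINT x. w x * (phi \<kappa> c x * v x))\<^sup>2
     \<le> C * (LBINT x. (phi \<kappa> c x)\<^sup>2 * (norm (v' x))\<^sup>2)"
proof -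
  let ?p = "phi \<kappa> c"
  let ?B = "ball c \<rho>"
  have v'0: "v' x = 0" if "x \<notin> K" for x
    using C1g_zero_off[OF v compact_imp_closed[OF K(1)] K(3) that] .
  have [measurable]: "v \<in> borel_measurable borel" "v' \<in> borel_measurable borel"
    using C1g_measurable[OF v] by auto
  \<comment> \<open>The support of \<open>v\<close> lies in the ball, where \<open>w\<close> and
    \<open>phi\<close> agree, so the discontinuous indicator can be traded for the smooth
    \<open>phi\<close>.\<close>
  have wv: "w x * v x = ?p x * v x" "(w x)\<^sup>2 * v x = (?p x)\<^sup>2 * v x"
    "(w x)\<^sup>2 * (v x)\<^sup>2 = (?p x)\<^sup>2 * (v x)\<^sup>2" "(w x)\<^sup>2 * (norm (v' x))\<^sup>2 = (?p x)\<^sup>2 * (norm (v' x))\<^sup>2" for x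
    using K(2) K(3)[of x] v'0[of x]
    by (cases "x \<in> K"; auto simp: w_def indicator_def)+
  define E where "E = (LBINT x. (?p x)\<^sup>2 * (norm (v' x))\<^sup>2)"
  have iE: "integrable lborel (\<lambda>x. (?p x)\<^sup>2 * (norm (v' x))\<^sup>2)"
    by (rule integrable_compact_support[OF _ K(1)])
      (auto simp: v'0 intro!: continuous_intros C1g_cont_grad[OF v] C1g_cont[OF C1g_phi])
  have i0: "integrable lborel (\<lambda>x. (w x)\<^sup>2)" using L2_integrable[OF w_square_integrable] by simp
  have i1: "integrable lborel (\<lambda>x. (w x)\<^sup>2 * v x)" unfolding wv
    by (rule integrable_compact_support[OF _ K(1)])
      (auto simp: K(3) intro!: continuous_intros C1g_cont[OF v] C1g_cont[OF C1g_phi])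
  have i2: "integrable lborel (\<lambda>x. (w x)\<^sup>2 * (v x)\<^sup>2)" unfolding wv
    by (rule integrable_compact_support[OF _ K(1)])
      (auto simp: K(3) intro!: continuous_intros C1g_cont[OF v] C1g_cont[OF C1g_phi])
  define H where "H z = ennreal ((w z)\<^sup>2 * (norm (v' z))\<^sup>2)" for z
  have [measurable]: "H \<in> borel_measurable borel" unfolding H_def[abs_def] by measurable
  have "ennreal (2 * A * (LBINT x. (w x)\<^sup>2 * (v x)\<^sup>2) - 2 * (LBINT x. (w x)\<^sup>2 * v x)\<^sup>2)
     = (\<integral>\<^sup>+x. \<integral>\<^sup>+y. ennreal ((w x)\<^sup>2 * (w y)\<^sup>2 * (v y - v x)\<^sup>2) \<partial>lborel \<partial>lborel)"
    unfolding A_def by (rule weighted_variance_eq[OF sigma_finite_lborel i0 i1 i2, symmetric])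
  also have "\<dots> \<le> (\<integral>\<^sup>+x. \<integral>\<^sup>+y. \<integral>\<^sup>+t. indicator ?B x * indicator ?B y * H (x + t *\<^sub>R (y - x)) * indicator {0..1::real} t
      \<partial>lborel \<partial>lborel \<partial>lborel)"
  proof (intro nn_integral_mono)
    fix x y :: 'a
    let ?I = "\<integral>\<^sup>+t. indicator ?B x * indicator ?B y * H (x + t *\<^sub>R (y - x)) * indicator {0..1::real} t \<partial>lborel"
    show "ennreal ((w x)\<^sup>2 * (w y)\<^sup>2 * (v y - v x)\<^sup>2) \<le> ?I"
    proof (cases "x \<in> ?B \<and> y \<in> ?B")
      case True
      have "norm (y - x) \<le> dist y c + dist c x" using dist_triangle[of y x c] by (simp add: dist_norm)
      also have "\<dots> \<le> 1" using True \<rho> by (simp add: dist_commute)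
      finally have "(norm (y - x))\<^sup>2 \<le> 1" by (simp add: abs_square_le_1)
      then have "ennreal ((v y - v x)\<^sup>2) \<le>
          1 * (\<integral>\<^sup>+t. ennreal ((norm (v' (x + t *\<^sub>R (y - x))))\<^sup>2) * indicator {0..1} t \<partial>lborel)"
        by (intro order_trans[OF C1g_segment_bound[OF v]] mult_right_mono) auto
      then have "ennreal ((w x)\<^sup>2 * (w y)\<^sup>2) * ennreal ((v y - v x)\<^sup>2) \<le> ennreal ((w x)\<^sup>2 * (w y)\<^sup>2) *
          (\<integral>\<^sup>+t. ennreal ((norm (v' (x + t *\<^sub>R (y - x))))\<^sup>2) * indicator {0..1} t \<partial>lborel)"
        by (intro mult_left_mono) auto
      also have "\<dots> = (\<integral>\<^sup>+t. ennreal ((w x)\<^sup>2 * (w y)\<^sup>2) *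
          (ennreal ((norm (v' (x + t *\<^sub>R (y - x))))\<^sup>2) * indicator {0..1} t) \<partial>lborel)"
        by (intro nn_integral_cmult[symmetric]) measurable
      also have "\<dots> \<le> ?I"
      proof (rule nn_integral_mono)
        fix t :: real
        show "ennreal ((w x)\<^sup>2 * (w y)\<^sup>2) * (ennreal ((norm (v' (x + t *\<^sub>R (y - x))))\<^sup>2) * indicator {0..1} t)
          \<le> indicator ?B x * indicator ?B y * H (x + t *\<^sub>R (y - x)) * indicator {0..1::real} t"
        proof (cases "t \<in> {0..1}")
          case t: True
          \<comment> \<open>For two numbers in \<open>[0, 1]\<close> the product is at most the
            minimum, which is what quasi-concavity compares with.\<close>
          have "w x * w y \<le> min (w x) (w y)"
            using w_nonneg[of x] w_nonneg[of y] w_le_1[of x] w_le_1[of y]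
            by (simp add: mult_left_le mult_left_le_one_le)
          also have "\<dots> \<le> w (x + t *\<^sub>R (y - x))" using w_quasi_concave[of x y t] True t by auto
          finally have "(w x * w y)\<^sup>2 \<le> (w (x + t *\<^sub>R (y - x)))\<^sup>2"
            using w_nonneg by (intro power_mono) auto
          then have "(w x)\<^sup>2 * (w y)\<^sup>2 * (norm (v' (x + t *\<^sub>R (y - x))))\<^sup>2
             \<le> (w (x + t *\<^sub>R (y - x)))\<^sup>2 * (norm (v' (x + t *\<^sub>R (y - x))))\<^sup>2"
            by (intro mult_right_mono) (auto simp: power_mult_distrib)
          then show ?thesis
            using t True by (simp add: H_def ennreal_mult'[symmetric] ennreal_leI)
        qed simp
      qed
      finally show ?thesis by (simp add: ennreal_mult'[symmetric])
    qed (auto simp: w_def)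
  qed
  also have "\<dots> \<le> emeasure lborel ?B * ennreal (2^DIM('a)) * (\<integral>\<^sup>+z. H z \<partial>lborel)"
    by (rule segment_average_bound) measurable
  also have "(\<integral>\<^sup>+z. H z \<partial>lborel) = ennreal E"
    unfolding H_def wv E_def by (rule nn_integral_eq_integral[OF iE]) simp
  also have "emeasure lborel ?B = ennreal (measure lborel ?B)"
    using emeasure_bounded_finite[of ?B] by (intro emeasure_eq_ennreal_measure) auto
  also have "ennreal (measure lborel ?B) * ennreal (2^DIM('a)) * ennreal E = ennreal (C * E)"
    by (simp add: C_def ennreal_mult'[symmetric] E_def)
  finally have "2 * A * (LBINT x. (w x)\<^sup>2 * (v x)\<^sup>2) - 2 * (LBINT x. (w x)\<^sup>2 * v x)\<^sup>2 \<le> C * E"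
    using C_pos by (subst (asm) ennreal_le_iff) (auto simp: E_def)
  moreover have "(w x)\<^sup>2 * v x = w x * (?p x * v x)" for x
    using wv(1)[of x] by (simp add: power2_eq_square mult.assoc)
  moreover have "(w x)\<^sup>2 * (v x)\<^sup>2 = (?p x * v x)\<^sup>2" for x
    unfolding wv by (simp add: power_mult_distrib)
  ultimately show ?thesis by (simp add: E_def)
qed

text \<open>Put \<open>v = u / phi\<close>. Since the support of \<open>u\<close> is compact in the
  open ball, \<open>v\<close> stays away from the boundary zeros of \<open>phi\<close> and is again
  C1; the ground-state identity then makes the deficit
  \<open>\<integral>|\<nabla>u|^2 - \<kappa> \<integral>u^2\<close> the weighted energy of
  \<open>v\<close>.\<close>

lemma ball_gap:
  assumes u: "C1g u u'" and K: "compact K" "K \<subseteq> ball c \<rho>" "\<And>x. x \<notin> K \<Longrightarrow> u x = 0"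
  shows "2 * A * (LBINT x. (u x)\<^sup>2) - 2 * (LBINT x. w x * u x)\<^sup>2
     \<le> C * (sqint lborel u' - \<kappa> * (LBINT x. (u x)\<^sup>2))" (is ?gap)
    and "\<kappa> * (LBINT x. (u x)\<^sup>2) \<le> sqint lborel u'" (is ?poincare)
proof -
  let ?p = "phi \<kappa> c" and ?d = "dphi \<kappa> c" and ?B = "ball c \<rho>"
  have u'0: "u' x = 0" if "x \<notin> K" for x
    using C1g_zero_off[OF u compact_imp_closed[OF K(1)] K(3) that] .
  define v where "v x = (if x \<in> ?B then u x / ?p x else 0)" for x
  define v' where "v' x = (if x \<in> ?B then (1 / ?p x) *\<^sub>R u' x - (u x / (?p x)\<^sup>2) *\<^sub>R ?d x else 0)" for x
  have v: "C1g v v'"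
    unfolding v_def[abs_def] v'_def[abs_def]
  proof (rule C1g_restrict[of _ "-K"])
    show "((\<lambda>x. u x / ?p x) has_derivative (\<bullet>) ((1 / ?p x) *\<^sub>R u' x - (u x / (?p x)\<^sup>2) *\<^sub>R ?d x)) (at x)"
      if "x \<in> ?B" for x
      using C1g_divide[OF C1g_deriv[OF u] C1g_deriv[OF C1g_phi]] phi_pos[OF that] by fastforce
    show "continuous_on ?B (\<lambda>x. (1 / ?p x) *\<^sub>R u' x - (u x / (?p x)\<^sup>2) *\<^sub>R ?d x)"
      using phi_pos
      by (intro continuous_intros continuous_on_subset[OF C1g_cont[OF u]] continuous_on_subset[OF C1g_cont_grad[OF u]]
        continuous_on_subset[OF C1g_cont[OF C1g_phi]] continuous_on_subset[OF C1g_cont_grad[OF C1g_phi]]) force+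
  qed (use K in \<open>auto simp: compact_imp_closed open_Compl\<close>)
  have vK: "v x = 0" if "x \<notin> K" for x using K(3)[OF that] by (simp add: v_def)
  have pv: "?p x * v x = u x" for x
    using phi_pos[of x] K(2) K(3)[of x] by (cases "x \<in> K") (auto simp: v_def)
  have pv': "?p x *\<^sub>R v' x + v x *\<^sub>R ?d x = u' x" for x
    using phi_pos[of x] K(2) K(3)[of x] u'0[of x]
    by (cases "x \<in> K") (auto simp: v_def v'_def algebra_simps power2_eq_square)
  have gs: "sqint lborel u' =
     (LBINT x. (?p x)\<^sup>2 * (norm (v' x))\<^sup>2) + \<kappa> * (LBINT x. (u x)\<^sup>2)"
    using ground_state_identity[OF v K(1) vK, of \<kappa> c] unfolding pv pv' .
  show ?gap using weighted_poincare[OF v K(1,2) vK] unfolding pv gs by simp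
  show ?poincare unfolding gs by simp
qed

end

section \<open>Spectral gap of the union of two balls\<close>

lemma Ck_phi: "Ck k (phi \<kappa> c)"
proof -
  have "Ck k (\<lambda>x::'a. \<kappa> * (\<Sum>b\<in>Basis. (x \<bullet> b + - (c \<bullet> b)) * (x \<bullet> b + - (c \<bullet> b))))"
    by (intro Ck_mult Ck_sum Ck_add Ck_const Ck_inner_left finite_Basis)
  also have "(\<lambda>x::'a. \<kappa> * (\<Sum>b\<in>Basis. (x \<bullet> b + - (c \<bullet> b)) * (x \<bullet> b + - (c \<bullet> b)))) = (\<lambda>x. \<kappa> * (norm (x - c))\<^sup>2)"
    unfolding power2_norm_eq_inner euclidean_inner[of "_ - _" "_ - _"] by (simp add: inner_diff_left)
  finally show ?thesis
    unfolding phi_def[abs_def] bF_def[abs_def]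
    by (rule Ck_compose) (rule Ck_powser[OF summable_bcoeff[OF DIM_ge_1]])
qed

text \<open>For \<open>s > \<eta>\<close> this is \<open>(s - \<eta>) exp (- \<eta> / (s - \<eta>))\<close>, whose derivative lies in \<open>[0, 1]\<close>
  because \<open>(1 + y) exp (- y) \<le> 1\<close>. The bound on the derivative spares any control of the
  gradient near the boundary in the energy estimate below.\<close>
definition trunc :: "real \<Rightarrow> real \<Rightarrow> real" where
  "trunc \<eta> s = (s - \<eta>) * flat 1 ((s - \<eta>) / \<eta>)"

definition trunc' :: "real \<Rightarrow> real \<Rightarrow> real" where
  "trunc' \<eta> s = flat 1 ((s - \<eta>) / \<eta>) + (s - \<eta>) / \<eta> * flat [:0,0,1:] ((s - \<eta>) / \<eta>)"

context
  fixes \<eta> :: real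
  assumes \<eta>: "0 < \<eta>"
begin

lemma trunc_zero: "s \<le> \<eta> \<Longrightarrow> trunc \<eta> s = 0"
  using \<eta> by (simp add: trunc_def flat_def zero_less_divide_iff)

lemma trunc_eq: "\<eta> < s \<Longrightarrow> trunc \<eta> s = (s - \<eta>) * exp (- (\<eta> / (s - \<eta>)))"
  using \<eta> by (simp add: trunc_def flat_def)

lemma trunc_nonneg: "0 \<le> trunc \<eta> s"
  using trunc_zero[of s] trunc_eq[of s] by (cases "s \<le> \<eta>") auto

lemma trunc_le: "0 \<le> s \<Longrightarrow> trunc \<eta> s \<le> s"
proof (cases "s \<le> \<eta>")
  case False
  then have "trunc \<eta> s \<le> (s - \<eta>) * 1"
    using \<eta> unfolding trunc_eq[OF not_le_imp_less[OF False]] by (intro mult_left_mono) auto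
  then show ?thesis using \<eta> by simp
qed (simp add: trunc_zero)

lemma trunc_deriv: "(trunc \<eta> has_real_derivative trunc' \<eta> s) (at s)"
proof -
  have d: "((\<lambda>s. (s - \<eta>) / \<eta>) has_real_derivative 1 / \<eta>) (at s)"
    using \<eta> by (auto intro!: derivative_eq_intros)
  have "((\<lambda>s. flat 1 ((s - \<eta>) / \<eta>)) has_real_derivative flat [:0,0,1:] ((s - \<eta>) / \<eta>) * (1 / \<eta>)) (at s)"
    using DERIV_chain2[OF flat_deriv[of 1 "(s - \<eta>) / \<eta>"] d] by (simp add: one_pCons pderiv_pCons)
  then show ?thesis
    unfolding trunc_def[abs_def] trunc'_def by (auto intro!: derivative_eq_intros)
qed

lemma trunc'_bounds: "0 \<le> trunc' \<eta> s" "trunc' \<eta> s \<le> 1"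
proof -
  define y where "y = (s - \<eta>) / \<eta>"
  have *: "trunc' \<eta> s = flat 1 y + y * flat [:0,0,1:] y" by (simp add: trunc'_def y_def)
  have "0 \<le> trunc' \<eta> s \<and> trunc' \<eta> s \<le> 1"
  proof (cases "0 < y")
    case True
    have e: "trunc' \<eta> s = (1 + 1/y) * exp (- (1/y))"
      unfolding * using True by (simp add: flat_def field_simps)
    have "(1 + 1/y) * exp (- (1/y)) \<le> exp (1/y) * exp (- (1/y))"
      by (intro mult_right_mono exp_ge_add_one_self) simp
    then show ?thesis using True by (simp add: e exp_minus)
  qed (simp add: * flat_def)
  then show "0 \<le> trunc' \<eta> s" "trunc' \<eta> s \<le> 1" by auto
qed

lemma trunc'_cont: "continuous_on A (trunc' \<eta>)"
proof -
  have f: "continuous_on UNIV (flat p)" for p using Ck_flat[of 0 p] by simp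
  show ?thesis
    unfolding trunc'_def[abs_def]
    using \<eta> by (intro continuous_intros continuous_on_compose2[OF f]) auto
qed

lemma Ck_trunc: "Ck k (trunc \<eta>)"
proof -
  have "Ck k (\<lambda>s::real. (s \<bullet> (1/\<eta>)) + - 1)" by (intro Ck_add Ck_inner_left Ck_const)
  moreover have "(\<lambda>s::real. (s \<bullet> (1/\<eta>)) + - 1) = (\<lambda>s. (s - \<eta>) / \<eta>)"
    using \<eta> by (auto simp: field_simps)
  ultimately have "Ck k (\<lambda>s. flat 1 ((s - \<eta>) / \<eta>))" using Ck_compose[OF _ Ck_flat] by metis
  moreover have "Ck k (\<lambda>s::real. (s \<bullet> 1) + - \<eta>)" by (intro Ck_add Ck_inner_left Ck_const)
  ultimately show ?thesis unfolding trunc_def[abs_def] by (intro Ck_mult) auto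
qed

end

lemma trunc_tendsto:
  assumes "0 < s"
  shows "(\<lambda>n. trunc (1 / real (Suc n)) s) \<longlonglongrightarrow> s"
proof -
  have h: "(\<lambda>n. 1 / real (Suc n)) \<longlonglongrightarrow> 0"
    using LIMSEQ_inverse_real_of_nat by (simp add: inverse_eq_divide)
  have "(\<lambda>n. (s - 1 / real (Suc n)) * exp (- ((1 / real (Suc n)) / (s - 1 / real (Suc n))))) \<longlonglongrightarrow> (s - 0) * exp (- (0 / (s - 0)))"
    using assms by (intro tendsto_intros h) auto
  then have "(\<lambda>n. (s - 1 / real (Suc n)) * exp (- ((1 / real (Suc n)) / (s - 1 / real (Suc n))))) \<longlonglongrightarrow> s"
    by simp
  moreover have "\<forall>\<^sub>F n in sequentially. (s - 1 / real (Suc n)) * exp (- ((1 / real (Suc n)) / (s - 1 / real (Suc n)))) = trunc (1 / real (Suc n)) s"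
    using order_tendstoD(2)[OF h assms] by eventually_elim (simp add: trunc_eq)
  ultimately show ?thesis by (rule Lim_transform_eventually)
qed

context bessel_ball
begin

text \<open>Cutting the values of \<open>phi\<close> rather than multiplying by a cutoff in space:
  the result vanishes where \<open>phi\<close> is at most \<open>\<eta>\<close>, hence near the
  boundary, and its gradient is a multiple of that of \<open>phi\<close>.\<close>

definition cutoff :: "real \<Rightarrow> 'a \<Rightarrow> real" where
  "cutoff \<eta> x = (if x \<in> ball c \<rho> then trunc \<eta> (phi \<kappa> c x) else 0)"

context
  fixes \<eta> :: real
  assumes \<eta>: "0 < \<eta>"
begin

text \<open>A compact set carrying the cutoff. As \<open>phi\<close> vanishes on the sphere, this
  superlevel set stays inside the open ball.\<close>

definition S :: "'a set" where "S = cball c \<rho> \<inter> {x. \<eta> \<le> phi \<kappa> c x}"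

lemma S_compact: "compact S"
  unfolding S_def by (intro compact_Int_closed compact_cball closed_Collect_le C1g_cont[OF C1g_phi] continuous_on_const)

lemma S_subset: "S \<subseteq> ball c \<rho>"
proof
  fix x assume "x \<in> S"
  then have "dist c x \<le> \<rho>" "phi \<kappa> c x \<noteq> 0" using \<eta> by (auto simp: S_def)
  then show "x \<in> ball c \<rho>" using phi_sphere[of x] by (cases "dist c x = \<rho>") auto
qed

lemma cutoff_zero: "x \<notin> S \<Longrightarrow> cutoff \<eta> x = 0"
  using trunc_zero[OF \<eta>] by (auto simp: cutoff_def S_def)

lemma trunc_phi_zero: "x \<in> ball c \<rho> \<inter> - S \<Longrightarrow> trunc \<eta> (phi \<kappa> c x) = 0"
  using trunc_zero[OF \<eta>] by (auto simp: S_def)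

lemma cutoff_Ck: "Ck k (cutoff \<eta>)"
  unfolding cutoff_def[abs_def]
  by (rule Ck_restrict[of _ "-S"])
    (use S_subset trunc_phi_zero in \<open>auto simp: compact_imp_closed[OF S_compact] open_Compl
      intro!: Ck_compose[OF Ck_phi Ck_trunc[OF \<eta>]]\<close>)

lemma cutoff_test_fun: "test_fun (ball c \<rho>) (cutoff \<eta>)"
proof -
  have "closure {x. cutoff \<eta> x \<noteq> 0} \<subseteq> S"
    using cutoff_zero by (intro closure_minimal compact_imp_closed[OF S_compact]) auto
  then have "compact (closure {x. cutoff \<eta> x \<noteq> 0})" "closure {x. cutoff \<eta> x \<noteq> 0} \<subseteq> ball c \<rho>"
    using compact_Int_closed[OF S_compact closed_closure, of "{x. cutoff \<eta> x \<noteq> 0}"] S_subset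
    by (auto simp: inf.absorb2 simp del: compact_closure)
  then show ?thesis by (simp add: test_fun_def smooth_fun_def cutoff_Ck)
qed

lemma cutoff_C1g: "C1g (cutoff \<eta>) (\<lambda>x. if x \<in> ball c \<rho> then trunc' \<eta> (phi \<kappa> c x) *\<^sub>R dphi \<kappa> c x else 0)"
  unfolding cutoff_def[abs_def]
proof (rule C1g_restrict[of _ "-S"])
  fix x
  show "((\<lambda>x. trunc \<eta> (phi \<kappa> c x)) has_derivative (\<bullet>) (trunc' \<eta> (phi \<kappa> c x) *\<^sub>R dphi \<kappa> c x)) (at x)"
    by (rule has_derivative_eq_rhs[OF has_derivative_compose[OF C1g_deriv[OF C1g_phi]
          trunc_deriv[OF \<eta>, unfolded has_field_derivative_def]]]) auto
next
  show "continuous_on (ball c \<rho>) (\<lambda>x. trunc' \<eta> (phi \<kappa> c x) *\<^sub>R dphi \<kappa> c x)"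
    by (intro continuous_intros continuous_on_compose2[OF trunc'_cont[OF \<eta>, of UNIV]]
        continuous_on_subset[OF C1g_cont[OF C1g_phi]] continuous_on_subset[OF C1g_cont_grad[OF C1g_phi]]) auto
qed (use S_subset trunc_phi_zero in \<open>auto simp: compact_imp_closed[OF S_compact] open_Compl\<close>)

text \<open>As \<open>trunc'\<close> lies in \<open>[0, 1]\<close>, its square is at most itself, so
  the squared gradient of the cutoff is at most its inner product with the gradient of
  \<open>phi\<close>. The weak equation evaluates the latter.\<close>

lemma cutoff_energy_le:
  "sqint lborel (grad (cutoff \<eta>)) \<le> \<kappa> * (LBINT x. cutoff \<eta> x * w x)"
proof -
  let ?g = "grad (cutoff \<eta>)"
  have C: "C1g (cutoff \<eta>) ?g" using cutoff_C1g by (simp add: C1g_grad[OF cutoff_C1g])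
  have g: "?g x = (if x \<in> ball c \<rho> then trunc' \<eta> (phi \<kappa> c x) *\<^sub>R dphi \<kappa> c x else 0)" for x
    by (simp add: C1g_grad[OF cutoff_C1g])
  have g0: "?g x = 0" if "x \<notin> S" for x
    using C1g_zero_off[OF C compact_imp_closed[OF S_compact] cutoff_zero that] .
  have "sqint lborel ?g \<le> (LBINT x. ?g x \<bullet> dphi \<kappa> c x)"
  proof (rule integral_mono)
    show "integrable lborel (\<lambda>x. (norm (?g x))\<^sup>2)"
      by (rule integrable_compact_support[OF _ S_compact]) (auto simp: g0 intro!: continuous_intros C1g_cont_grad[OF C])
    show "integrable lborel (\<lambda>x. ?g x \<bullet> dphi \<kappa> c x)"
      by (rule integrable_compact_support[OF _ S_compact])
        (auto simp: g0 intro!: continuous_intros C1g_cont_grad[OF C] C1g_cont_grad[OF C1g_phi])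
    fix x
    have "(trunc' \<eta> (phi \<kappa> c x))\<^sup>2 \<le> trunc' \<eta> (phi \<kappa> c x)"
      using trunc'_bounds[OF \<eta>, of "phi \<kappa> c x"] by (simp add: power2_eq_square mult_left_le)
    then have "(trunc' \<eta> (phi \<kappa> c x))\<^sup>2 * (norm (dphi \<kappa> c x))\<^sup>2 \<le> trunc' \<eta> (phi \<kappa> c x) * (norm (dphi \<kappa> c x))\<^sup>2"
      by (rule mult_right_mono) simp
    then show "(norm (?g x))\<^sup>2 \<le> ?g x \<bullet> dphi \<kappa> c x"
      by (simp add: g power_mult_distrib power2_norm_eq_inner) (simp add: power2_eq_square mult.assoc)
  qed
  also have "\<dots> = \<kappa> * (LBINT x. cutoff \<eta> x * phi \<kappa> c x)"
    by (rule integral_grad_dphi[OF C S_compact cutoff_zero])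
  also have "(\<lambda>x. cutoff \<eta> x * phi \<kappa> c x) = (\<lambda>x. cutoff \<eta> x * w x)"
    by (auto simp: cutoff_def w_def)
  finally show ?thesis .
qed

lemma cutoff_bounds: "0 \<le> cutoff \<eta> x" "cutoff \<eta> x \<le> w x"
  using trunc_nonneg[OF \<eta>] trunc_le[OF \<eta>] phi_pos[of x]
  by (auto simp: cutoff_def w_def less_imp_le)

end

text \<open>For \<open>\<eta>\<close> tending to 0 the cutoffs increase to no more than
  \<open>w\<close> and converge to it. By domination with \<open>w\<^sup>2\<close>, the energy bound
  tends to \<open>\<kappa> * A\<close> and the squared norm to \<open>A\<close>.\<close>

lemma test_fun_near_eigenvalue:
  assumes "\<kappa> < \<mu>"
  shows "\<exists>u. test_fun (ball c \<rho>) u \<and> (sqint lborel (grad u)) < \<mu> * (LBINT x. (u x)\<^sup>2)"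
proof -
  define W where "W n = cutoff (1 / real (Suc n))" for n
  have \<eta>: "0 < 1 / real (Suc n)" for n by simp
  have Wm [measurable]: "W n \<in> borel_measurable borel" for n
    unfolding W_def by (rule C1g_measurable(1)[OF cutoff_C1g[OF \<eta>]])
  have lim: "(\<lambda>n. W n x) \<longlonglongrightarrow> w x" for x
    using trunc_tendsto[OF phi_pos[of x]] by (cases "x \<in> ball c \<rho>") (auto simp: W_def cutoff_def w_def)
  have b: "0 \<le> W n x" "W n x \<le> w x" for n x
    using cutoff_bounds[OF \<eta>] unfolding W_def by auto
  have iw: "integrable lborel (\<lambda>x. (w x)\<^sup>2)" using L2_integrable[OF w_square_integrable] by simp
  have l1: "(\<lambda>n. LBINT x. W n x * w x) \<longlonglongrightarrow> (LBINT x. (w x)\<^sup>2)"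
  proof (rule integral_dominated_convergence[OF _ _ iw])
    show "AE x in lborel. (\<lambda>n. W n x * w x) \<longlonglongrightarrow> (w x)\<^sup>2"
      unfolding power2_eq_square by (intro AE_I2 tendsto_intros lim)
    show "AE x in lborel. norm (W n x * w x) \<le> (w x)\<^sup>2" for n
      using b[of n] w_nonneg by (intro AE_I2) (simp add: power2_eq_square abs_mult mult_right_mono)
  qed auto
  have l2: "(\<lambda>n. LBINT x. (W n x)\<^sup>2) \<longlonglongrightarrow> (LBINT x. (w x)\<^sup>2)"
  proof (rule integral_dominated_convergence[OF _ _ iw])
    show "AE x in lborel. (\<lambda>n. (W n x)\<^sup>2) \<longlonglongrightarrow> (w x)\<^sup>2"
      by (intro AE_I2 tendsto_intros lim)
    show "AE x in lborel. norm ((W n x)\<^sup>2) \<le> (w x)\<^sup>2" for n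
      using b[of n] by (intro AE_I2) (simp add: power_mono)
  qed auto
  have "(\<lambda>n. \<mu> * (LBINT x. (W n x)\<^sup>2) - \<kappa> * (LBINT x. W n x * w x)) \<longlonglongrightarrow> \<mu> * A - \<kappa> * A"
    unfolding A_def by (intro tendsto_intros l1 l2)
  moreover have "0 < \<mu> * A - \<kappa> * A" using assms A_pos by simp
  ultimately have "\<forall>\<^sub>F n in sequentially. 0 < \<mu> * (LBINT x. (W n x)\<^sup>2) - \<kappa> * (LBINT x. W n x * w x)"
    by (rule order_tendstoD(1))
  then obtain n where "\<kappa> * (LBINT x. W n x * w x) < \<mu> * (LBINT x. (W n x)\<^sup>2)"
    by (auto dest!: eventually_happens'[OF sequentially_bot])
  then have "sqint lborel (grad (W n)) < \<mu> * (LBINT x. (W n x)\<^sup>2)"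
    using cutoff_energy_le[OF \<eta>[of n]] unfolding W_def by linarith
  then show ?thesis using cutoff_test_fun[OF \<eta>[of n]] unfolding W_def by blast
qed

end

section \<open>Test functions and their restriction to one of two disjoint open sets\<close>

lemma test_fun_C1g: "test_fun \<Omega> u \<Longrightarrow> C1g u (grad u)"
  by (rule Ck_C1g) (auto simp: test_fun_def smooth_fun_def simp del: Ck.simps)

lemma test_fun_support:
  assumes "test_fun \<Omega> u"
  obtains K where "compact K" "K \<subseteq> \<Omega>" "\<And>x. x \<notin> K \<Longrightarrow> u x = 0" "\<And>x. x \<notin> K \<Longrightarrow> grad u x = 0"
proof (rule that[of "closure {x. u x \<noteq> 0}"])
  show z: "u x = 0" if "x \<notin> closure {x. u x \<noteq> 0}" for x
    using that closure_subset[of "{x. u x \<noteq> 0}"] by blast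
  show "grad u x = 0" if "x \<notin> closure {x. u x \<noteq> 0}" for x
    by (rule C1g_zero_off[OF test_fun_C1g[OF assms] closed_closure z that])
qed (use assms in \<open>auto simp: test_fun_def\<close>)

lemma test_fun_L2:
  assumes "test_fun \<Omega> u"
  shows "L2 lborel u" "L2 lborel (grad u)"
proof -
  obtain K where "compact K" "\<And>x. x \<notin> K \<Longrightarrow> u x = 0" "\<And>x. x \<notin> K \<Longrightarrow> grad u x = 0"
    using test_fun_support[OF assms] by metis
  with C1g_cont[OF test_fun_C1g[OF assms]] C1g_cont_grad[OF test_fun_C1g[OF assms]]
  show "L2 lborel u" "L2 lborel (grad u)" by (auto intro: L2_compact_support)
qed

lemma test_fun_mono: "test_fun \<Omega> u \<Longrightarrow> \<Omega> \<subseteq> \<Omega>' \<Longrightarrow> test_fun \<Omega>' u"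
  by (auto simp: test_fun_def)

text \<open>Removing the open set \<open>V\<close> from the compact support leaves a compact subset
  of \<open>U\<close>, so cutting to \<open>U\<close> creates no singularity.\<close>

lemma test_fun_restrict:
  assumes u: "test_fun (U \<union> V) u" and UV: "open U" "open V" "U \<inter> V = {}"
  obtains K where "compact K" "K \<subseteq> U" "\<And>x. x \<notin> K \<Longrightarrow> (if x \<in> U then u x else 0) = 0"
    "C1g (\<lambda>x. if x \<in> U then u x else 0) (\<lambda>x. if x \<in> U then grad u x else 0)"
proof -
  obtain K where K: "compact K" "K \<subseteq> U \<union> V" "\<And>x. x \<notin> K \<Longrightarrow> u x = 0"
    using test_fun_support[OF u] by metis
  have c: "compact (K - V)" by (rule compact_diff[OF K(1) UV(2)])
  have s: "K - V \<subseteq> U" using K(2) by auto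
  have z: "(if x \<in> U then u x else 0) = 0" if "x \<notin> K - V" for x
    using that K(3)[of x] UV(3) by auto
  have "C1g (\<lambda>x. if x \<in> U then u x else 0) (\<lambda>x. if x \<in> U then grad u x else 0)"
  proof (rule C1g_restrict[OF UV(1) open_Compl[OF compact_imp_closed[OF c]]])
    show "u x = 0" if "x \<in> U \<inter> - (K - V)" for x using that z[of x] by auto
    show "continuous_on U (grad u)"
      by (rule continuous_on_subset[OF C1g_cont_grad[OF test_fun_C1g[OF u]]]) simp
  qed (use s C1g_deriv[OF test_fun_C1g[OF u]] in auto)
  with c s z show ?thesis by (rule that)
qed

lemma integral_split_disjoint:
  fixes f :: "'a \<Rightarrow> 'b::euclidean_space"
  assumes f: "L2 M f" and m: "U \<inter> space M \<in> sets M" "V \<inter> space M \<in> sets M"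
    and d: "U \<inter> V = {}" "\<And>x. x \<notin> U \<union> V \<Longrightarrow> f x = 0"
  shows "sqint M f =
    sqint M (\<lambda>x. if x \<in> U then f x else 0) + sqint M (\<lambda>x. if x \<in> V then f x else 0)"
proof -
  have i: "integrable M (\<lambda>x. (norm (if x \<in> W then f x else 0))\<^sup>2)" if "W \<inter> space M \<in> sets M" for W
  proof -
    have "integrable M (\<lambda>x. indicator (W \<inter> space M) x *\<^sub>R (norm (f x))\<^sup>2)"
      by (rule integrable_mult_indicator[OF that L2_integrable[OF f]])
    then show ?thesis
      by (rule Bochner_Integration.integrable_cong[THEN iffD1, rotated 2]) (auto simp: indicator_def)
  qed
  have "(norm (f x))\<^sup>2 = (norm (if x \<in> U then f x else 0))\<^sup>2 + (norm (if x \<in> V then f x else 0))\<^sup>2" for x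
    using d by auto
  then show ?thesis
    using Bochner_Integration.integral_add[OF i[OF m(1)] i[OF m(2)]] by simp
qed

text \<open>The weight \<open>r\<close> is the eigenfunction of the larger ball, extended by zero.
  Its direction is the only one below \<open>\<mu>\<close>, so a single rank-one term restores the
  inequality.\<close>

lemma Omega_domain_gap:
  fixes e :: "'a::euclidean_space"
  assumes e: "e \<in> Basis"
  obtains \<kappa> \<mu> M and r :: "'a \<Rightarrow> real" and \<phi> where
    "0 < \<kappa>" "0 < \<mu>" "0 \<le> M" "L2 lborel r"
    "\<And>u. test_fun (Omega_domain e) u \<Longrightarrow> \<kappa> * (LBINT x. (u x)\<^sup>2) \<le> sqint lborel (grad u)"
    "\<And>u. test_fun (Omega_domain e) u \<Longrightarrow> \<mu> * (LBINT x. (u x)\<^sup>2)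
        \<le> sqint lborel (grad u) + M * (LBINT x. r x * u x)\<^sup>2"
    "test_fun (Omega_domain e) \<phi>"
    "sqint lborel (grad \<phi>) < \<mu> * (LBINT x. (\<phi> x)\<^sup>2)"
proof -
  obtain T where T: "0 < T" "bF DIM('a) T = 0" "\<And>t. 0 \<le> t \<Longrightarrow> t < T \<Longrightarrow> 0 < bF DIM('a) t"
    using bF_first_zero[OF DIM_ge_1] by metis
  let ?U = "ball e (1/2)" and ?V = "ball (- (1/2) *\<^sub>R e) (1/4)"
  \<comment> \<open>The same zero \<open>T\<close> serves both balls:
    \<open>T / \<rho>\<^sup>2\<close> is \<open>4 * T\<close> for radius 1/2 and
    \<open>16 * T\<close> for radius 1/4.\<close>
  interpret b1: bessel_ball e "1/2" "4 * T"
    by unfold_locales (use T in \<open>auto simp: power2_eq_square\<close>)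
  interpret b2: bessel_ball "- (1/2) *\<^sub>R e" "1/4" "16 * T"
    by unfold_locales (use T in \<open>auto simp: power2_eq_square\<close>)
  have disj: "?U \<inter> ?V = {}"
  proof -
    have "dist e (- (1/2) *\<^sub>R e) = norm ((3/2) *\<^sub>R e)"
      unfolding dist_norm by (rule arg_cong[where f=norm]) (use scaleR_left_distrib[of 1 "1/2" e] in simp)
    then have "dist e (- (1/2) *\<^sub>R e) = 3/2" using e by simp
    then have "\<not> (dist e z < 1/2 \<and> dist (- (1/2) *\<^sub>R e) z < 1/4)" for z
      using dist_triangle2[of e "- (1/2) *\<^sub>R e" z] by linarith
    then show ?thesis unfolding disjoint_iff mem_ball by blast
  qed
  \<comment> \<open>The first entry comes from \<open>ball_gap\<close> on the larger ball, divided
    by \<open>C\<close>, and holds up to the rank-one term; the second is the plain eigenvalue bound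
    on the smaller ball. Both exceed \<open>4 * T\<close>.\<close>
  define \<mu> where "\<mu> = min (4 * T + 2 * b1.A / b1.C) (16 * T)"
  have \<mu>: "4 * T < \<mu>" using T b1.A_pos b1.C_pos by (simp add: \<mu>_def)
  have main: "4 * T * (LBINT x. (u x)\<^sup>2) \<le> sqint lborel (grad u) \<and>
      \<mu> * (LBINT x. (u x)\<^sup>2) \<le> sqint lborel (grad u) + (2 / b1.C) * (LBINT x. b1.w x * u x)\<^sup>2"
    if u: "test_fun (Omega_domain e) u" for u
  proof -
    have u': "test_fun (?U \<union> ?V) u" "test_fun (?V \<union> ?U) u"
      using u by (auto simp: Omega_domain_def Un_commute)
    let ?r = "\<lambda>W x. if x \<in> W then u x else 0" and ?g = "\<lambda>W x. if x \<in> W then grad u x else 0"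
    obtain K where K: "compact K" "K \<subseteq> ?U" "\<And>x. x \<notin> K \<Longrightarrow> ?r ?U x = 0" "C1g (?r ?U) (?g ?U)"
      by (rule test_fun_restrict[OF u'(1) _ _ disj]) auto
    obtain L where L: "compact L" "L \<subseteq> ?V" "\<And>x. x \<notin> L \<Longrightarrow> ?r ?V x = 0" "C1g (?r ?V) (?g ?V)"
      by (rule test_fun_restrict[OF u'(2)]) (use disj in auto)
    obtain Z where Z: "Z \<subseteq> ?U \<union> ?V" "\<And>x. x \<notin> Z \<Longrightarrow> u x = 0" "\<And>x. x \<notin> Z \<Longrightarrow> grad u x = 0"
      using test_fun_support[OF u'(1)] by metis
    have z: "u x = 0" "grad u x = 0" if "x \<notin> ?U \<union> ?V" for x
      using Z(2,3)[of x] Z(1) that by blast+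
    have m: "?U \<inter> space lborel \<in> sets lborel" "?V \<inter> space lborel \<in> sets lborel" by auto
    define x1 where "x1 = (LBINT x. (?r ?U x)\<^sup>2)"
    define x2 where "x2 = (LBINT x. (?r ?V x)\<^sup>2)"
    define y1 where "y1 = sqint lborel (?g ?U)"
    define y2 where "y2 = sqint lborel (?g ?V)"
    define l where "l = (LBINT x. b1.w x * u x)"
    have X: "(LBINT x. (u x)\<^sup>2) = x1 + x2"
      using integral_split_disjoint[OF test_fun_L2(1)[OF u] m disj z(1)] by (simp add: x1_def x2_def)
    have Y: "sqint lborel (grad u) = y1 + y2"
      using integral_split_disjoint[OF test_fun_L2(2)[OF u] m disj z(2)] by (simp add: y1_def y2_def)
    \<comment> \<open>\<open>b1.w\<close> vanishes off the larger ball, so the functional does not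
      see the other piece of \<open>u\<close>.\<close>
    have l: "(LBINT x. b1.w x * ?r ?U x) = l"
      unfolding l_def by (intro Bochner_Integration.integral_cong) (auto simp: b1.w_def)
    have "2 * b1.A * x1 - 2 * l\<^sup>2 \<le> b1.C * (y1 - 4 * T * x1)"
      using b1.ball_gap(1)[OF K(4,1-3)] unfolding l x1_def y1_def .
    then have "(2 * b1.A * x1 - 2 * l\<^sup>2) / b1.C \<le> y1 - 4 * T * x1"
      using b1.C_pos by (subst pos_divide_le_eq) (auto simp: mult.commute)
    then have g1: "(4 * T + 2 * b1.A / b1.C) * x1 \<le> y1 + (2 / b1.C) * l\<^sup>2"
      by (simp add: diff_divide_distrib algebra_simps)
    have p1: "4 * T * x1 \<le> y1" using b1.ball_gap(2)[OF K(4,1-3)] unfolding x1_def y1_def .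
    have p2: "16 * T * x2 \<le> y2" using b2.ball_gap(2)[OF L(4,1-3)] unfolding x2_def y2_def .
    have nn: "0 \<le> x1" "0 \<le> x2" by (auto simp: x1_def x2_def)
    have "\<mu> * x1 \<le> (4 * T + 2 * b1.A / b1.C) * x1" "\<mu> * x2 \<le> 16 * T * x2" "4 * T * x2 \<le> 16 * T * x2"
      using nn T by (auto simp: \<mu>_def intro!: mult_right_mono)
    then show ?thesis
      unfolding X Y l_def[symmetric] using g1 p1 p2 by (simp add: distrib_left)
  qed
  obtain \<phi> where \<phi>: "test_fun ?U \<phi>" "sqint lborel (grad \<phi>) < \<mu> * (LBINT x. (\<phi> x)\<^sup>2)"
    using b1.test_fun_near_eigenvalue[OF \<mu>] by blast
  show ?thesis
  proof (rule that[of "4 * T" \<mu> "2 / b1.C" b1.w \<phi>])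
    show "test_fun (Omega_domain e) \<phi>" by (rule test_fun_mono[OF \<phi>(1)]) (auto simp: Omega_domain_def)
  qed (use T \<mu> b1.C_pos b1.w_square_integrable main \<phi> in auto)
qed

section \<open>The fractional seminorm\<close>

definition annulus :: "real \<Rightarrow> 'a::euclidean_space set" where
  "annulus r = {h. r \<le> norm h \<and> norm h < 2 * r}"

text \<open>The kernel is treated as a measure, so that countable additivity over dyadic annuli
  replaces manipulations of integrals.\<close>

definition riesz :: "real \<Rightarrow> 'a::euclidean_space measure" where
  "riesz q = density lborel (\<lambda>h. ennreal (norm h powr q))"

lemma annulus_measurable [measurable]: "annulus r \<in> sets borel"
  unfolding annulus_def by measurable

lemma riesz_sets [measurable_cong, simp]: "sets (riesz q) = sets borel"
  by (simp add: riesz_def)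

lemma riesz_emeasure:
  "A \<in> sets borel \<Longrightarrow> emeasure (riesz q) A = (\<integral>\<^sup>+h. ennreal (norm h powr q) * indicator A h \<partial>lborel)"
  unfolding riesz_def by (rule emeasure_density) auto

lemma riesz_annulus_scale:
  fixes q :: real
  assumes a: "0 < a"
  shows "emeasure (riesz q) (annulus (a * r) :: 'a::euclidean_space set)
    = ennreal (a powr (real DIM('a) + q)) * emeasure (riesz q) (annulus r :: 'a set)"
proof -
  let ?f = "\<lambda>h::'a. ennreal (norm h powr q) * indicator (annulus (a * r)) h"
  have "emeasure (riesz q) (annulus (a * r) :: 'a set) = (\<integral>\<^sup>+h. ?f h \<partial>lborel)"
    by (simp add: riesz_emeasure)
  also have "\<dots> = ennreal (\<bar>a\<bar>^DIM('a)) * (\<integral>\<^sup>+h. ?f (0 + a *\<^sub>R h) \<partial>lborel)"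
    by (rule nn_integral_lborel_scale[symmetric]) (use a in auto)
  also have "(\<lambda>h. ?f (0 + a *\<^sub>R h)) = (\<lambda>h. ennreal (a powr q) * (ennreal (norm h powr q) * indicator (annulus r) h))"
    using a by (auto simp: fun_eq_iff annulus_def indicator_def powr_mult ennreal_mult')
  also have "(\<integral>\<^sup>+h. ennreal (a powr q) * (ennreal (norm h powr q) * indicator (annulus r) h) \<partial>(lborel::'a measure))
    = ennreal (a powr q) * emeasure (riesz q) (annulus r :: 'a set)"
    by (simp add: nn_integral_cmult riesz_emeasure)
  also have "ennreal (\<bar>a\<bar>^DIM('a)) * (ennreal (a powr q) * emeasure (riesz q) (annulus r :: 'a set))
    = ennreal (a powr (real DIM('a) + q)) * emeasure (riesz q) (annulus r :: 'a set)"
    using a by (simp add: powr_add powr_realpow ennreal_mult' mult.assoc)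
  finally show ?thesis .
qed

lemma riesz_annulus_finite:
  assumes "0 < r"
  shows "emeasure (riesz q) (annulus r :: 'a::euclidean_space set) < \<infinity>"
proof -
  define m where "m = max (r powr q) ((2 * r) powr q)"
  have "emeasure (riesz q) (annulus r :: 'a set) \<le> (\<integral>\<^sup>+h. ennreal m * indicator (ball 0 (2 * r)) h \<partial>(lborel::'a measure))"
    unfolding riesz_emeasure[OF annulus_measurable]
  proof (rule nn_integral_mono)
    fix h :: 'a
    have "norm h powr q \<le> m" if "r \<le> norm h" "norm h < 2 * r"
      using that assms powr_mono2[of q "norm h" "2 * r"] powr_mono2'[of "q" r "norm h"]
      by (cases "q \<ge> 0") (auto simp: m_def le_max_iff_disj)
    then show "ennreal (norm h powr q) * indicator (annulus r) h \<le> ennreal m * indicator (ball 0 (2 * r)) h"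
      by (auto simp: annulus_def indicator_def intro: ennreal_leI)
  qed
  also have "\<dots> = ennreal m * emeasure lborel (ball (0::'a) (2 * r))"
    by (simp add: nn_integral_cmult_indicator)
  also have "\<dots> < \<infinity>"
    using emeasure_bounded_finite[OF bounded_ball[of "0::'a" "2 * r"]] by (simp add: ennreal_mult_less_top)
  finally show ?thesis .
qed

lemma riesz_annulus_pos:
  assumes "0 < r"
  shows "0 < emeasure (riesz q) (annulus r :: 'a::euclidean_space set)"
proof (rule ccontr)
  assume "\<not> ?thesis"
  then have "(\<integral>\<^sup>+h. ennreal (norm h powr q) * indicator (annulus r) h \<partial>(lborel::'a measure)) = 0"
    by (simp add: riesz_emeasure)
  then have "AE h in lborel. ennreal (norm (h::'a) powr q) * indicator (annulus r) h = 0"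
    by (subst (asm) nn_integral_0_iff_AE) auto
  then have ae: "AE h in lborel. (h::'a) \<notin> annulus r"
    by eventually_elim (use assms in \<open>auto simp: annulus_def indicator_def split: if_splits\<close>)
  obtain b :: 'a where b: "b \<in> Basis" using nonempty_Basis by blast
  \<comment> \<open>A point midway between the two radii; the ball of radius \<open>r / 2\<close>
    about it fits into the annulus.\<close>
  define c where "c = (3/2 * r) *\<^sub>R b"
  have "norm c = 3/2 * r" using b assms by (simp add: c_def)
  then have sub: "ball c (r/2) \<subseteq> annulus r"
  proof (intro subsetI)
    fix x assume nc: "norm c = 3/2 * r" and "x \<in> ball c (r/2)"
    then have "norm (x - c) < r/2" by (simp add: dist_norm norm_minus_commute)
    then show "x \<in> annulus r"
      using nc norm_triangle_ineq2[of c "c - x"] norm_triangle_ineq[of "x - c" c]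
      by (simp add: annulus_def norm_minus_commute)
  qed
  have "AE h in lborel. h \<notin> ball c (r/2)" using ae by eventually_elim (use sub in blast)
  then have "emeasure lborel (ball c (r/2)) = 0"
    by (subst (asm) AE_iff_measurable[of "ball c (r/2)"]) auto
  then show False using assms unit_ball_vol_pos[of "real DIM('a)"] by (auto simp: emeasure_ball)
qed

lemma annuli_disjoint: "disjoint_family (\<lambda>k. annulus (2^k * r) :: 'a::euclidean_space set)" if "0 < r"
proof -
  have *: "annulus (2^k * r) \<inter> annulus (2^l * r) = ({} :: 'a set)" if "k < l" for k l
  proof -
    have "(2::real)^(Suc k) \<le> 2^l" using that by (intro power_increasing) auto
    then have "2 * (2^k * r) \<le> 2^l * r" using \<open>0 < r\<close> by simp
    then show ?thesis by (force simp: annulus_def)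
  qed
  show ?thesis unfolding disjoint_family_on_def using * by (metis Int_commute linorder_neqE_nat)
qed

lemma exterior_eq_annuli:
  assumes "0 < r"
  shows "{h::'a::euclidean_space. r \<le> norm h} = (\<Union>k. annulus (2^k * r))"
proof safe
  fix h :: 'a assume h: "r \<le> norm h"
  have "\<exists>k. norm h / r < 2^k" by (rule real_arch_pow) simp
  then have ex: "\<exists>k. norm h < 2^k * r" using assms by (simp add: field_simps)
  define k where "k = (LEAST k. norm h < 2^k * r)"
  have k: "norm h < 2^k * r" unfolding k_def using ex by (rule LeastI_ex)
  then obtain l where l: "k = Suc l" using h by (cases k) auto
  have "\<not> norm h < 2^l * r" using l not_less_Least[of l "\<lambda>k. norm h < 2^k * r"] by (simp add: k_def)
  then show "h \<in> (\<Union>k. annulus (2^k * r))" using k l by (auto simp: annulus_def intro!: exI[of _ l])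
next
  fix h :: 'a and k assume "h \<in> annulus (2^k * r)"
  then have "2^k * r \<le> norm h" by (simp add: annulus_def)
  moreover have "1 * r \<le> 2^k * r" using assms by (intro mult_right_mono) auto
  ultimately show "r \<le> norm h" by simp
qed

lemma punctured_ball_subset_annuli:
  assumes "0 < r"
  shows "{h::'a::euclidean_space. h \<noteq> 0 \<and> norm h < r} \<subseteq> (\<Union>k. annulus ((1/2)^(Suc k) * r))"
proof safe
  fix h :: 'a assume h: "h \<noteq> 0" "norm h < r"
  have "\<exists>k. (1/2)^k < norm h / r" by (rule real_arch_pow_inv) (use h assms in auto)
  then have ex: "\<exists>k. (1/2)^k * r \<le> norm h" using assms by (auto simp: field_simps intro: less_imp_le)
  define k where "k = (LEAST k. (1/2)^k * r \<le> norm h)"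
  have k: "(1/2)^k * r \<le> norm h" unfolding k_def using ex by (rule LeastI_ex)
  then obtain l where l: "k = Suc l" using h by (cases k) auto
  have "\<not> (1/2)^l * r \<le> norm h" using l not_less_Least[of l "\<lambda>k. (1/2)^k * r \<le> norm h"] by (simp add: k_def)
  then show "h \<in> (\<Union>k. annulus ((1/2)^(Suc k) * r))" using k l by (auto simp: annulus_def intro!: exI[of _ l])
qed

text \<open>Near the origin the kernel, weighted by \<open>|h|\<^sup>2\<close>, has bounded mass, while its mass away from the
  origin blows up like \<open>1 / s\<close>; both are computed from one dyadic annulus by scaling.\<close>
lemma kernel_bounds:
  fixes s r :: real
  assumes s: "0 < s" "s \<le> 1/2" and r: "0 < r"
  defines "p \<equiv> real DIM('a::euclidean_space) + 2 * s"
  obtains k1 k2 where "0 \<le> k1" "0 < k2" "k1 \<le> 4 * r\<^sup>2 * (1 - 2 powr (- 2 * s)) * k2"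
    "(\<integral>\<^sup>+h. ennreal ((norm h)\<^sup>2 / norm h powr p) * indicator {h. norm h < r} h \<partial>(lborel::'a measure)) \<le> ennreal k1"
    "(\<integral>\<^sup>+h. ennreal (1 / norm h powr p) * indicator {h. r \<le> norm h} h \<partial>(lborel::'a measure)) = ennreal k2"
proof -
  define I where "I = measure (riesz (- p)) (annulus r :: 'a set)"
  have I: "emeasure (riesz (- p)) (annulus r :: 'a set) = ennreal I"
    unfolding I_def using riesz_annulus_finite[OF r, of "- p", where 'a='a]
    by (intro emeasure_eq_ennreal_measure) auto
  have I0: "0 < I" using riesz_annulus_pos[OF r, of "- p", where 'a='a] unfolding I by simp
  \<comment> \<open>\<open>x\<close> is the factor by which the kernel mass changes from one annulus
    to the next outwards, and \<open>y\<close> the factor inwards after weighting with the squared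
    norm; \<open>s \<le> 1/2\<close> gives \<open>y \<le> 1/2\<close>, uniformly in
    \<open>s\<close>.\<close>
  define x where "x = (2::real) powr (- 2 * s)"
  define y where "y = (1/2::real) powr (2 - 2 * s)"
  have x: "0 < x" "x < 1" unfolding x_def using s by (auto intro: powr_less_one)
  have "y \<le> (1/2) powr 1" unfolding y_def using s by (intro powr_mono') auto
  then have y: "0 < y" "y \<le> 1/2" by (auto simp: y_def)
  have K2: "(\<integral>\<^sup>+h. ennreal (1 / norm h powr p) * indicator {h. r \<le> norm h} h \<partial>(lborel::'a measure)) = ennreal (I / (1 - x))"
  proof -
    have "(\<integral>\<^sup>+h. ennreal (1 / norm h powr p) * indicator {h. r \<le> norm h} h \<partial>(lborel::'a measure))
       = emeasure (riesz (- p)) {h::'a. r \<le> norm h}"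
      by (subst riesz_emeasure) (auto simp: powr_minus_divide)
    also have "\<dots> = (\<Sum>k. emeasure (riesz (- p)) (annulus (2^k * r) :: 'a set))"
      unfolding exterior_eq_annuli[OF r] by (rule suminf_emeasure[symmetric]) (auto simp: annuli_disjoint[OF r])
    also have "\<dots> = (\<Sum>k. ennreal (x^k * I))"
    proof (rule suminf_cong)
      fix k
      have "(2^k) powr (real DIM('a) + - p) = x^k"
        unfolding x_def p_def by (simp add: powr_realpow[symmetric] powr_powr powr_power mult.commute)
      then show "emeasure (riesz (- p)) (annulus (2^k * r) :: 'a set) = ennreal (x^k * I)"
        using riesz_annulus_scale[of "2^k" "- p" r, where 'a='a] x by (simp add: I ennreal_mult')
    qed
    also have "\<dots> = ennreal (\<Sum>k. x^k * I)"
      using x I0 by (intro suminf_ennreal2) (auto intro!: summable_mult2 summable_geometric)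
    also have "(\<Sum>k. x^k * I) = I / (1 - x)"
      using x suminf_mult2[OF summable_geometric[of x], of I] by (simp add: suminf_geometric)
    finally show ?thesis .
  qed
  have K1: "(\<integral>\<^sup>+h. ennreal ((norm h)\<^sup>2 / norm h powr p) * indicator {h. norm h < r} h \<partial>(lborel::'a measure)) \<le> ennreal (4 * r\<^sup>2 * I)"
  proof -
    have J: "emeasure (riesz (2 - p)) (annulus r :: 'a set) \<le> ennreal (4 * r\<^sup>2 * I)"
    proof -
      have "emeasure (riesz (2 - p)) (annulus r :: 'a set)
         \<le> (\<integral>\<^sup>+h. ennreal (4 * r\<^sup>2) * (ennreal (norm h powr (- p)) * indicator (annulus r) h) \<partial>(lborel::'a measure))"
        unfolding riesz_emeasure[OF annulus_measurable]
      proof (rule nn_integral_mono)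
        fix h :: 'a
        have "norm h powr (2 - p) \<le> 4 * r\<^sup>2 * norm h powr (- p)" if "r \<le> norm h" "norm h < 2 * r"
        proof -
          have "norm h powr (2 - p) = (norm h)\<^sup>2 * norm h powr (- p)"
            using that r by (simp add: powr_diff powr_minus_divide)
          moreover have "(norm h)\<^sup>2 \<le> (2 * r)\<^sup>2" using that by (intro power_mono) auto
          ultimately show ?thesis by (auto simp: power_mult_distrib intro: mult_right_mono)
        qed
        then show "ennreal (norm h powr (2 - p)) * indicator (annulus r) h
           \<le> ennreal (4 * r\<^sup>2) * (ennreal (norm h powr (- p)) * indicator (annulus r) h)"
          by (auto simp: annulus_def indicator_def ennreal_mult'[symmetric] intro: ennreal_leI)
      qed
      also have "\<dots> = ennreal (4 * r\<^sup>2 * I)"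
        using I by (simp add: nn_integral_cmult riesz_emeasure ennreal_mult')
      finally show ?thesis .
    qed
    have "(\<integral>\<^sup>+h. ennreal ((norm h)\<^sup>2 / norm h powr p) * indicator {h. norm h < r} h \<partial>(lborel::'a measure))
       \<le> emeasure (riesz (2 - p)) {h::'a. h \<noteq> 0 \<and> norm h < r}"
    proof (subst riesz_emeasure)
      show "{h::'a. h \<noteq> 0 \<and> norm h < r} \<in> sets borel" by measurable
      show "(\<integral>\<^sup>+h. ennreal ((norm h)\<^sup>2 / norm h powr p) * indicator {h. norm h < r} h \<partial>(lborel::'a measure))
        \<le> (\<integral>\<^sup>+h. ennreal (norm h powr (2 - p)) * indicator {h::'a. h \<noteq> 0 \<and> norm h < r} h \<partial>lborel)"
      proof (rule nn_integral_mono)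
        fix h :: 'a
        have "(norm h)\<^sup>2 / norm h powr p = norm h powr (2 - p)" if "h \<noteq> 0"
          using that by (simp add: powr_diff)
        then show "ennreal ((norm h)\<^sup>2 / norm h powr p) * indicator {h. norm h < r} h
           \<le> ennreal (norm h powr (2 - p)) * indicator {h. h \<noteq> 0 \<and> norm h < r} h"
          by (cases "h = 0") (auto simp: indicator_def)
      qed
    qed
    also have "\<dots> \<le> emeasure (riesz (2 - p)) (\<Union>k. annulus ((1/2)^(Suc k) * r) :: 'a set)"
      by (intro emeasure_mono punctured_ball_subset_annuli[OF r]) auto
    also have "\<dots> \<le> (\<Sum>k. emeasure (riesz (2 - p)) (annulus ((1/2)^(Suc k) * r) :: 'a set))"
      by (rule emeasure_subadditive_countably) auto
    also have "\<dots> \<le> (\<Sum>k. ennreal (y^(Suc k) * (4 * r\<^sup>2 * I)))"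
    proof (rule suminf_le)
      fix k
      have "((1/2)^(Suc k)) powr (real DIM('a) + (2 - p)) = y^(Suc k)"
        unfolding y_def p_def by (simp add: powr_realpow[symmetric] powr_powr powr_power mult.commute del: power_Suc)
      then have "emeasure (riesz (2 - p)) (annulus ((1/2)^(Suc k) * r) :: 'a set)
         = ennreal (y^(Suc k)) * emeasure (riesz (2 - p)) (annulus r :: 'a set)"
        using riesz_annulus_scale[of "(1/2)^(Suc k)" "2 - p" r, where 'a='a] by simp
      also have "\<dots> \<le> ennreal (y^(Suc k)) * ennreal (4 * r\<^sup>2 * I)" by (intro mult_left_mono J) auto
      also have "\<dots> = ennreal (y^(Suc k) * (4 * r\<^sup>2 * I))"
        using y I0 by (intro ennreal_mult[symmetric]) auto
      finally show "emeasure (riesz (2 - p)) (annulus ((1/2)^(Suc k) * r) :: 'a set) \<le> ennreal (y^(Suc k) * (4 * r\<^sup>2 * I))" .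
    qed auto
    \<comment> \<open>Starting from index 1, the powers of 1/2 sum to 1, so the whole inner part
      costs no more than the bound for one annulus.\<close>
    also have "\<dots> \<le> (\<Sum>k. ennreal ((1/2)^(Suc k) * (4 * r\<^sup>2 * I)))"
      using y I0 by (intro suminf_le ennreal_leI mult_right_mono power_mono) auto
    also have "\<dots> = ennreal (\<Sum>k. (1/2)^(Suc k) * (4 * r\<^sup>2 * I))"
      using I0 by (intro suminf_ennreal2) (auto intro!: summable_mult2 summable_mult summable_geometric)
    also have "(\<Sum>k. (1/2)^(Suc k) * (4 * r\<^sup>2 * I)) = 4 * r\<^sup>2 * I"
      using power_half_series by (intro sums_unique[symmetric]) (use sums_mult2[OF power_half_series, of "4 * r\<^sup>2 * I"] in simp)
    finally show ?thesis .
  qed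
  show ?thesis
  \<comment> \<open>Both constants are multiples of the same \<open>I\<close>, whose size cancels in
    the comparison.\<close>
  proof (rule that[OF _ _ _ K1 K2])
    show "4 * r\<^sup>2 * I \<le> 4 * r\<^sup>2 * (1 - 2 powr (- 2 * s)) * (I / (1 - x))"
      unfolding x_def[symmetric] using x by simp
  qed (use x I0 in auto)
qed

text \<open>A square root of the kernel goes with each difference, so that the seminorm and its
  bilinear form become a norm and an inner product of L2 over pairs, up to the factor
  \<open>cNs\<close>.\<close>

definition fracq :: "real \<Rightarrow> ('a::euclidean_space \<Rightarrow> real) \<Rightarrow> 'a \<times> 'a \<Rightarrow> real" where
  "fracq s u z = (u (fst z) - u (snd z)) / norm (fst z - snd z) powr ((real DIM('a) + 2 * s) / 2)"

abbreviation "lborel2 \<equiv> (lborel \<Otimes>\<^sub>M lborel)"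

lemma fracq_mult:
  fixes u v :: "'a::euclidean_space \<Rightarrow> real"
  shows "fracq s u z * fracq s v z = (u (fst z) - u (snd z)) * (v (fst z) - v (snd z)) /
            norm (fst z - snd z) powr (real DIM('a) + 2 * s)"
proof -
  have "norm (fst z - snd z) powr ((real DIM('a) + 2 * s) / 2) * norm (fst z - snd z) powr ((real DIM('a) + 2 * s) / 2)
    = norm (fst z - snd z) powr (real DIM('a) + 2 * s)"
    unfolding powr_add[symmetric] by (rule arg_cong2[where f="(powr)"]) (auto simp: field_simps)
  then show ?thesis by (simp add: fracq_def)
qed

lemma frac_form_eq:
  fixes u v :: "'a::euclidean_space \<Rightarrow> real"
  shows "frac_form s u v = cNs DIM('a) s * (\<integral>z. fracq s u z \<bullet> fracq s v z \<partial>lborel2)"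
  by (simp add: frac_form_def fracq_mult)

lemma frac_seminorm_sq_eq:
  "frac_seminorm_sq s u = frac_form s u u"
  by (simp add: frac_form_def frac_seminorm_sq_def power2_eq_square)

lemma fracq_measurable [measurable]:
  assumes [measurable]: "u \<in> borel_measurable borel"
  shows "fracq s u \<in> borel_measurable lborel2"
  unfolding fracq_def[abs_def] by measurable

lemma fracq_lin: "fracq s (\<lambda>x. a * u x + b * v x) z = a * fracq s u z + b * fracq s v z"
  by (simp add: fracq_def diff_divide_distrib add_divide_distrib algebra_simps)

text \<open>Substitute \<open>y = x + h\<close> and exchange the integrals: what remains is an
  integral over \<open>h\<close> of squared L2 distances between \<open>u\<close> and its
  translates, so short and long \<open>h\<close> can be treated separately.\<close>

lemma fracq_nn_integral_eq:
  fixes u :: "'a::euclidean_space \<Rightarrow> real"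
  assumes [measurable]: "u \<in> borel_measurable borel"
  shows "nnsqint lborel2 (fracq s u)
    = (\<integral>\<^sup>+h. ennreal (1 / norm h powr (real DIM('a) + 2 * s)) * (\<integral>\<^sup>+x. ennreal ((u (x + h) - u x)\<^sup>2) \<partial>lborel) \<partial>lborel)"
proof -
  let ?p = "real DIM('a) + 2 * s"
  let ?f = "\<lambda>x y. ennreal ((norm (fracq s u (x, y)))\<^sup>2)"
  have [measurable]: "(\<lambda>z. ennreal ((norm (fracq s u z))\<^sup>2)) \<in> borel_measurable lborel2" by measurable
  have e: "?f x (h + x) = ennreal (1 / norm h powr ?p) * ennreal ((u (x + h) - u x)\<^sup>2)" for x h
  proof -
    have "(norm (fracq s u (x, h + x)))\<^sup>2 = (1 / norm h powr ?p) * (u (x + h) - u x)\<^sup>2"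
      using fracq_mult[of s u "(x, h + x)" u]
      by (simp add: power2_eq_square add.commute[of h x] norm_minus_commute) (simp add: algebra_simps)
    then show ?thesis by (simp add: ennreal_mult'[symmetric])
  qed
  have "nnsqint lborel2 (fracq s u) = (\<integral>\<^sup>+x. \<integral>\<^sup>+y. ?f x y \<partial>lborel \<partial>lborel)"
    by (rule lborel.nn_integral_fst[symmetric]) measurable
  also have "\<dots> = (\<integral>\<^sup>+x. \<integral>\<^sup>+h. ?f x (h + x) \<partial>lborel \<partial>lborel)"
    by (intro nn_integral_cong nn_integral_lborel_translate[symmetric]) measurable
  also have "\<dots> = (\<integral>\<^sup>+h. \<integral>\<^sup>+x. ?f x (h + x) \<partial>lborel \<partial>lborel)"
    unfolding e by (intro lborel_pair.Fubini') measurable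
  also have "\<dots> = (\<integral>\<^sup>+h. ennreal (1 / norm h powr ?p) * (\<integral>\<^sup>+x. ennreal ((u (x + h) - u x)\<^sup>2) \<partial>lborel) \<partial>lborel)"
    unfolding e by (intro nn_integral_cong nn_integral_cmult) measurable
  finally show ?thesis .
qed

text \<open>Each difference is bounded by an average of the gradient over a segment; after
  exchanging the integrals, translation invariance makes the inner one the same for every
  \<open>t\<close>.\<close>

lemma translation_difference_le:
  fixes u :: "'a::euclidean_space \<Rightarrow> real"
  assumes u: "C1g u g"
  shows "(\<integral>\<^sup>+x. ennreal ((u (x + h) - u x)\<^sup>2) \<partial>lborel) \<le> ennreal ((norm h)\<^sup>2) * nnsqint lborel g"
proof -
  have [measurable]: "u \<in> borel_measurable borel" "g \<in> borel_measurable borel" using C1g_measurable[OF u] by auto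
  let ?G = "\<integral>\<^sup>+x. ennreal ((norm (g x))\<^sup>2) \<partial>lborel"
  have "(\<integral>\<^sup>+x. ennreal ((u (x + h) - u x)\<^sup>2) \<partial>lborel) \<le> (\<integral>\<^sup>+x. ennreal ((norm h)\<^sup>2) *
     (\<integral>\<^sup>+t. ennreal ((norm (g (x + t *\<^sub>R h)))\<^sup>2) * indicator {0..1::real} t \<partial>lborel) \<partial>lborel)"
  proof (rule nn_integral_mono)
    fix x
    show "ennreal ((u (x + h) - u x)\<^sup>2) \<le> ennreal ((norm h)\<^sup>2) *
       (\<integral>\<^sup>+t. ennreal ((norm (g (x + t *\<^sub>R h)))\<^sup>2) * indicator {0..1::real} t \<partial>lborel)"
      using C1g_segment_bound[OF u, of "x + h" x] by simp
  qed
  also have "\<dots> = ennreal ((norm h)\<^sup>2) * (\<integral>\<^sup>+x. \<integral>\<^sup>+t. ennreal ((norm (g (x + t *\<^sub>R h)))\<^sup>2) * indicator {0..1::real} t \<partial>lborel \<partial>lborel)"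
    by (rule nn_integral_cmult) measurable
  also have "(\<integral>\<^sup>+x. \<integral>\<^sup>+t. ennreal ((norm (g (x + t *\<^sub>R h)))\<^sup>2) * indicator {0..1::real} t \<partial>lborel \<partial>lborel)
     = (\<integral>\<^sup>+t. \<integral>\<^sup>+x. ennreal ((norm (g (x + t *\<^sub>R h)))\<^sup>2) * indicator {0..1::real} t \<partial>lborel \<partial>lborel)"
    by (intro lborel_pair.Fubini') measurable
  also have "\<dots> = (\<integral>\<^sup>+t. ?G * indicator {0..1::real} t \<partial>lborel)"
  proof (rule nn_integral_cong)
    fix t :: real
    have "(\<integral>\<^sup>+x. ennreal ((norm (g (x + t *\<^sub>R h)))\<^sup>2) * indicator {0..1::real} t \<partial>lborel)
      = nnsqint lborel (\<lambda>x. g (x + t *\<^sub>R h)) * indicator {0..1::real} t"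
      by (rule nn_integral_multc) measurable
    then show "(\<integral>\<^sup>+x. ennreal ((norm (g (x + t *\<^sub>R h)))\<^sup>2) * indicator {0..1::real} t \<partial>lborel) = ?G * indicator {0..1::real} t"
      using nn_integral_lborel_translate[of "\<lambda>x. ennreal ((norm (g x))\<^sup>2)" "t *\<^sub>R h"] by simp
  qed
  also have "\<dots> = ?G" by (simp add: nn_integral_cmult_indicator)
  finally show ?thesis .
qed

lemma translation_difference_eq:
  fixes u :: "'a::euclidean_space \<Rightarrow> real"
  assumes [measurable]: "u \<in> borel_measurable borel" and d: "\<And>x. u x * u (x + h) = 0"
  shows "(\<integral>\<^sup>+x. ennreal ((u (x + h) - u x)\<^sup>2) \<partial>lborel) = 2 * (\<integral>\<^sup>+x. ennreal ((u x)\<^sup>2) \<partial>lborel)"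
proof -
  have "(u (x + h) - u x)\<^sup>2 = (u (x + h))\<^sup>2 + (u x)\<^sup>2" for x
    using d[of x] by (auto simp: power2_eq_square)
  then have "(\<integral>\<^sup>+x. ennreal ((u (x + h) - u x)\<^sup>2) \<partial>lborel) = (\<integral>\<^sup>+x. ennreal ((u (x + h))\<^sup>2) + ennreal ((u x)\<^sup>2) \<partial>lborel)"
    by simp
  also have "\<dots> = (\<integral>\<^sup>+x. ennreal ((u (x + h))\<^sup>2) \<partial>lborel) + (\<integral>\<^sup>+x. ennreal ((u x)\<^sup>2) \<partial>lborel)"
    by (rule nn_integral_add) measurable
  also have "(\<integral>\<^sup>+x. ennreal ((u (x + h))\<^sup>2) \<partial>lborel) = (\<integral>\<^sup>+x. ennreal ((u x)\<^sup>2) \<partial>lborel)"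
    by (rule nn_integral_lborel_translate) measurable
  finally show ?thesis by (simp add: mult_2)
qed

text \<open>For \<open>norm h \<ge> r\<close> the supports of \<open>u\<close> and its translate are
  disjoint, so the squared distance is exactly twice the squared norm. This far part therefore
  appears with the same coefficient in the upper and the lower bound; only the near part costs a
  gradient term.\<close>

lemma frac_test_fun_bounds:
  fixes r s :: real and \<Omega> :: "'a::euclidean_space set"
  assumes s: "0 < s" "s \<le> 1/2" and r: "0 < r"
    and diam: "\<And>x y. x \<in> \<Omega> \<Longrightarrow> y \<in> \<Omega> \<Longrightarrow> norm (x - y) < r"
  obtains k1 k2 where "0 \<le> k1" "0 < k2" "k1 \<le> 4 * r\<^sup>2 * (1 - 2 powr (- 2 * s)) * k2"
    "\<And>u. test_fun \<Omega> u \<Longrightarrow> L2 lborel2 (fracq s u) \<and>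
      (sqint lborel2 (fracq s u)) \<le> k1 * sqint lborel (grad u) + 2 * k2 * (LBINT x. (u x)\<^sup>2) \<and>
      2 * k2 * (LBINT x. (u x)\<^sup>2) \<le> sqint lborel2 (fracq s u)"
proof -
  let ?p = "real DIM('a) + 2 * s"
  obtain k1 k2 where k: "0 \<le> k1" "0 < k2" "k1 \<le> 4 * r\<^sup>2 * (1 - 2 powr (- 2 * s)) * k2"
    and K1: "(\<integral>\<^sup>+h. ennreal ((norm h)\<^sup>2 / norm h powr ?p) * indicator {h. norm h < r} h \<partial>(lborel::'a measure)) \<le> ennreal k1"
    and K2: "(\<integral>\<^sup>+h. ennreal (1 / norm h powr ?p) * indicator {h. r \<le> norm h} h \<partial>(lborel::'a measure)) = ennreal k2"
    by (rule kernel_bounds[OF s r, where 'a='a])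
  have main: "L2 lborel2 (fracq s u) \<and>
      (sqint lborel2 (fracq s u)) \<le> k1 * sqint lborel (grad u) + 2 * k2 * (LBINT x. (u x)\<^sup>2) \<and>
      2 * k2 * (LBINT x. (u x)\<^sup>2) \<le> sqint lborel2 (fracq s u)"
    if u: "test_fun \<Omega> u" for u
  proof -
    have C: "C1g u (grad u)" by (rule test_fun_C1g[OF u])
    have [measurable]: "u \<in> borel_measurable borel" using C1g_measurable[OF C] by auto
    define L where "L = (LBINT x. (u x)\<^sup>2)"
    define D where "D = sqint lborel (grad u)"
    have LD: "0 \<le> L" "0 \<le> D" by (auto simp: L_def D_def)
    have L: "(\<integral>\<^sup>+x. ennreal ((u x)\<^sup>2) \<partial>lborel) = ennreal L"
      using L2_nn_integral_eq[OF test_fun_L2(1)[OF u]] by (simp add: L_def)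
    have D: "nnsqint lborel (grad u) = ennreal D"
      using L2_nn_integral_eq[OF test_fun_L2(2)[OF u]] by (simp add: D_def)
    have u0: "u x = 0" if "x \<notin> \<Omega>" for x
    proof -
      obtain K where "K \<subseteq> \<Omega>" "\<And>x. x \<notin> K \<Longrightarrow> u x = 0" using test_fun_support[OF u] by metis
      then show ?thesis using that by blast
    qed
    have far: "u x * u (x + h) = 0" if "r \<le> norm h" for x h
      using diam[of "x + h" x] that u0[of x] u0[of "x + h"] by force
    let ?k = "\<lambda>h::'a. ennreal (1 / norm h powr ?p)"
    let ?d = "\<lambda>h. \<integral>\<^sup>+x. ennreal ((u (x + h) - u x)\<^sup>2) \<partial>lborel"
    let ?near = "\<lambda>h::'a. ennreal ((norm h)\<^sup>2 / norm h powr ?p) * indicator {h. norm h < r} h"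
    let ?far = "\<lambda>h::'a. ?k h * indicator {h. r \<le> norm h} h"
    have dfar: "?d h = ennreal (2 * L)" if "r \<le> norm h" for h
      using translation_difference_eq[of u h] far[OF that] LD by (simp add: L ennreal_mult')
    have lower: "?far h * ennreal (2 * L) \<le> ?k h * ?d h" for h
      using dfar[of h] by (auto simp: indicator_def)
    have upper: "?k h * ?d h \<le> ?near h * ennreal D + ?far h * ennreal (2 * L)" for h
    proof (cases "norm h < r")
      case True
      have "?k h * ?d h \<le> ?k h * (ennreal ((norm h)\<^sup>2) * ennreal D)"
        using translation_difference_le[OF C, of h] unfolding D by (intro mult_left_mono) auto
      also have "\<dots> = ?near h * ennreal D"
        using True by (simp add: mult.assoc[symmetric] ennreal_mult'[symmetric])
      finally show ?thesis by (simp add: True add_increasing2)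
    next
      case False
      then show ?thesis using dfar[of h] by simp
    qed
    have eq: "nnsqint lborel2 (fracq s u) = (\<integral>\<^sup>+h. ?k h * ?d h \<partial>lborel)"
      by (rule fracq_nn_integral_eq) measurable
    also have "\<dots> \<le> (\<integral>\<^sup>+h. ?near h * ennreal D + ?far h * ennreal (2 * L) \<partial>lborel)"
      by (intro nn_integral_mono upper)
    also have "\<dots> = (\<integral>\<^sup>+h. ?near h \<partial>lborel) * ennreal D + (\<integral>\<^sup>+h. ?far h \<partial>lborel) * ennreal (2 * L)"
      by (simp add: nn_integral_add nn_integral_multc)
    also have "\<dots> \<le> ennreal k1 * ennreal D + ennreal k2 * ennreal (2 * L)"
      unfolding K2 by (intro add_mono mult_right_mono K1) auto
    also have "\<dots> = ennreal (k1 * D + 2 * k2 * L)"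
      using k LD by (simp add: ennreal_mult[symmetric] ennreal_plus[symmetric] mult_ac del: ennreal_plus)
    finally have up: "nnsqint lborel2 (fracq s u) \<le> ennreal (k1 * D + 2 * k2 * L)" .
    have nn: "0 \<le> k1 * D + 2 * k2 * L" using k LD by simp
    note X = L2_I_nn_integral[OF fracq_measurable up nn]
    have "ennreal (2 * k2 * L) = (\<integral>\<^sup>+h. ?far h \<partial>lborel) * ennreal (2 * L)"
      unfolding K2 using k LD by (simp add: ennreal_mult[symmetric] mult_ac)
    also have "\<dots> = (\<integral>\<^sup>+h. ?far h * ennreal (2 * L) \<partial>lborel)" by (simp add: nn_integral_multc)
    also have "\<dots> \<le> nnsqint lborel2 (fracq s u)"
      unfolding eq by (intro nn_integral_mono lower)
    also have "\<dots> = ennreal (sqint lborel2 (fracq s u))"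
      using X by (intro L2_nn_integral_eq) auto
    finally have "2 * k2 * L \<le> sqint lborel2 (fracq s u)"
      by (simp add: ennreal_le_iff)
    then show ?thesis using X by (simp add: L_def D_def)
  qed
  show ?thesis by (rule that[OF k]) (rule main)
qed

section \<open>Coercive pairs of quadratic forms\<close>

text \<open>The first eigenvalue of \<open>D\<close> relative to \<open>S\<close>, when \<open>D - lam S\<close> is coercive on the kernel of one
  linear functional \<open>l\<close>. No compactness is required: an almost minimising sequence normalised by
  \<open>l = 1\<close> is a Cauchy sequence. Vectors are manipulated only through \<open>lin a x b y\<close>, which stands for
  \<open>a x + b y\<close>, so that functions need not be identified almost everywhere.\<close>
locale coercive_forms =
  fixes V :: "'v set" and lin :: "real \<Rightarrow> 'v \<Rightarrow> real \<Rightarrow> 'v \<Rightarrow> 'v"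
    and D S :: "'v \<Rightarrow> 'v \<Rightarrow> real" and l :: "'v \<Rightarrow> real" and lam \<delta> M C :: real
  assumes lin_V: "x \<in> V \<Longrightarrow> y \<in> V \<Longrightarrow> lin a x b y \<in> V"
    and D_lin: "x \<in> V \<Longrightarrow> y \<in> V \<Longrightarrow> z \<in> V \<Longrightarrow> D (lin a x b y) z = a * D x z + b * D y z"
    and S_lin: "x \<in> V \<Longrightarrow> y \<in> V \<Longrightarrow> z \<in> V \<Longrightarrow> S (lin a x b y) z = a * S x z + b * S y z"
    and l_lin: "x \<in> V \<Longrightarrow> y \<in> V \<Longrightarrow> l (lin a x b y) = a * l x + b * l y"
    and D_sym: "D x y = D y x" and S_sym: "S x y = S y x"
    and S_nonneg: "x \<in> V \<Longrightarrow> 0 \<le> S x x"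
    and l_bound: "x \<in> V \<Longrightarrow> (l x)\<^sup>2 \<le> C * D x x"
    and rayleigh: "x \<in> V \<Longrightarrow> lam * S x x \<le> D x x"
    and lam_pos: "0 < lam"
    and infimum: "0 < \<epsilon> \<Longrightarrow> \<exists>x\<in>V. 0 < S x x \<and> D x x < (lam + \<epsilon>) * S x x"
    and \<delta>_pos: "0 < \<delta>" and M_nonneg: "0 \<le> M"
    and coercive: "x \<in> V \<Longrightarrow> \<delta> * D x x \<le> D x x - lam * S x x + M * (l x)\<^sup>2"
    and complete: "(\<And>k. X k \<in> V) \<Longrightarrow>
        (\<And>k m. k \<le> m \<Longrightarrow> D (lin 1 (X m) (-1) (X k)) (lin 1 (X m) (-1) (X k)) \<le> (1/8)^k) \<Longrightarrow>
        \<exists>x\<in>V. (\<lambda>k. D (lin 1 (X k) (-1) x) (lin 1 (X k) (-1) x)) \<longlonglongrightarrow> 0"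
begin

definition a where "a x y = D x y - lam * S x y"

lemma a_sym: "a x y = a y x"
  by (simp add: a_def D_sym[of x y] S_sym[of x y])

lemma a_nonneg: "x \<in> V \<Longrightarrow> 0 \<le> a x x"
  using rayleigh[of x] by (simp add: a_def)

lemma a_le_D: "x \<in> V \<Longrightarrow> a x x \<le> D x x"
  using S_nonneg[of x] lam_pos by (simp add: a_def)

lemma a_lin: "x \<in> V \<Longrightarrow> y \<in> V \<Longrightarrow> z \<in> V \<Longrightarrow> a (lin s x t y) z = s * a x z + t * a y z"
  by (simp add: a_def D_lin S_lin algebra_simps)

lemma a_lin_square:
  assumes "x \<in> V" "y \<in> V"
  shows "a (lin s x t y) (lin s x t y) = s\<^sup>2 * a x x + 2 * s * t * a x y + t\<^sup>2 * a y y"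
proof -
  have "a (lin s x t y) (lin s x t y) = s * a x (lin s x t y) + t * a y (lin s x t y)"
    by (rule a_lin[OF assms lin_V[OF assms]])
  also have "a x (lin s x t y) = s * a x x + t * a x y"
    using a_lin[OF assms assms(1), of s t] a_sym by metis
  also have "a y (lin s x t y) = s * a x y + t * a y y"
    using a_lin[OF assms assms(2), of s t] a_sym by metis
  finally show ?thesis by (simp add: algebra_simps power2_eq_square)
qed

lemma a_Cauchy_Schwarz:
  assumes "x \<in> V" "y \<in> V"
  shows "(a x y)\<^sup>2 \<le> a x x * a y y"
proof (rule quadratic_nonneg_discrim[OF _ a_nonneg[OF assms(2)]])
  fix t show "0 \<le> a x x + 2 * t * a x y + t\<^sup>2 * a y y"
    using a_nonneg[OF lin_V[OF assms, of 1 t]] by (simp add: a_lin_square[OF assms])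
qed

lemma a_diff_le:
  assumes "x \<in> V" "y \<in> V"
  shows "a (lin 1 x (-1) y) (lin 1 x (-1) y) \<le> 2 * a x x + 2 * a y y"
  using a_nonneg[OF lin_V[OF assms, of 1 1]] by (simp add: a_lin_square[OF assms])

text \<open>Otherwise \<open>a x x \<ge> \<eta> * (l x)\<^sup>2\<close> everywhere by homogeneity.
  The rank-one term in \<open>coercive\<close> could then be absorbed, making \<open>a\<close>
  coercive on all of \<open>V\<close>, and \<open>lam\<close> would not be the infimum of the
  quotients.\<close>

lemma almost_minimiser:
  assumes "0 < \<eta>"
  shows "\<exists>x\<in>V. l x = 1 \<and> a x x < \<eta>"
proof (rule ccontr)
  assume no: "\<not> ?thesis"
  have l_le: "\<eta> * (l x)\<^sup>2 \<le> a x x" if x: "x \<in> V" for x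
  proof (cases "l x = 0")
    case True
    then show ?thesis using a_nonneg[OF x] by simp
  next
    case False
    let ?y = "lin (1 / l x) x 0 x"
    have "l ?y = 1" using False by (simp add: l_lin[OF x x])
    then have "\<eta> \<le> a ?y ?y" using no lin_V[OF x x] by (meson not_le)
    also have "\<dots> = a x x / (l x)\<^sup>2" by (simp add: a_lin_square[OF x x] power_divide)
    finally show ?thesis using False by (simp add: field_simps)
  qed
  \<comment> \<open>The constant left after replacing \<open>M * (l x)\<^sup>2\<close> by
    \<open>M / \<eta>\<close> times \<open>a x x\<close>.\<close>
  define \<gamma> where "\<gamma> = \<delta> / (1 + M / \<eta>)"
  have pos: "0 < 1 + M / \<eta>" using M_nonneg assms by (simp add: add_pos_nonneg)
  then have \<gamma>: "0 < \<gamma>" using \<delta>_pos by (simp add: \<gamma>_def)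
  \<comment> \<open>This excess makes \<open>a x x\<close> smaller than
    \<open>\<gamma> * lam * S x x\<close>, against the coercivity derived below.\<close>
  obtain x where x: "x \<in> V" "0 < S x x" "D x x < (lam + lam * \<gamma>) * S x x"
    using infimum[of "lam * \<gamma>"] lam_pos \<gamma> by auto
  have "M * (l x)\<^sup>2 \<le> M * (a x x / \<eta>)"
    using l_le[OF x(1)] assms M_nonneg by (intro mult_left_mono) (auto simp: field_simps)
  then have "\<delta> * D x x \<le> a x x * (1 + M / \<eta>)"
  proof -
    have "\<delta> * D x x \<le> a x x + M * (l x)\<^sup>2" using coercive[OF x(1)] by (simp add: a_def)
    also have "\<dots> \<le> a x x + M * (a x x / \<eta>)" using \<open>M * (l x)\<^sup>2 \<le> _\<close> by simp
    also have "\<dots> = a x x * (1 + M / \<eta>)" by (simp add: distrib_left)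
    finally show ?thesis .
  qed
  then have "\<gamma> * D x x \<le> a x x" using pos by (simp add: \<gamma>_def field_simps)
  moreover have "\<gamma> * (lam * S x x) \<le> \<gamma> * D x x" using rayleigh[OF x(1)] \<gamma> by simp
  ultimately show False using x(3) by (simp add: a_def algebra_simps)
qed

text \<open>Differences of vectors with \<open>l = 1\<close> lie in the kernel of \<open>l\<close>,
  where \<open>a\<close> controls \<open>D\<close>. At the limit \<open>\<psi>\<close> the form
  \<open>a\<close> vanishes, so Cauchy-Schwarz gives the eigenvalue equation against every vector.
  If \<open>a\<close> also vanishes at \<open>u\<close>, then it vanishes at
  \<open>u - l u \<psi>\<close>, which lies in the kernel again.\<close>

theorem first_eigenvector:
  obtains \<psi> where "\<psi> \<in> V" "l \<psi> = 1" "\<And>v. v \<in> V \<Longrightarrow> D \<psi> v = lam * S \<psi> v"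
    "\<And>u. u \<in> V \<Longrightarrow> D u u = lam * S u u \<Longrightarrow> D (lin 1 u (- l u) \<psi>) (lin 1 u (- l u) \<psi>) \<le> 0"
proof -
  \<comment> \<open>With \<open>\<delta> / 4\<close>, the estimate \<open>a_diff_le\<close> for two
    members produces the factor \<open>\<delta>\<close>, which coercivity cancels.\<close>
  have "\<exists>X. \<forall>k. X k \<in> V \<and> l (X k) = 1 \<and> a (X k) (X k) < \<delta> / 4 * (1/8)^k"
  proof (intro choice allI)
    fix k
    have "0 < \<delta> / 4 * (1/8)^k" using \<delta>_pos by simp
    from almost_minimiser[OF this]
    show "\<exists>x. x \<in> V \<and> l x = 1 \<and> a x x < \<delta> / 4 * (1/8)^k" by blast
  qed
  then obtain X where X: "\<And>k. X k \<in> V" "\<And>k. l (X k) = 1" "\<And>k. a (X k) (X k) < \<delta> / 4 * (1/8)^k"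
    by blast
  have fast: "D (lin 1 (X m) (-1) (X k)) (lin 1 (X m) (-1) (X k)) \<le> (1/8)^k" if "k \<le> m" for k m
  proof -
    let ?d = "lin 1 (X m) (-1) (X k)"
    have d: "?d \<in> V" by (rule lin_V[OF X(1) X(1)])
    have "(1/8::real)^m \<le> (1/8)^k" using that by (rule power_decreasing) auto
    then have "a (X m) (X m) \<le> \<delta> / 4 * (1/8)^k"
      using X(3)[of m] \<delta>_pos mult_left_mono[of "(1/8)^m" "(1/8)^k" "\<delta>/4"] by linarith
    then have "a ?d ?d \<le> \<delta> * (1/8)^k"
      using a_diff_le[OF X(1) X(1), of m k] X(3)[of k] by (simp add: algebra_simps)
    moreover have "l ?d = 0" by (simp add: l_lin[OF X(1) X(1)] X(2))
    ultimately have "\<delta> * D ?d ?d \<le> \<delta> * (1/8)^k" using coercive[OF d] by (simp add: a_def)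
    then show ?thesis using \<delta>_pos by simp
  qed
  obtain \<psi> where \<psi>: "\<psi> \<in> V" and lim: "(\<lambda>k. D (lin 1 (X k) (-1) \<psi>) (lin 1 (X k) (-1) \<psi>)) \<longlonglongrightarrow> 0"
    using complete[OF X(1) fast] by blast
  let ?d = "\<lambda>k. lin 1 (X k) (-1) \<psi>"
  have d: "?d k \<in> V" for k by (rule lin_V[OF X(1) \<psi>])
  have "(1 - l \<psi>)\<^sup>2 \<le> 0"
  proof (rule LIMSEQ_le_const)
    show "(\<lambda>k. C * D (?d k) (?d k)) \<longlonglongrightarrow> 0" using tendsto_mult_right_zero[OF lim] .
    show "\<exists>N. \<forall>k\<ge>N. (1 - l \<psi>)\<^sup>2 \<le> C * D (?d k) (?d k)"
      using l_bound[OF d] by (auto simp: l_lin[OF X(1) \<psi>] X(2))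
  qed
  then have l1: "l \<psi> = 1" by simp
  have "a \<psi> \<psi> \<le> 0"
  proof (rule LIMSEQ_le_const)
    have "(\<lambda>k. 2 * (\<delta> / 4 * (1/8)^k) + 2 * D (?d k) (?d k)) \<longlonglongrightarrow> 2 * (\<delta> / 4 * 0) + 2 * 0"
      by (intro tendsto_intros lim LIMSEQ_power_zero) auto
    then show "(\<lambda>k. 2 * (\<delta> / 4 * (1/8)^k) + 2 * D (?d k) (?d k)) \<longlonglongrightarrow> 0" by simp
    have "a \<psi> \<psi> \<le> 2 * (\<delta> / 4 * (1/8)^k) + 2 * D (?d k) (?d k)" for k
    proof -
      \<comment> \<open>The parallelogram law for \<open>X k\<close> and \<open>?d k\<close>: their
        difference is \<open>\<psi>\<close>, and their sum is \<open>2 X k - \<psi>\<close>.\<close>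
      have "a \<psi> \<psi> = 2 * a (X k) (X k) + 2 * a (?d k) (?d k) - a (lin 2 (X k) (-1) \<psi>) (lin 2 (X k) (-1) \<psi>)"
        by (simp add: a_lin_square[OF X(1) \<psi>])
      then show ?thesis
        using a_nonneg[OF lin_V[OF X(1) \<psi>, of 2 k "-1"]] X(3)[of k] a_le_D[OF d, of k] by linarith
    qed
    then show "\<exists>N. \<forall>k\<ge>N. a \<psi> \<psi> \<le> 2 * (\<delta> / 4 * (1/8)^k) + 2 * D (?d k) (?d k)" by blast
  qed
  then have a0: "a \<psi> \<psi> = 0" using a_nonneg[OF \<psi>] by simp
  have a\<psi>: "a \<psi> v = 0" if "v \<in> V" for v
    using a_Cauchy_Schwarz[OF \<psi> that] by (simp add: a0)
  show ?thesis
  proof (rule that[OF \<psi> l1])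
    show "D \<psi> v = lam * S \<psi> v" if "v \<in> V" for v using a\<psi>[OF that] by (simp add: a_def)
    fix u assume u: "u \<in> V" and "D u u = lam * S u u"
    then have "a u u = 0" by (simp add: a_def)
    then have "a (lin 1 u (- l u) \<psi>) (lin 1 u (- l u) \<psi>) = 0"
      using a\<psi>[OF u] by (simp add: a_lin_square[OF u \<psi>] a0 a_sym[of u \<psi>])
    moreover have "l (lin 1 u (- l u) \<psi>) = 0" by (simp add: l_lin[OF u \<psi>] l1)
    ultimately have "\<delta> * D (lin 1 u (- l u) \<psi>) (lin 1 u (- l u) \<psi>) \<le> 0"
      using coercive[OF lin_V[OF u \<psi>, of 1 "- l u"]] by (simp add: a_def)
    then show "D (lin 1 u (- l u) \<psi>) (lin 1 u (- l u) \<psi>) \<le> 0"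
      using \<delta>_pos by (simp add: mult_le_0_iff)
  qed
qed

end

section \<open>The Sobolev space and the nonlocal form\<close>

lemma L2_of_nn_tendsto:
  fixes f :: "nat \<Rightarrow> 'a \<Rightarrow> 'b::euclidean_space"
  assumes f: "\<And>k. L2 M (f k)" and m [measurable]: "f' \<in> borel_measurable M"
    and lim: "(\<lambda>k. \<integral>\<^sup>+x. ennreal ((norm (f k x - f' x))\<^sup>2) \<partial>M) \<longlonglongrightarrow> 0"
  shows "L2 M f'" "(\<lambda>k. sqint M (\<lambda>x. f k x - f' x)) \<longlonglongrightarrow> 0"
proof -
  have [measurable]: "f k \<in> borel_measurable M" for k using f by (simp add: L2_def)
  have "\<forall>\<^sub>F k in sequentially. (nnsqint M (\<lambda>x. f k x - f' x)) < 1"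
    using lim by (rule order_tendstoD) simp
  then obtain k where "nnsqint M (\<lambda>x. f k x - f' x) < 1"
    by (auto dest!: eventually_happens'[OF sequentially_bot])
  then have "nnsqint M (\<lambda>x. f k x - f' x) < \<infinity>"
    by (rule order.strict_trans) simp
  then have "L2 M (\<lambda>x. f k x - f' x)" by (subst L2_iff_nn_integral) auto
  from L2_diff[OF f[of k] this] show f': "L2 M f'" by simp
  have "nnsqint M (\<lambda>x. f k x - f' x) = ennreal (sqint M (\<lambda>x. f k x - f' x))" for k
    by (rule L2_nn_integral_eq[OF L2_diff[OF f f']])
  then show "(\<lambda>k. sqint M (\<lambda>x. f k x - f' x)) \<longlonglongrightarrow> 0"
    using lim by (simp add: ennreal_tendsto_0_iff)
qed

lemma H10_cases:
  assumes "H10 \<Omega> u G"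
  obtains \<phi> where "\<And>k. test_fun \<Omega> (\<phi> k)" "L2 lborel u" "L2 lborel G"
    "(\<lambda>k. LBINT x. (norm (\<phi> k x - u x))\<^sup>2) \<longlonglongrightarrow> 0"
    "(\<lambda>k. LBINT x. (norm (grad (\<phi> k) x - G x))\<^sup>2) \<longlonglongrightarrow> 0"
proof -
  obtain \<phi> where \<phi>: "\<And>k. test_fun \<Omega> (\<phi> k)"
    and l: "(\<lambda>k. \<integral>\<^sup>+x. ennreal ((norm (\<phi> k x - u x))\<^sup>2) \<partial>lborel) \<longlonglongrightarrow> 0"
      "(\<lambda>k. \<integral>\<^sup>+x. ennreal ((norm (grad (\<phi> k) x - G x))\<^sup>2) \<partial>lborel) \<longlonglongrightarrow> 0"
    using assms by (auto simp: H10_def)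
  have m: "u \<in> borel_measurable lborel" "G \<in> borel_measurable lborel"
    using assms unfolding H10_def by blast+
  show ?thesis
    using that[OF \<phi> L2_of_nn_tendsto(1)[OF test_fun_L2(1)[OF \<phi>] m(1) l(1)]
        L2_of_nn_tendsto(1)[OF test_fun_L2(2)[OF \<phi>] m(2) l(2)]
        L2_of_nn_tendsto(2)[OF test_fun_L2(1)[OF \<phi>] m(1) l(1)]
        L2_of_nn_tendsto(2)[OF test_fun_L2(2)[OF \<phi>] m(2) l(2)]] .
qed

lemma H10_L2:
  assumes "H10 \<Omega> u G"
  shows "L2 lborel u" "L2 lborel G"
  by (rule H10_cases[OF assms], assumption)+

lemma H10_I:
  assumes \<phi>: "\<And>k. test_fun \<Omega> (\<phi> k)" and uG: "L2 lborel u" "L2 lborel G"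
    and l: "(\<lambda>k. LBINT x. (norm (\<phi> k x - u x))\<^sup>2) \<longlonglongrightarrow> 0"
    "(\<lambda>k. LBINT x. (norm (grad (\<phi> k) x - G x))\<^sup>2) \<longlonglongrightarrow> 0"
  shows "H10 \<Omega> u G"
proof -
  have "nnsqint lborel (\<lambda>x. \<phi> k x - u x) = ennreal (sqint lborel (\<lambda>x. \<phi> k x - u x))"
    "nnsqint lborel (\<lambda>x. grad (\<phi> k) x - G x) = ennreal (sqint lborel (\<lambda>x. grad (\<phi> k) x - G x))" for k
    by (rule L2_nn_integral_eq L2_diff test_fun_L2 \<phi> uG)+
  with l have "(\<lambda>k. \<integral>\<^sup>+x. ennreal ((norm (\<phi> k x - u x))\<^sup>2) \<partial>lborel) \<longlonglongrightarrow> 0"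
    "(\<lambda>k. \<integral>\<^sup>+x. ennreal ((norm (grad (\<phi> k) x - G x))\<^sup>2) \<partial>lborel) \<longlonglongrightarrow> 0"
    by (simp_all add: ennreal_tendsto_0_iff)
  then show ?thesis using \<phi> uG unfolding H10_def L2_def by auto
qed

lemma test_fun_H10: "test_fun \<Omega> u \<Longrightarrow> H10 \<Omega> u (grad u)"
  by (rule H10_I[of _ "\<lambda>_. u"]) (auto intro: test_fun_L2)

lemma test_fun_lin:
  assumes "test_fun \<Omega> u" "test_fun \<Omega> v"
  shows "test_fun \<Omega> (\<lambda>x. a * u x + b * v x)"
    and "grad (\<lambda>x. a * u x + b * v x) = (\<lambda>x. a *\<^sub>R grad u x + b *\<^sub>R grad v x)"
proof -
  show "grad (\<lambda>x. a * u x + b * v x) = (\<lambda>x. a *\<^sub>R grad u x + b *\<^sub>R grad v x)"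
    by (rule C1g_grad[OF C1g_lin[OF test_fun_C1g[OF assms(1)] test_fun_C1g[OF assms(2)]]])
  let ?S = "\<lambda>f :: 'a \<Rightarrow> real. closure {x. f x \<noteq> 0}"
  have s: "?S (\<lambda>x. a * u x + b * v x) \<subseteq> ?S u \<union> ?S v"
    unfolding closure_Un[symmetric] by (intro closure_mono) auto
  have "compact (?S u \<union> ?S v)" using assms unfolding test_fun_def by (intro compact_Un) auto
  then have "compact (?S (\<lambda>x. a * u x + b * v x))"
    using compact_Int_closed[OF _ closed_closure, of "?S u \<union> ?S v" "{x. a * u x + b * v x \<noteq> 0}"] s
    by (simp add: inf.absorb2 del: compact_closure)
  moreover have "smooth_fun (\<lambda>x. a * u x + b * v x)"
    using assms unfolding test_fun_def smooth_fun_def by (intro allI Ck_add Ck_mult Ck_const) auto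
  moreover have "?S (\<lambda>x. a * u x + b * v x) \<subseteq> \<Omega>" using s assms unfolding test_fun_def by blast
  ultimately show "test_fun \<Omega> (\<lambda>x. a * u x + b * v x)" unfolding test_fun_def by blast
qed

lemma L2_lin_tendsto:
  fixes f g :: "nat \<Rightarrow> 'a \<Rightarrow> 'b::euclidean_space"
  assumes L: "\<And>k. L2 M (f k)" "L2 M f'" "\<And>k. L2 M (g k)" "L2 M g'"
    and l: "(\<lambda>k. sqint M (\<lambda>x. f k x - f' x)) \<longlonglongrightarrow> 0" "(\<lambda>k. sqint M (\<lambda>x. g k x - g' x)) \<longlonglongrightarrow> 0"
  shows "(\<lambda>k. sqint M (\<lambda>x. (a *\<^sub>R f k x + b *\<^sub>R g k x) - (a *\<^sub>R f' x + b *\<^sub>R g' x))) \<longlonglongrightarrow> 0"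
proof (rule tendsto_sandwich[OF _ _ tendsto_const])
  let ?b = "\<lambda>k. 2 * a\<^sup>2 * sqint M (\<lambda>x. f k x - f' x) + 2 * b\<^sup>2 * sqint M (\<lambda>x. g k x - g' x)"
  have "(\<lambda>k. ?b k) \<longlonglongrightarrow> 2 * a\<^sup>2 * 0 + 2 * b\<^sup>2 * 0" by (intro tendsto_intros l)
  then show "?b \<longlonglongrightarrow> 0" by simp
  have e: "(a *\<^sub>R f k x + b *\<^sub>R g k x) - (a *\<^sub>R f' x + b *\<^sub>R g' x) = a *\<^sub>R (f k x - f' x) + b *\<^sub>R (g k x - g' x)" for k x
    by (simp add: algebra_simps)
  show "\<forall>\<^sub>F k in sequentially. (sqint M (\<lambda>x. (a *\<^sub>R f k x + b *\<^sub>R g k x) - (a *\<^sub>R f' x + b *\<^sub>R g' x))) \<le> ?b k"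
    unfolding e by (intro always_eventually allI L2_norm_lin_le L2_diff L)
qed auto

lemma H10_lin:
  assumes "H10 \<Omega> u G" "H10 \<Omega> v H"
  shows "H10 \<Omega> (\<lambda>x. a * u x + b * v x) (\<lambda>x. a *\<^sub>R G x + b *\<^sub>R H x)"
proof -
  obtain \<phi> where \<phi>: "\<And>k. test_fun \<Omega> (\<phi> k)" "L2 lborel u" "L2 lborel G"
    "(\<lambda>k. LBINT x. (norm (\<phi> k x - u x))\<^sup>2) \<longlonglongrightarrow> 0"
    "(\<lambda>k. LBINT x. (norm (grad (\<phi> k) x - G x))\<^sup>2) \<longlonglongrightarrow> 0"
    by (rule H10_cases[OF assms(1)], rule that)
  obtain \<psi> where \<psi>: "\<And>k. test_fun \<Omega> (\<psi> k)" "L2 lborel v" "L2 lborel H"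
    "(\<lambda>k. LBINT x. (norm (\<psi> k x - v x))\<^sup>2) \<longlonglongrightarrow> 0"
    "(\<lambda>k. LBINT x. (norm (grad (\<psi> k) x - H x))\<^sup>2) \<longlonglongrightarrow> 0"
    by (rule H10_cases[OF assms(2)], rule that)
  show ?thesis
  proof (rule H10_I[OF test_fun_lin(1)[OF \<phi>(1) \<psi>(1)]])
    show "L2 lborel (\<lambda>x. a * u x + b * v x)" "L2 lborel (\<lambda>x. a *\<^sub>R G x + b *\<^sub>R H x)"
      using L2_lin[OF \<phi>(2) \<psi>(2)] L2_lin[OF \<phi>(3) \<psi>(3)] by auto
    show "(\<lambda>k. LBINT x. (norm (a * \<phi> k x + b * \<psi> k x - (a * u x + b * v x)))\<^sup>2) \<longlonglongrightarrow> 0"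
      using L2_lin_tendsto[OF test_fun_L2(1)[OF \<phi>(1)] \<phi>(2) test_fun_L2(1)[OF \<psi>(1)] \<psi>(2) \<phi>(4) \<psi>(4), of a b] by simp
    show "(\<lambda>k. LBINT x. (norm (grad (\<lambda>x. a * \<phi> k x + b * \<psi> k x) x - (a *\<^sub>R G x + b *\<^sub>R H x)))\<^sup>2) \<longlonglongrightarrow> 0"
      unfolding test_fun_lin(2)[OF \<phi>(1) \<psi>(1)]
      by (rule L2_lin_tendsto[OF test_fun_L2(2)[OF \<phi>(1)] \<phi>(3) test_fun_L2(2)[OF \<psi>(1)] \<psi>(3) \<phi>(5) \<psi>(5)])
  qed
qed

text \<open>Replace each \<open>u k\<close> by a test function whose squared distances, for values
  and gradients, are at most \<open>1 / (k + 1)\<close>; the replacements still converge to the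
  limit.\<close>

lemma H10_limit:
  assumes X: "\<And>k. H10 \<Omega> (u k) (G k)" and L: "L2 lborel u'" "L2 lborel G'"
    and l: "(\<lambda>k. LBINT x. (norm (u k x - u' x))\<^sup>2) \<longlonglongrightarrow> 0"
      "(\<lambda>k. LBINT x. (norm (G k x - G' x))\<^sup>2) \<longlonglongrightarrow> 0"
  shows "H10 \<Omega> u' G'"
proof -
  have "\<exists>\<phi>. test_fun \<Omega> \<phi> \<and> (sqint lborel (\<lambda>x. \<phi> x - u k x)) \<le> inverse (real (Suc k))
     \<and> (sqint lborel (\<lambda>x. grad \<phi> x - G k x)) \<le> inverse (real (Suc k))" for k
  proof -
    obtain \<phi> where \<phi>: "\<And>j. test_fun \<Omega> (\<phi> j)"
      and "L2 lborel (u k)" "L2 lborel (G k)"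
      and \<phi>l: "(\<lambda>j. LBINT x. (norm (\<phi> j x - u k x))\<^sup>2) \<longlonglongrightarrow> 0"
      "(\<lambda>j. LBINT x. (norm (grad (\<phi> j) x - G k x))\<^sup>2) \<longlonglongrightarrow> 0"
      by (rule H10_cases[OF X[of k]], rule that)
    have "\<forall>\<^sub>F j in sequentially. (sqint lborel (\<lambda>x. \<phi> j x - u k x)) < inverse (real (Suc k)) \<and>
       (sqint lborel (\<lambda>x. grad (\<phi> j) x - G k x)) < inverse (real (Suc k))"
      by (intro eventually_conj order_tendstoD(2)[OF \<phi>l(1)] order_tendstoD(2)[OF \<phi>l(2)]) auto
    then obtain j where "sqint lborel (\<lambda>x. \<phi> j x - u k x) < inverse (real (Suc k)) \<and>
       (sqint lborel (\<lambda>x. grad (\<phi> j) x - G k x)) < inverse (real (Suc k))"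
      by (auto dest!: eventually_happens'[OF sequentially_bot])
    then show ?thesis using \<phi> by (blast intro: less_imp_le)
  qed
  then obtain \<phi> where \<phi>: "\<And>k. test_fun \<Omega> (\<phi> k)"
    "\<And>k. (sqint lborel (\<lambda>x. \<phi> k x - u k x)) \<le> inverse (real (Suc k))"
    "\<And>k. (sqint lborel (\<lambda>x. grad (\<phi> k) x - G k x)) \<le> inverse (real (Suc k))"
    using choice[OF allI, of "\<lambda>k \<phi>. test_fun \<Omega> \<phi> \<and> (sqint lborel (\<lambda>x. \<phi> x - u k x)) \<le> inverse (real (Suc k))
     \<and> (sqint lborel (\<lambda>x. grad \<phi> x - G k x)) \<le> inverse (real (Suc k))"] by blast
  have tri: "(\<lambda>k. LBINT x. (norm (f k x - h' x))\<^sup>2) \<longlonglongrightarrow> 0"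
    if Lf: "\<And>k. L2 lborel (f k)" "\<And>k. L2 lborel (h k)" "L2 lborel h'"
      and b: "\<And>k. (sqint lborel (\<lambda>x. f k x - h k x)) \<le> inverse (real (Suc k))"
      and lh: "(\<lambda>k. LBINT x. (norm (h k x - h' x))\<^sup>2) \<longlonglongrightarrow> 0"
    for f h :: "nat \<Rightarrow> 'a \<Rightarrow> 'b::euclidean_space" and h'
  proof -
    have z: "(\<lambda>k. LBINT x. (norm ((f k x - h k x) - 0))\<^sup>2) \<longlonglongrightarrow> 0"
      using b by (intro tendsto_sandwich[OF _ _ tendsto_const LIMSEQ_inverse_real_of_nat]) auto
    have L0: "L2 lborel (\<lambda>x::'a. 0::'b)" by (simp add: L2_def)
    show ?thesis
      using L2_lin_tendsto[OF L2_diff[OF Lf(1,2)] L0 Lf(2,3) z lh, of 1 1] by simp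
  qed
  show ?thesis
    by (rule H10_I[OF \<phi>(1) L]; rule tri[OF test_fun_L2(1)[OF \<phi>(1)] H10_L2(1)[OF X] L(1) \<phi>(2) l(1)]
        tri[OF test_fun_L2(2)[OF \<phi>(1)] H10_L2(2)[OF X] L(2) \<phi>(3) l(2)])
qed

section \<open>The fractional form on the Sobolev space, by approximation\<close>

lemma AE_lborel2:
  fixes P :: "'a::euclidean_space \<Rightarrow> bool"
  assumes "AE x in lborel. P x"
  shows "AE z in lborel2. P (fst z) \<and> P (snd z)"
proof -
  obtain N where N: "{x. \<not> P x} \<subseteq> N" "N \<in> null_sets lborel"
    using assms by (auto elim!: AE_E simp: null_sets_def)
  have "N \<times> UNIV \<union> UNIV \<times> N \<in> null_sets (lborel2 :: ('a \<times> 'a) measure)"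
    using N(2) by (intro null_sets.Un lborel.times_in_null_sets1 lborel.times_in_null_sets2) auto
  then show ?thesis
    by (rule AE_I') (use N(1) in auto)
qed

text \<open>Fatou's lemma along a subsequence that converges almost everywhere. It provides only an
  inequality, but the inequality for differences will give convergence.\<close>

lemma H10_frac_upper:
  fixes u :: "'a::euclidean_space \<Rightarrow> real"
  assumes uG: "H10 \<Omega> u G" and k: "0 \<le> k1" "0 \<le> k2"
    and b: "\<And>\<phi>. test_fun \<Omega> \<phi> \<Longrightarrow> L2 lborel2 (fracq s \<phi>) \<and>
      (sqint lborel2 (fracq s \<phi>)) \<le> k1 * sqint lborel (grad \<phi>) + k2 * sqint lborel \<phi>"
  shows "L2 lborel2 (fracq s u)"
    and "sqint lborel2 (fracq s u) \<le> k1 * sqint lborel G + k2 * sqint lborel u"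
proof -
  obtain \<phi> where \<phi>: "\<And>k. test_fun \<Omega> (\<phi> k)" and L: "L2 lborel u" "L2 lborel G"
    and l: "(\<lambda>k. LBINT x. (norm (\<phi> k x - u x))\<^sup>2) \<longlonglongrightarrow> 0"
      "(\<lambda>k. LBINT x. (norm (grad (\<phi> k) x - G x))\<^sup>2) \<longlonglongrightarrow> 0"
    by (rule H10_cases[OF uG], rule that)
  let ?B = "\<lambda>k. k1 * sqint lborel (grad (\<phi> k)) + k2 * sqint lborel (\<phi> k)"
  let ?B' = "k1 * sqint lborel G + k2 * sqint lborel u"
  have Blim: "?B \<longlonglongrightarrow> ?B'"
    by (intro tendsto_intros L2_tendsto_norm test_fun_L2[OF \<phi>] L l)
  have [measurable]: "u \<in> borel_measurable borel" "\<phi> k \<in> borel_measurable borel" for k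
    using L2_measurable[OF L(1)] C1g_measurable(1)[OF test_fun_C1g[OF \<phi>]] by auto
  have "\<exists>r. strict_mono r \<and> (AE x in lborel. (\<lambda>n. (norm (\<phi> (r n) x - u x))\<^sup>2) \<longlonglongrightarrow> 0)"
    by (rule tendsto_L1_AE_subseq)
      (use L2_integrable[OF L2_diff[OF test_fun_L2(1)[OF \<phi>] L(1)]] l(1) in auto)
  then obtain r where r: "strict_mono r" "AE x in lborel. (\<lambda>n. (norm (\<phi> (r n) x - u x))\<^sup>2) \<longlonglongrightarrow> 0"
    by blast
  from r(2) have "AE x in lborel. (\<lambda>n. \<phi> (r n) x) \<longlonglongrightarrow> u x"
    by eventually_elim (simp add: power_tendsto_0_iff tendsto_norm_zero_iff LIM_zero_iff)
  from AE_lborel2[OF this]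
  have "AE z in lborel2. (\<lambda>n. fracq s (\<phi> (r n)) z) \<longlonglongrightarrow> fracq s u z"
  proof eventually_elim
    case (elim z)
    show ?case
      unfolding fracq_def divide_inverse
      by (intro tendsto_mult tendsto_diff tendsto_const elim[THEN conjunct1] elim[THEN conjunct2])
  qed
  then have ae: "AE z in lborel2. ennreal ((norm (fracq s u z))\<^sup>2) = liminf (\<lambda>n. ennreal ((norm (fracq s (\<phi> (r n)) z))\<^sup>2))"
  proof eventually_elim
    case (elim z)
    then have "(\<lambda>n. ennreal ((norm (fracq s (\<phi> (r n)) z))\<^sup>2)) \<longlonglongrightarrow> ennreal ((norm (fracq s u z))\<^sup>2)"
      by (intro tendsto_intros)
    from lim_imp_Liminf[OF _ this] show ?case by simp
  qed
  have "nnsqint lborel2 (fracq s u)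
     = (\<integral>\<^sup>+z. liminf (\<lambda>n. ennreal ((norm (fracq s (\<phi> (r n)) z))\<^sup>2)) \<partial>lborel2)"
    by (rule nn_integral_cong_AE[OF ae])
  also have "\<dots> \<le> liminf (\<lambda>n. \<integral>\<^sup>+z. ennreal ((norm (fracq s (\<phi> (r n)) z))\<^sup>2) \<partial>lborel2)"
    by (rule nn_integral_liminf) measurable
  also have "\<dots> \<le> liminf (\<lambda>n. ennreal (?B (r n)))"
  proof (intro Liminf_mono always_eventually allI)
    show "nnsqint lborel2 (fracq s (\<phi> (r n))) \<le> ennreal (?B (r n))" for n
      unfolding L2_nn_integral_eq[OF b[OF \<phi>, THEN conjunct1]]
      by (rule ennreal_leI[OF b[OF \<phi>, THEN conjunct2]])
  qed
  also have "\<dots> = ennreal ?B'"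
    by (intro lim_imp_Liminf tendsto_ennrealI LIMSEQ_subseq_LIMSEQ[OF Blim r(1), unfolded comp_def]) simp
  finally have up: "nnsqint lborel2 (fracq s u) \<le> ennreal ?B'" .
  have "fracq s u \<in> borel_measurable lborel2" by measurable
  then show "L2 lborel2 (fracq s u)" "sqint lborel2 (fracq s u) \<le> ?B'"
    by (rule L2_I_nn_integral[OF _ up], intro add_nonneg_nonneg mult_nonneg_nonneg k integral_nonneg, simp, simp)+
qed

locale frac_setting =
  fixes \<Omega> :: "'a::euclidean_space set" and s k1 k2 :: real
  assumes k: "0 \<le> k1" "0 \<le> k2"
    and test_upper: "test_fun \<Omega> \<phi> \<Longrightarrow> L2 lborel2 (fracq s \<phi>) \<and>
      (sqint lborel2 (fracq s \<phi>)) \<le> k1 * sqint lborel (grad \<phi>) + k2 * sqint lborel \<phi>"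
begin

lemmas frac_L2 = H10_frac_upper(1)[OF _ k test_upper]
lemmas frac_upper = H10_frac_upper(2)[OF _ k test_upper]

text \<open>The upper bound applied to \<open>\<phi> k - u\<close>: convergence of values and
  gradients forces convergence in the fractional seminorm.\<close>

lemma H10_approx:
  assumes uG: "H10 \<Omega> u G"
  obtains \<phi> where "\<And>k. test_fun \<Omega> (\<phi> k)"
    "(\<lambda>k. LBINT x. (norm (\<phi> k x - u x))\<^sup>2) \<longlonglongrightarrow> 0"
    "(\<lambda>k. LBINT x. (norm (grad (\<phi> k) x - G x))\<^sup>2) \<longlonglongrightarrow> 0"
    "(\<lambda>k. sqint lborel2 (\<lambda>z. fracq s (\<phi> k) z - fracq s u z)) \<longlonglongrightarrow> 0"
proof -
  obtain \<phi> where \<phi>: "\<And>k. test_fun \<Omega> (\<phi> k)"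
    and "L2 lborel u" "L2 lborel G"
    and l: "(\<lambda>k. LBINT x. (norm (\<phi> k x - u x))\<^sup>2) \<longlonglongrightarrow> 0"
      "(\<lambda>k. LBINT x. (norm (grad (\<phi> k) x - G x))\<^sup>2) \<longlonglongrightarrow> 0"
    by (rule H10_cases[OF uG], rule that)
  let ?B = "\<lambda>j. k1 * sqint lborel (\<lambda>x. grad (\<phi> j) x - G x) + k2 * sqint lborel (\<lambda>x. \<phi> j x - u x)"
  have "(\<lambda>k. sqint lborel2 (\<lambda>z. fracq s (\<phi> k) z - fracq s u z)) \<longlonglongrightarrow> 0"
  proof (rule tendsto_sandwich[OF _ _ tendsto_const])
    have "?B \<longlonglongrightarrow> k1 * 0 + k2 * 0" by (intro tendsto_intros l)
    then show "?B \<longlonglongrightarrow> 0" by simp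
    have "sqint lborel2 (\<lambda>z. fracq s (\<phi> j) z - fracq s u z) \<le> ?B j" for j
      using frac_upper[OF H10_lin[OF test_fun_H10[OF \<phi>[of j]] uG, of 1 "-1"]]
        fracq_lin[of s 1 "\<phi> j" "-1" u] by simp
    then show "\<forall>\<^sub>F j in sequentially. (sqint lborel2 (\<lambda>z. fracq s (\<phi> j) z - fracq s u z)) \<le> ?B j"
      by simp
  qed auto
  then show ?thesis using that \<phi> l by blast
qed

text \<open>Four free coefficients let one limit argument carry over the Poincare inequality, the
  lower bound on the seminorm and the spectral gap alike.\<close>

lemma H10_quadratic_limit:
  assumes uG: "H10 \<Omega> u G" and r: "L2 lborel r"
    and t: "\<And>\<phi>. test_fun \<Omega> \<phi> \<Longrightarrow> 0 \<le> a * sqint lborel (grad \<phi>) + b * sqint lborel \<phi>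
       + c * sqint lborel2 (fracq s \<phi>) + d * (LBINT x. \<phi> x * r x)\<^sup>2"
  shows "0 \<le> a * sqint lborel G + b * sqint lborel u
       + c * sqint lborel2 (fracq s u) + d * (LBINT x. u x * r x)\<^sup>2"
proof -
  obtain \<phi> where \<phi>: "\<And>k. test_fun \<Omega> (\<phi> k)"
    and l: "(\<lambda>k. LBINT x. (norm (\<phi> k x - u x))\<^sup>2) \<longlonglongrightarrow> 0"
      "(\<lambda>k. LBINT x. (norm (grad (\<phi> k) x - G x))\<^sup>2) \<longlonglongrightarrow> 0"
      "(\<lambda>k. sqint lborel2 (\<lambda>z. fracq s (\<phi> k) z - fracq s u z)) \<longlonglongrightarrow> 0"
    by (rule H10_approx[OF uG], rule that)
  have L: "\<And>k. L2 lborel2 (fracq s (\<phi> k))" using test_upper[OF \<phi>] by blast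
  note tL = test_fun_L2[OF \<phi>] and uL = H10_L2[OF uG] and fL = frac_L2[OF uG]
  have "(\<lambda>k. a * sqint lborel (grad (\<phi> k)) + b * sqint lborel (\<phi> k)
       + c * sqint lborel2 (fracq s (\<phi> k)) + d * (LBINT x. \<phi> k x \<bullet> r x)\<^sup>2)
     \<longlonglongrightarrow> a * sqint lborel G + b * sqint lborel u
       + c * sqint lborel2 (fracq s u) + d * (LBINT x. u x \<bullet> r x)\<^sup>2"
    by (intro tendsto_intros L2_tendsto_norm L2_tendsto_inner tL uL fL L l r)
  then show ?thesis
    unfolding inner_real_def by (rule LIMSEQ_le_const) (use t[OF \<phi>] in blast)
qed

text \<open>Enlarges the class of admissible test functions by density, so that an eigenfunction can
  be tested with itself.\<close>

lemma H10_bilinear_limit: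
  assumes uG: "H10 \<Omega> u G" and vH: "H10 \<Omega> v H"
    and t: "\<And>\<phi>. test_fun \<Omega> \<phi> \<Longrightarrow> (LBINT x. G x \<bullet> grad \<phi> x) = c * (\<integral>z. fracq s u z \<bullet> fracq s \<phi> z \<partial>lborel2)"
  shows "(LBINT x. G x \<bullet> H x) = c * (\<integral>z. fracq s u z \<bullet> fracq s v z \<partial>lborel2)"
proof -
  obtain \<phi> where \<phi>: "\<And>k. test_fun \<Omega> (\<phi> k)"
    and "(\<lambda>k. LBINT x. (norm (\<phi> k x - v x))\<^sup>2) \<longlonglongrightarrow> 0"
    and l: "(\<lambda>k. LBINT x. (norm (grad (\<phi> k) x - H x))\<^sup>2) \<longlonglongrightarrow> 0"
      "(\<lambda>k. sqint lborel2 (\<lambda>z. fracq s (\<phi> k) z - fracq s v z)) \<longlonglongrightarrow> 0"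
    by (rule H10_approx[OF vH], rule that)
  have L: "\<And>k. L2 lborel2 (fracq s (\<phi> k))" using test_upper[OF \<phi>] by blast
  have l1: "(\<lambda>k. LBINT x. grad (\<phi> k) x \<bullet> G x) \<longlonglongrightarrow> (LBINT x. H x \<bullet> G x)"
    by (rule L2_tendsto_inner[OF test_fun_L2(2)[OF \<phi>] H10_L2(2)[OF vH] H10_L2(2)[OF uG] l(1)])
  have l2: "(\<lambda>k. c * (\<integral>z. fracq s (\<phi> k) z \<bullet> fracq s u z \<partial>lborel2)) \<longlonglongrightarrow> c * (\<integral>z. fracq s v z \<bullet> fracq s u z \<partial>lborel2)"
    by (intro tendsto_intros L2_tendsto_inner L frac_L2[OF vH] frac_L2[OF uG] l(2))
  have "(LBINT x. grad (\<phi> k) x \<bullet> G x) = c * (\<integral>z. fracq s (\<phi> k) z \<bullet> fracq s u z \<partial>lborel2)" for k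
    using t[OF \<phi>] by (simp add: inner_commute mult.commute)
  then have "(LBINT x. H x \<bullet> G x) = c * (\<integral>z. fracq s v z \<bullet> fracq s u z \<partial>lborel2)"
    using LIMSEQ_unique l1 l2 by simp
  then show ?thesis by (simp add: inner_commute mult.commute)
qed

end

section \<open>Simplicity of the first eigenvalue\<close>

lemma cNs_pos: "0 < s \<Longrightarrow> s < 1 \<Longrightarrow> 0 < cNs N s"
  unfolding cNs_def by (intro mult_pos_pos divide_pos_pos Gamma_real_pos) (auto simp: add_nonneg_pos)

context frac_setting
begin

text \<open>\<open>q\<close> is the Dirichlet quotient of \<open>\<phi>\<^sub>0\<close> and lies
  below \<open>\<mu>\<close>. It bounds \<open>lam\<close> times the far coefficient of the
  seminorm, so \<open>lam\<close> times the seminorm stays a fixed fraction below the gradient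
  energy on the kernel of \<open>\<integral>r u\<close>, provided that \<open>k1\<close> is small
  against \<open>k2\<close>.\<close>

lemma simple_of_gap:
  fixes r \<phi>\<^sub>0 :: "'a \<Rightarrow> real" and \<kappa> \<mu> M q :: real
  assumes c: "0 < cNs DIM('a) s" and k2: "0 < k2"
    and low: "\<And>\<phi>. test_fun \<Omega> \<phi> \<Longrightarrow> k2 * sqint lborel \<phi> \<le> sqint lborel2 (fracq s \<phi>)"
    and \<kappa>: "0 < \<kappa>" "\<And>\<phi>. test_fun \<Omega> \<phi> \<Longrightarrow> \<kappa> * sqint lborel \<phi> \<le> sqint lborel (grad \<phi>)"
    and \<mu>: "0 < \<mu>" "0 \<le> M" "L2 lborel r"
    and gap: "\<And>\<phi>. test_fun \<Omega> \<phi> \<Longrightarrow> \<mu> * sqint lborel \<phi>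
        \<le> sqint lborel (grad \<phi>) + M * (LBINT x. \<phi> x * r x)\<^sup>2"
    and \<phi>\<^sub>0: "test_fun \<Omega> \<phi>\<^sub>0" "0 < sqint lborel (\<lambda>x. \<phi>\<^sub>0 x)"
      "sqint lborel (\<lambda>x. grad \<phi>\<^sub>0 x) = q * sqint lborel (\<lambda>x. \<phi>\<^sub>0 x)"
    and q: "0 \<le> q" "q < \<mu>" and small: "q * k1 \<le> (1 - q / \<mu>) / 2 * k2"
  shows "simple_eigenvalue \<Omega> s (first_eigenvalue \<Omega> s)"
proof -
  define c where "c = cNs DIM('a) s"
  define lam where "lam = first_eigenvalue \<Omega> s"
  define DD where "DD G = sqint lborel G" for G :: "'a \<Rightarrow> 'a"
  define LL where "LL u = sqint lborel u" for u :: "'a \<Rightarrow> real"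
  define QQ where "QQ u = sqint lborel2 (fracq s u)" for u :: "'a \<Rightarrow> real"
  define ll where "ll u = (LBINT x. u x * r x)" for u :: "'a \<Rightarrow> real"
  have c0: "0 < c" using c by (simp add: c_def)
  have semi: "frac_seminorm_sq s u = c * QQ u" for u :: "'a \<Rightarrow> real"
    by (simp only: frac_seminorm_sq_eq frac_form_eq c_def QQ_def integral_norm_sq_eq_inner)
  have nn: "0 \<le> DD G" "0 \<le> LL u" "0 \<le> QQ u" for G u by (auto simp: DD_def LL_def QQ_def)
  have poinc: "\<kappa> * LL u \<le> DD G" if "H10 \<Omega> u G" for u G
    using H10_quadratic_limit[OF that \<mu>(3), of 1 "- \<kappa>" 0 0] \<kappa>(2) by (simp add: DD_def LL_def)
  have lower: "k2 * LL u \<le> QQ u" if "H10 \<Omega> u G" for u G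
    using H10_quadratic_limit[OF that \<mu>(3), of 0 "- k2" 1 0] low by (simp add: LL_def QQ_def)
  have gapH: "\<mu> * LL u \<le> DD G + M * (ll u)\<^sup>2" if "H10 \<Omega> u G" for u G
    using H10_quadratic_limit[OF that \<mu>(3), of 1 "- \<mu>" 0 M] gap by (simp add: DD_def LL_def ll_def algebra_simps)
  have upper: "QQ u \<le> k1 * DD G + k2 * LL u" if "H10 \<Omega> u G" for u G
    using frac_upper[OF that] by (simp add: DD_def LL_def QQ_def)
  have LL_pos: "0 < LL u" if "H10 \<Omega> u G" "\<not> (AE x in lborel. u x = 0)" for u G
  proof -
    have "LL u \<noteq> 0" using L2_AE_zero[OF H10_L2(1)[OF that(1)]] that(2) by (auto simp: LL_def)
    then show ?thesis using nn(2)[of u] by simp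
  qed
  have QQ_pos: "0 < QQ u" if "H10 \<Omega> u G" "\<not> (AE x in lborel. u x = 0)" for u G
    using lower[OF that(1)] mult_pos_pos[OF k2 LL_pos[OF that]] by linarith
  have QQ_zero: "QQ u = 0" if "AE x in lborel. u x = 0" for u
  proof -
    have "AE z in lborel2. (norm (fracq s u z))\<^sup>2 = 0"
      using AE_lborel2[OF that] by eventually_elim (simp add: fracq_def)
    then show ?thesis unfolding QQ_def by (rule integral_eq_zero_AE)
  qed
  \<comment> \<open>The seminorm is bounded by the gradient energy, so the quotients in
    \<open>E\<close> stay above \<open>1 / C1\<close> and \<open>lam\<close> is positive.\<close>
  define C1 where "C1 = c * (k1 + k2 / \<kappa>)"
  have C1: "0 < C1" using c0 k k2 \<kappa>(1) by (simp add: C1_def add_nonneg_pos)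
  have S_le: "c * QQ u \<le> C1 * DD G" if "H10 \<Omega> u G" for u G
  proof -
    have "k2 * LL u \<le> k2 * (DD G / \<kappa>)"
      using poinc[OF that] \<kappa>(1) k2 by (intro mult_left_mono) (auto simp: field_simps)
    then have "QQ u \<le> (k1 + k2 / \<kappa>) * DD G" using upper[OF that] by (simp add: algebra_simps)
    then show ?thesis using c0 by (simp add: C1_def)
  qed
  define E where "E = {DD G / (c * QQ u) | u G. H10 \<Omega> u G \<and> \<not> (AE x in lborel. u x = 0)}"
  have lamE: "lam = Inf E"
    by (simp add: lam_def first_eigenvalue_def E_def semi DD_def)
  have E_lower: "1 / C1 \<le> x" if xE: "x \<in> E" for x
  proof -
    obtain u G where uG: "H10 \<Omega> u G" "\<not> (AE x in lborel. u x = 0)" "x = DD G / (c * QQ u)"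
      using xE unfolding E_def mem_Collect_eq by - (elim exE conjE, rule that)
    have "0 < c * QQ u" using c0 QQ_pos[OF uG(1,2)] by simp
    then show ?thesis using S_le[OF uG(1)] C1 uG(3) by (simp add: field_simps)
  qed
  have bdd: "bdd_below E" using E_lower by (rule bdd_belowI)
  have \<phi>H: "H10 \<Omega> \<phi>\<^sub>0 (grad \<phi>\<^sub>0)" by (rule test_fun_H10[OF \<phi>\<^sub>0(1)])
  have \<phi>nz: "\<not> (AE x in lborel. \<phi>\<^sub>0 x = 0)"
  proof
    assume "AE x in lborel. \<phi>\<^sub>0 x = 0"
    then have "AE x in lborel. (norm (\<phi>\<^sub>0 x))\<^sup>2 = 0" by eventually_elim simp
    then have "sqint lborel (\<lambda>x. \<phi>\<^sub>0 x) = 0" by (rule integral_eq_zero_AE)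
    then show False using \<phi>\<^sub>0(2) by simp
  qed
  have inE: "DD (grad \<phi>\<^sub>0) / (c * QQ \<phi>\<^sub>0) \<in> E" unfolding E_def using \<phi>H \<phi>nz by blast
  have lam_pos: "0 < lam"
    using cInf_greatest[of E "1 / C1"] inE E_lower C1 unfolding lamE
    by (metis divide_pos_pos empty_iff less_le_trans zero_less_one)
  \<comment> \<open>Test with \<open>\<phi>\<^sub>0\<close> and replace its seminorm by the lower
    bound: this shrinks the denominator to \<open>c * k2\<close> times the squared norm.\<close>
  have lam_le: "lam * (c * k2) \<le> q"
  proof -
    have pos: "0 < c * QQ \<phi>\<^sub>0" using c0 QQ_pos[OF \<phi>H \<phi>nz] by simp
    have "lam \<le> DD (grad \<phi>\<^sub>0) / (c * QQ \<phi>\<^sub>0)" unfolding lamE by (rule cInf_lower[OF inE bdd])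
    then have "lam * (c * QQ \<phi>\<^sub>0) \<le> q * LL \<phi>\<^sub>0"
      using pos \<phi>\<^sub>0(3) by (simp add: DD_def LL_def pos_le_divide_eq)
    moreover have "lam * (c * (k2 * LL \<phi>\<^sub>0)) \<le> lam * (c * QQ \<phi>\<^sub>0)"
      using lower[OF \<phi>H] lam_pos c0 by (intro mult_left_mono) auto
    ultimately have "(lam * (c * k2)) * LL \<phi>\<^sub>0 \<le> q * LL \<phi>\<^sub>0" by (simp add: mult.assoc)
    then show ?thesis using \<phi>\<^sub>0(2) by (simp add: LL_def)
  qed
  have ray: "lam * (c * QQ u) \<le> DD G" if "H10 \<Omega> u G" for u G
  proof (cases "AE x in lborel. u x = 0")
    case True
    then show ?thesis using nn by (simp add: QQ_zero)
  next
    case False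
    have "DD G / (c * QQ u) \<in> E" unfolding E_def using that False by blast
    then have "lam \<le> DD G / (c * QQ u)" unfolding lamE by (rule cInf_lower[OF _ bdd])
    then show ?thesis using c0 QQ_pos[OF that False] by (simp add: pos_le_divide_eq)
  qed
  \<comment> \<open>Half of the relative gap \<open>1 - q / \<mu>\<close>: one half absorbs the near
    part \<open>k1\<close>, by \<open>small\<close>, and the other half remains as
    coercivity.\<close>
  define \<delta> where "\<delta> = (1 - q / \<mu>) / 2"
  have \<delta>: "0 < \<delta>" using q \<mu>(1) by (simp add: \<delta>_def)
  define M' where "M' = q / \<mu> * M"
  have M': "0 \<le> M'" using q \<mu> by (simp add: M'_def)
  have coer: "\<delta> * DD G \<le> DD G - lam * (c * QQ u) + M' * (ll u)\<^sup>2" if "H10 \<Omega> u G" for u G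
  proof -
    have "lam * (c * QQ u) \<le> lam * (c * (k1 * DD G + k2 * LL u))"
      using upper[OF that] lam_pos c0 by (intro mult_left_mono) auto
    also have "\<dots> = lam * (c * k2) * (k1 / k2 * DD G + LL u)"
      using k2 by (simp add: field_simps)
    also have "\<dots> \<le> q * (k1 / k2 * DD G + LL u)"
      using lam_le nn k k2 by (intro mult_right_mono) auto
    also have "\<dots> = q * k1 / k2 * DD G + q * LL u" by (simp add: distrib_left)
    also have "q * k1 / k2 * DD G \<le> \<delta> * DD G"
      using small k2 nn by (intro mult_right_mono) (auto simp: \<delta>_def pos_divide_le_eq)
    also have "q * LL u \<le> q * ((DD G + M * (ll u)\<^sup>2) / \<mu>)"
      using gapH[OF that] \<mu>(1) q by (intro mult_left_mono) (auto simp: pos_le_divide_eq mult.commute)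
    also have "\<delta> * DD G + q * ((DD G + M * (ll u)\<^sup>2) / \<mu>) = (\<delta> + q / \<mu>) * DD G + M' * (ll u)\<^sup>2"
      by (simp add: M'_def add_divide_distrib algebra_simps)
    also have "\<delta> + q / \<mu> = 1 - \<delta>" by (simp add: \<delta>_def field_simps)
    finally show ?thesis by (simp add: algebra_simps)
  qed
  have l_le: "(ll u)\<^sup>2 \<le> (LL r / \<kappa>) * DD G" if "H10 \<Omega> u G" for u G
  proof -
    have "(ll u)\<^sup>2 \<le> LL u * LL r"
      using L2_Cauchy_Schwarz[OF H10_L2(1)[OF that] \<mu>(3)] by (simp add: ll_def LL_def)
    also have "\<dots> \<le> (DD G / \<kappa>) * LL r"
      using poinc[OF that] \<kappa>(1) nn by (intro mult_right_mono) (auto simp: field_simps)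
    finally show ?thesis by (simp add: mult.commute)
  qed
  \<comment> \<open>Vectors are pairs of a function and a weak gradient, so no representative of the
    gradient has to be chosen: \<open>D\<close> reads the second component, \<open>S\<close> and
    \<open>l\<close> the first.\<close>
  define V where "V = {(u, G). H10 \<Omega> u G}"
  define lin where "lin a x b y = ((\<lambda>z. a * fst x z + b * fst y z), (\<lambda>z. a *\<^sub>R snd x z + b *\<^sub>R snd y z))"
    for a b and x y :: "('a \<Rightarrow> real) \<times> ('a \<Rightarrow> 'a)"
  define D where "D x y = (LBINT z. snd x z \<bullet> snd y z)" for x y :: "('a \<Rightarrow> real) \<times> ('a \<Rightarrow> 'a)"
  define S where "S x y = c * (\<integral>z. fracq s (fst x) z \<bullet> fracq s (fst y) z \<partial>lborel2)"
    for x y :: "('a \<Rightarrow> real) \<times> ('a \<Rightarrow> 'a)"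
  define l where "l x = ll (fst x)" for x :: "('a \<Rightarrow> real) \<times> ('a \<Rightarrow> 'a)"
  have V: "x \<in> V \<longleftrightarrow> H10 \<Omega> (fst x) (snd x)" for x by (auto simp: V_def)
  have DDD: "D x x = DD (snd x)" for x by (simp add: D_def DD_def power2_norm_eq_inner)
  have SQQ: "S x x = c * QQ (fst x)" for x by (simp only: S_def QQ_def integral_norm_sq_eq_inner)
  interpret coercive_forms V lin D S l lam \<delta> M' "LL r / \<kappa>"
  proof
    fix x y z and a b \<epsilon> :: real
    show "lin a x b y \<in> V" if "x \<in> V" "y \<in> V"
      using that H10_lin by (simp add: V lin_def)
    show "D (lin a x b y) z = a * D x z + b * D y z" if xyz: "x \<in> V" "y \<in> V" "z \<in> V"
      using L2_inner_lin[OF xyz[unfolded V, THEN H10_L2(2)], of a b] by (simp add: D_def lin_def)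
    show "S (lin a x b y) z = a * S x z + b * S y z" if xyz: "x \<in> V" "y \<in> V" "z \<in> V"
      using L2_inner_lin[OF xyz[unfolded V, THEN frac_L2], of a b]
      by (simp add: S_def lin_def fracq_lin algebra_simps)
    show "l (lin a x b y) = a * l x + b * l y" if xy: "x \<in> V" "y \<in> V"
      using L2_inner_lin[OF xy[unfolded V, THEN H10_L2(1)] \<mu>(3), of a b]
      by (simp add: l_def ll_def lin_def)
    show "D x y = D y x" "S x y = S y x" by (simp_all add: D_def S_def inner_commute mult.commute)
    show "0 \<le> S x x" using c0 nn by (simp add: SQQ)
    show "(l x)\<^sup>2 \<le> LL r / \<kappa> * D x x" if "x \<in> V" using l_le that by (simp add: V l_def DDD)
    show "lam * S x x \<le> D x x" if "x \<in> V" using ray that by (simp add: V DDD SQQ)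
    show "\<delta> * D x x \<le> D x x - lam * S x x + M' * (l x)\<^sup>2" if "x \<in> V"
      using coer that by (simp add: V DDD SQQ l_def)
    show "\<exists>x\<in>V. 0 < S x x \<and> D x x < (lam + \<epsilon>) * S x x" if "0 < \<epsilon>"
    proof -
      have "\<exists>x\<in>E. x < lam + \<epsilon>" unfolding lamE using inE that by (intro cInf_lessD) auto
      then obtain u G where uG: "H10 \<Omega> u G" "\<not> (AE x in lborel. u x = 0)" "DD G / (c * QQ u) < lam + \<epsilon>"
        unfolding E_def by blast
      have "0 < c * QQ u" using c0 QQ_pos[OF uG(1,2)] by simp
      then show ?thesis using uG by (intro bexI[of _ "(u, G)"]) (auto simp: V DDD SQQ pos_divide_less_eq)
    qed
  next
    fix X
    assume X: "\<And>k. X k \<in> V"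
      and fast: "\<And>k m. k \<le> m \<Longrightarrow> D (lin 1 (X m) (-1) (X k)) (lin 1 (X m) (-1) (X k)) \<le> (1/8)^k"
    have XH: "H10 \<Omega> (fst (X k)) (snd (X k))" for k using X[of k] by (simp add: V)
    have dH: "H10 \<Omega> (\<lambda>z. fst (X m) z - fst (X k) z) (\<lambda>z. snd (X m) z - snd (X k) z)" for k m
      using H10_lin[OF XH[of m] XH[of k], of 1 "-1"] by simp
    have fG: "sqint lborel (\<lambda>z. snd (X m) z - snd (X k) z) \<le> 1 * (1/8)^k" if "k \<le> m" for k m
      using fast[OF that] by (simp add: DDD DD_def lin_def)
    have fu: "sqint lborel (\<lambda>z. fst (X m) z - fst (X k) z) \<le> (1 / \<kappa>) * (1/8)^k" if "k \<le> m" for k m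
    proof -
      have "\<kappa> * sqint lborel (\<lambda>z. fst (X m) z - fst (X k) z) \<le> (1/8)^k"
        using poinc[OF dH[of m k]] fG[OF that] by (simp add: LL_def DD_def)
      then show ?thesis
        using \<kappa>(1) by (simp add: pos_le_divide_eq mult.commute[of \<kappa>])
    qed
    obtain u where u: "u \<in> borel_measurable lborel"
      "\<And>k. (nnsqint lborel (\<lambda>x. fst (X k) x - u x)) \<le> ennreal ((1 / \<kappa>) * (1/8)^k)"
      using L2_complete_fast[OF H10_L2(1)[OF XH] _ fu] \<kappa>(1) by auto
    obtain G where G: "G \<in> borel_measurable lborel"
      "\<And>k. (nnsqint lborel (\<lambda>x. snd (X k) x - G x)) \<le> ennreal (1 * (1/8)^k)"
      using L2_complete_fast[OF H10_L2(2)[OF XH] _ fG] by auto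
    have z: "(\<lambda>k. ennreal (B * (1/8)^k)) \<longlonglongrightarrow> 0" for B
    proof -
      have "(\<lambda>k. ennreal (B * (1/8)^k)) \<longlonglongrightarrow> ennreal (B * 0)"
        by (intro tendsto_ennrealI tendsto_mult tendsto_const LIMSEQ_power_zero) auto
      then show ?thesis by simp
    qed
    have lu: "(\<lambda>k. \<integral>\<^sup>+x. ennreal ((norm (fst (X k) x - u x))\<^sup>2) \<partial>lborel) \<longlonglongrightarrow> 0"
      by (rule tendsto_sandwich[OF _ _ tendsto_const z[of "1 / \<kappa>"]], simp, rule always_eventually, rule allI, rule u(2))
    have lG: "(\<lambda>k. \<integral>\<^sup>+x. ennreal ((norm (snd (X k) x - G x))\<^sup>2) \<partial>lborel) \<longlonglongrightarrow> 0"
      by (rule tendsto_sandwich[OF _ _ tendsto_const z[of 1]], simp, rule always_eventually, rule allI, rule G(2))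
    note Lu = L2_of_nn_tendsto[OF H10_L2(1)[OF XH] u(1) lu]
    note LG = L2_of_nn_tendsto[OF H10_L2(2)[OF XH] G(1) lG]
    have "H10 \<Omega> u G" by (rule H10_limit[OF XH Lu(1) LG(1) Lu(2) LG(2)])
    then show "\<exists>x\<in>V. (\<lambda>k. D (lin 1 (X k) (-1) x) (lin 1 (X k) (-1) x)) \<longlonglongrightarrow> 0"
      using LG(2) by (intro bexI[of _ "(u, G)"]) (auto simp: V DDD DD_def lin_def)
  qed (use lam_pos \<delta> M' in auto)
  obtain p where p: "p \<in> V" "l p = 1" "\<And>v. v \<in> V \<Longrightarrow> D p v = lam * S p v"
    "\<And>u. u \<in> V \<Longrightarrow> D u u = lam * S u u \<Longrightarrow> D (lin 1 u (- l u) p) (lin 1 u (- l u) p) \<le> 0"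
    by (rule first_eigenvector, rule that)
  have pH: "H10 \<Omega> (fst p) (snd p)" using p(1) by (simp add: V)
  have "eigenfunction \<Omega> s lam (fst p)"
    unfolding eigenfunction_def
  proof (intro exI[of _ "snd p"] conjI allI impI pH notI)
    assume "AE x in lborel. fst p x = 0"
    then have "AE x in lborel. fst p x * r x = 0" by eventually_elim simp
    then have "l p = 0" unfolding l_def ll_def by (rule integral_eq_zero_AE)
    then show False using p(2) by simp
  next
    fix v assume "test_fun \<Omega> v"
    then have "(v, grad v) \<in> V" by (simp add: V test_fun_H10)
    from p(3)[OF this] show "(LBINT x. snd p x \<bullet> grad v x) = lam * frac_form s (fst p) v"
      by (simp add: D_def S_def frac_form_eq c_def)
  qed
  moreover have "\<exists>t. AE x in lborel. u x = t * fst p x" if u: "eigenfunction \<Omega> s lam u" for u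
  proof -
    obtain G where G: "H10 \<Omega> u G"
      "\<And>v. test_fun \<Omega> v \<Longrightarrow> (LBINT x. G x \<bullet> grad v x) = lam * frac_form s u v"
      using u by (auto simp: eigenfunction_def)
    \<comment> \<open>The eigenvalue equation tested with \<open>u\<close> itself shows that
      \<open>u\<close> annihilates the form, as the uniqueness part of
      \<open>first_eigenvector\<close> requires.\<close>
    have "(LBINT x. G x \<bullet> G x) = (lam * c) * (\<integral>z. fracq s u z \<bullet> fracq s u z \<partial>lborel2)"
      by (rule H10_bilinear_limit[OF G(1) G(1)]) (simp add: G(2) frac_form_eq c_def)
    then have "D (u, G) (u, G) = lam * S (u, G) (u, G)" by (simp add: D_def S_def)
    moreover have uV: "(u, G) \<in> V" using G(1) by (simp add: V)
    ultimately have "D (lin 1 (u, G) (- l (u, G)) p) (lin 1 (u, G) (- l (u, G)) p) \<le> 0" by (intro p(4))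
    moreover define t where "t = l (u, G)"
    ultimately have d: "DD (\<lambda>z. 1 *\<^sub>R G z + (- t) *\<^sub>R snd p z) \<le> 0" by (simp add: DDD lin_def)
    have dH: "H10 \<Omega> (\<lambda>z. 1 * u z + (- t) * fst p z) (\<lambda>z. 1 *\<^sub>R G z + (- t) *\<^sub>R snd p z)"
      by (rule H10_lin[OF G(1) pH])
    \<comment> \<open>The gradient of \<open>u - t p\<close> has norm zero; the Poincare inequality
      passes this on to the function itself.\<close>
    have "\<kappa> * LL (\<lambda>z. 1 * u z + (- t) * fst p z) \<le> 0" using poinc[OF dH] d by linarith
    then have "LL (\<lambda>z. 1 * u z + (- t) * fst p z) = 0"
      using nn(2)[of "\<lambda>z. 1 * u z + (- t) * fst p z"] \<kappa>(1) by (simp add: mult_le_0_iff)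
    then have "AE x in lborel. 1 * u x + (- t) * fst p x = 0"
      using L2_AE_zero[OF H10_L2(1)[OF dH]] by (simp add: LL_def)
    then show ?thesis by (intro exI[of _ t]) (auto elim!: eventually_mono)
  qed
  ultimately show ?thesis unfolding simple_eigenvalue_def lam_def by blast
qed

end

theorem theorem1p7:
  fixes e1 :: "'a::euclidean_space"
  assumes "e1 \<in> Basis"
  shows "\<exists>s0>0. \<forall>s. 0 < s \<and> s < s0 \<longrightarrow> s < 1 \<longrightarrow>
           simple_eigenvalue (Omega_domain e1) s (first_eigenvalue (Omega_domain e1) s)"
proof -
  let ?\<Omega> = "Omega_domain e1"
  obtain \<kappa> \<mu> M and r \<phi> :: "'a \<Rightarrow> real" where
    g: "0 < \<kappa>" "0 < \<mu>" "0 \<le> M" "L2 lborel r"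
    and poinc: "\<And>u. test_fun ?\<Omega> u \<Longrightarrow> \<kappa> * (LBINT x. (u x)\<^sup>2) \<le> sqint lborel (grad u)"
    and gap: "\<And>u. test_fun ?\<Omega> u \<Longrightarrow> \<mu> * (LBINT x. (u x)\<^sup>2)
        \<le> sqint lborel (grad u) + M * (LBINT x. r x * u x)\<^sup>2"
    and \<phi>: "test_fun ?\<Omega> \<phi>" "sqint lborel (grad \<phi>) < \<mu> * (LBINT x. (\<phi> x)\<^sup>2)"
    by (rule Omega_domain_gap[OF assms], rule that)
  define L where "L = (LBINT x. (\<phi> x)\<^sup>2)"
  define D where "D = sqint lborel (grad \<phi>)"
  have "0 \<le> D" by (simp add: D_def)
  then have "0 < \<mu> * L" using \<phi>(2) unfolding L_def D_def by (rule order.strict_trans1)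
  then have L: "0 < L" using g(2) by (simp add: zero_less_mult_iff)
  define q where "q = D / L"
  have q: "0 \<le> q" "q < \<mu>" "D = q * L"
    using L \<open>0 \<le> D\<close> \<phi>(2) by (auto simp: q_def L_def[symmetric] D_def[symmetric] pos_divide_less_eq)
  define \<delta> where "\<delta> = (1 - q / \<mu>) / 2"
  have \<delta>: "0 < \<delta>" using q g(2) by (simp add: \<delta>_def)
  \<comment> \<open>Both balls lie within distance 2 of the origin, so 4 can serve as the radius at
    which the kernel is split.\<close>
  have diam: "norm (x - y) < 4" if "x \<in> ?\<Omega>" "y \<in> ?\<Omega>" for x y :: 'a
  proof -
    have n: "norm z < 2" if "z \<in> ?\<Omega>" for z
    proof -
      have "dist 0 e1 = 1" "dist 0 (- (1/2) *\<^sub>R e1) = 1/2" using assms by (auto simp: dist_norm)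
      then show ?thesis
        using that dist_triangle[of 0 z e1] dist_triangle[of 0 z "- (1/2) *\<^sub>R e1"]
        unfolding Omega_domain_def Un_iff mem_ball by (auto simp: dist_norm)
    qed
    show ?thesis using n[OF that(1)] n[OF that(2)] norm_triangle_ineq4[of x y] by linarith
  qed
  \<comment> \<open>The bound for the ratio of the near to the far part of the kernel tends to 0
    with \<open>s\<close>; apart from \<open>s \<le> 1/2\<close>, this is where \<open>s\<close> has
    to be small.\<close>
  have "((\<lambda>s. q * (4 * 4\<^sup>2 * (1 - 2 powr (- 2 * s)))) \<longlongrightarrow> q * (4 * 4\<^sup>2 * (1 - 2 powr (- 2 * 0)))) (at_right (0::real))"
    by (intro tendsto_intros) auto
  then have "\<forall>\<^sub>F s in at_right (0::real). q * (4 * 4\<^sup>2 * (1 - 2 powr (- 2 * s))) < \<delta>"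
    using \<delta> by (intro order_tendstoD(2)) auto
  then obtain b where b: "0 < b" "\<And>s. 0 < s \<Longrightarrow> s < b \<Longrightarrow> q * (4 * 4\<^sup>2 * (1 - 2 powr (- 2 * s))) < \<delta>"
    by (auto simp: eventually_at_right_field)
  show ?thesis
  proof (intro exI[of _ "min b (1/2)"] conjI allI impI)
    show "0 < min b (1/2)" using b by simp
    fix s :: real assume s: "0 < s \<and> s < min b (1/2)" "s < 1"
    then have s': "0 < s" "s \<le> 1/2" "s < b" by auto
    obtain k1 k2 where kk: "0 \<le> k1" "0 < k2" "k1 \<le> 4 * 4\<^sup>2 * (1 - 2 powr (- 2 * s)) * k2"
      and bounds: "\<And>u. test_fun ?\<Omega> u \<Longrightarrow>
        L2 lborel2 (fracq s u) \<and>
        (sqint lborel2 (fracq s u)) \<le> k1 * sqint lborel (grad u) + 2 * k2 * (LBINT x. (u x)\<^sup>2) \<and>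
        2 * k2 * (LBINT x. (u x)\<^sup>2) \<le> sqint lborel2 (fracq s u)"
      by (rule frac_test_fun_bounds[where \<Omega>="?\<Omega>" and r=4 and s=s], rule s'(1), rule s'(2), simp,
          rule diam, assumption, assumption, rule that)
    interpret frac_setting ?\<Omega> s k1 "2 * k2"
      by unfold_locales (use kk bounds in auto)
    show "simple_eigenvalue ?\<Omega> s (first_eigenvalue ?\<Omega> s)"
    proof (rule simple_of_gap[where r=r and \<phi>\<^sub>0=\<phi> and \<kappa>=\<kappa> and \<mu>=\<mu> and M=M and q=q])
      show "0 < cNs DIM('a) s" using s by (intro cNs_pos) auto
      have "q * k1 \<le> q * (4 * 4\<^sup>2 * (1 - 2 powr (- 2 * s)) * k2)" using kk(3) q(1) by (rule mult_left_mono)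
      also have "\<dots> = q * (4 * 4\<^sup>2 * (1 - 2 powr (- 2 * s))) * k2" by simp
      also have "\<dots> \<le> \<delta> * k2" using b(2)[OF s'(1,3)] kk(2) by (intro mult_right_mono) auto
      also have "\<dots> \<le> \<delta> * (2 * k2)" using \<delta> kk(2) by simp
      finally show "q * k1 \<le> (1 - q / \<mu>) / 2 * (2 * k2)" unfolding \<delta>_def .
    qed (use g poinc gap \<phi> bounds kk(2) L q in \<open>auto simp: L_def[symmetric] D_def[symmetric] mult.commute[of _ "r _"]\<close>)
  qed
qed

end
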